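(* Let $D$ be a unital, simple, stably finite $C^*$-algebra with $\operatorname{QT}^1_2(D)\neq\varnothing$. If $\operatorname{rc}_{\mathrm p}(D)<\infty$, then $D\otimes\mathcal K$ has no maximal ideals and its Pedersen ideal is proper, i.e. $\operatorname{Ped}(D\otimes\mathcal K)\neq D\otimes\mathcal K$. In particular, this holds when $\operatorname{rc}(D)<\infty$, hence when $D$ has strict comparison.
   Context: $\mathcal K$ is the algebra of compact operators on a separable infinite-dimensional Hilbert space. Ideals are complex-linear two-sided ideals, not assumed norm closed. A proper ideal $J$ of $A$ satisfies $0\subsetneq J\subsetneq A$; a maximal ideal is one that is maximal among the proper ideals. A $C^*$-algebra is simple if it has no nonzero proper closed ideals. $\operatorname{Ped}(A)$ is the Pedersen ideal, the smallest norm-dense ideal of $A$. For positive $a,b$ in a $C^*$-algebra, $a\precsim b$ (Cuntz subequivalence) means there are elements $r_n$ of the algebra with $r_n^*br_n\to a$ in norm; for matrices over $D$ of different sizes one compares inside a common matrix algebra (equivalently in $D\otimes\mathcal K$). $M_\infty(D)=\bigcup_nM_n(D)$. A quasitrace on $D$ is a function $\tau:D\to\mathbb C$ with $0\le\tau(x^*x)=\tau(xx^* )$, linear on commutative $*$-subalgebras, and $\tau(a+ib)=\tau(a)+i\tau(b)$ for self-adjoint $a,b$; it is a $2$-quasitrace if it extends to a quasitrace on $M_2(D)$. $\operatorname{QT}^1_2(D)$ is the set of $2$-quasitraces with $\tau(1_D)=1$; these extend canonically (unnormalized) to matrices over $D$, and $d_\tau(a)=\lim_n\tau(a^{1/n})$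 for $a\in M_\infty(D)_+$. For $r\ge0$, $D$ has $r$-comparison if for all $a,b\in M_\infty(D)_+$: $d_\tau(a)+r<d_\tau(b)$ for all $\tau\in\operatorname{QT}^1_2(D)$ implies $a\precsim b$. The radius of comparison is $\operatorname{rc}(D)=\inf\{r\ge0: D\text{ has }r\text{-comparison}\}$ ($\inf\varnothing=\infty$). $D$ has strict comparison if it has $0$-comparison. The restricted projection radius $\operatorname{rc}_{\mathrm p}(D)$ is the infimum of the $r\ge0$ such that for every projection $q\in M_\infty(D)$ and every $b\in M_\infty(D)_+$: $d_\tau(q)+r<d_\tau(b)$ for all $\tau\in\operatorname{QT}^1_2(D)$ implies $q\precsim b$ ($\inf\varnothing=\infty$). *)

theory Defs
  imports "HOL-Analysis.Analysis"
begin

section \<open>Complex vector spaces, Hilbert spaces and C*-algebras\<close>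

class complex_vector = real_vector +
  fixes scaleC :: "complex \<Rightarrow> 'a \<Rightarrow> 'a" (infixr "*\<^sub>C" 75)
  assumes scaleC_add_right: "c *\<^sub>C (x + y) = c *\<^sub>C x + c *\<^sub>C y"
    and scaleC_add_left: "(c + d) *\<^sub>C x = c *\<^sub>C x + d *\<^sub>C x"
    and scaleC_scaleC: "c *\<^sub>C d *\<^sub>C x = (c * d) *\<^sub>C x"
    and scaleC_of_real: "complex_of_real r *\<^sub>C x = r *\<^sub>R x"

class complex_hilbert_space = complex_vector + banach +
  fixes cinner :: "'a \<Rightarrow> 'a \<Rightarrow> complex"
  assumes cinner_commute: "cinner x y = cnj (cinner y x)"
    and cinner_add_right: "cinner x (y + z) = cinner x y + cinner x z"
    and cinner_scaleC_right: "cinner x (c *\<^sub>C y) = c * cinner x y"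
    and cinner_norm: "cinner x x = complex_of_real ((norm x)\<^sup>2)"

class star_algebra = complex_vector + real_algebra +
  fixes adj :: "'a \<Rightarrow> 'a"
  assumes mult_scaleC_left: "(c *\<^sub>C x) * y = c *\<^sub>C (x * y)"
    and mult_scaleC_right: "x * (c *\<^sub>C y) = c *\<^sub>C (x * y)"
    and adj_adj: "adj (adj x) = x"
    and adj_add: "adj (x + y) = adj x + adj y"
    and adj_scaleC: "adj (c *\<^sub>C x) = cnj c *\<^sub>C adj x"
    and adj_mult: "adj (x * y) = adj y * adj x"

lemma scaleC_zero [simp]: "c *\<^sub>C (0::'b::complex_vector) = 0"
  using scaleC_add_right[of c "0::'b" 0] by simp

lemma adj_zero [simp]: "adj (0::'b::star_algebra) = 0"
  using adj_add[of "0::'b" 0] by simp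

lemma adj_sum: "adj (sum f A) = (\<Sum>k\<in>A. adj (f k :: 'b::star_algebra))"
  by (induction A rule: infinite_finite_induct) (auto simp: adj_add)

lemma scaleC_sum: "c *\<^sub>C sum f A = (\<Sum>k\<in>A. c *\<^sub>C (f k :: 'b::complex_vector))"
  by (induction A rule: infinite_finite_induct) (auto simp: scaleC_add_right)

class cstar_algebra = star_algebra + real_normed_algebra + banach +
  assumes norm_scaleC: "norm (c *\<^sub>C x) = cmod c * norm x"
    and cstar_identity: "norm (adj x * x) = (norm x)\<^sup>2"

class unital_cstar_algebra = cstar_algebra + real_normed_algebra_1

definition star_subalgebra :: "'a::star_algebra set \<Rightarrow> bool" where
  "star_subalgebra B \<longleftrightarrow> 0 \<in> B \<and> (\<forall>x\<in>B. \<forall>y\<in>B. x + y \<in> B \<and> x * y \<in> B)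
     \<and> (\<forall>c. \<forall>x\<in>B. c *\<^sub>C x \<in> B) \<and> (\<forall>x\<in>B. adj x \<in> B)"

text \<open>Applied to a C*-algebra or to matrices over one, where the elements of this form are the
  positive ones.\<close>

definition positive :: "'a::star_algebra \<Rightarrow> bool" where
  "positive a \<longleftrightarrow> (\<exists>x. a = adj x * x)"

definition projection :: "'a::star_algebra \<Rightarrow> bool" where
  "projection q \<longleftrightarrow> adj q = q \<and> q * q = q"

section \<open>Ideals\<close>

definition two_sided_ideal :: "'a::star_algebra set \<Rightarrow> bool" where
  "two_sided_ideal I \<longleftrightarrow> 0 \<in> I \<and> (\<forall>x\<in>I. \<forall>y\<in>I. x + y \<in> I) \<and> (\<forall>c. \<forall>x\<in>I. c *\<^sub>C x \<in> I)
     \<and> (\<forall>x\<in>I. \<forall>a. a * x \<in> I \<and> x * a \<in> I)"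

definition proper_ideal :: "'a::star_algebra set \<Rightarrow> bool" where
  "proper_ideal J \<longleftrightarrow> two_sided_ideal J \<and> {0} \<subset> J \<and> J \<subset> UNIV"

definition maximal_ideal :: "'a::star_algebra set \<Rightarrow> bool" where
  "maximal_ideal J \<longleftrightarrow> proper_ideal J \<and> (\<forall>I. proper_ideal I \<and> J \<subseteq> I \<longrightarrow> I = J)"

definition simple_cstar_algebra :: "'a::cstar_algebra itself \<Rightarrow> bool" where
  "simple_cstar_algebra _ \<longleftrightarrow> \<not> (\<exists>I::'a set. proper_ideal I \<and> closed I)"

text \<open>\<open>LEAST\<close> is the smallest dense ideal with respect to inclusion; it exists in every C*-algebra
  by a theorem of Pedersen.\<close>

definition Ped :: "'a::cstar_algebra set" where
  "Ped = (LEAST I. two_sided_ideal I \<and> closure I = UNIV)"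

section \<open>Matrices over a *-algebra\<close>

text \<open>\<open>'d minf\<close> is the *-algebra of all matrices indexed by \<open>nat \<times> nat\<close> with finitely many
  nonzero entries, i.e. the union of the matrix algebras under the upper left corner embeddings;
  \<open>Mat n\<close> is the copy of the \<open>n \<times> n\<close> matrices inside it.\<close>

typedef (overloaded) 'd minf =
  "{x :: nat \<Rightarrow> nat \<Rightarrow> 'd::zero. \<exists>n. \<forall>i j. x i j \<noteq> 0 \<longrightarrow> i < n \<and> j < n}"
  morphisms entry Abs_minf
  by (rule exI[of _ "\<lambda>_ _. 0"]) simp

setup_lifting type_definition_minf

definition Mat :: "nat \<Rightarrow> 'd::zero minf set" where
  "Mat n = {x. \<forall>i j. entry x i j \<noteq> 0 \<longrightarrow> i < n \<and> j < n}"

lemma minf_eqI: "(\<And>i j. entry x i j = entry y i j) \<Longrightarrow> x = y"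
  by (simp add: entry_inject[symmetric] fun_eq_iff)

lemma Mat_mono: "x \<in> Mat m \<Longrightarrow> m \<le> n \<Longrightarrow> x \<in> Mat n"
  by (force simp: Mat_def)

lemma ex_Mat: "\<exists>n. x \<in> Mat n"
  using entry[of x] by (simp add: Mat_def)

lemma ex_Mat3: "\<exists>n. x \<in> Mat n \<and> y \<in> Mat n \<and> z \<in> Mat n"
proof -
  obtain k l m where "x \<in> Mat k" "y \<in> Mat l" "z \<in> Mat m"
    using ex_Mat by metis
  then show ?thesis
    by (intro exI[of _ "max k (max l m)"]) (auto intro: Mat_mono)
qed

lift_definition matrix_unit :: "nat \<Rightarrow> nat \<Rightarrow> 'd::zero \<Rightarrow> 'd minf"
  is "\<lambda>i j d k l. if k = i \<and> l = j then d else 0"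
  subgoal for i j d by (rule exI[of _ "Suc (max i j)"]) (simp add: less_Suc_eq_le)
  done

instantiation minf :: (star_algebra) star_algebra
begin

lift_definition zero_minf :: "'a minf" is "\<lambda>i j. 0" by simp

lift_definition plus_minf :: "'a minf \<Rightarrow> 'a minf \<Rightarrow> 'a minf"
  is "\<lambda>x y i j. x i j + y i j"
proof -
  fix x y :: "nat \<Rightarrow> nat \<Rightarrow> 'a"
  assume "\<exists>n. \<forall>i j. x i j \<noteq> 0 \<longrightarrow> i < n \<and> j < n" "\<exists>n. \<forall>i j. y i j \<noteq> 0 \<longrightarrow> i < n \<and> j < n"
  then obtain m n where mn: "\<And>i j. x i j \<noteq> 0 \<Longrightarrow> i < m \<and> j < m" "\<And>i j. y i j \<noteq> 0 \<Longrightarrow> i < n \<and> j < n"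
    by blast
  have "i < max m n \<and> j < max m n" if "x i j + y i j \<noteq> 0" for i j
    using mn[of i j] that by (cases "x i j = 0") auto
  then show "\<exists>n. \<forall>i j. x i j + y i j \<noteq> 0 \<longrightarrow> i < n \<and> j < n"
    by blast
qed

lift_definition uminus_minf :: "'a minf \<Rightarrow> 'a minf" is "\<lambda>x i j. - x i j" by simp

definition minus_minf :: "'a minf \<Rightarrow> 'a minf \<Rightarrow> 'a minf" where
  "minus_minf x y = x + - y"

lift_definition scaleC_minf :: "complex \<Rightarrow> 'a minf \<Rightarrow> 'a minf" is "\<lambda>c x i j. c *\<^sub>C x i j"
proof -
  fix c and x :: "nat \<Rightarrow> nat \<Rightarrow> 'a"
  assume "\<exists>n. \<forall>i j. x i j \<noteq> 0 \<longrightarrow> i < n \<and> j < n"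
  moreover have "c *\<^sub>C x i j \<noteq> 0 \<longrightarrow> x i j \<noteq> 0" for i j by auto
  ultimately show "\<exists>n. \<forall>i j. c *\<^sub>C x i j \<noteq> 0 \<longrightarrow> i < n \<and> j < n" by blast
qed

definition scaleR_minf :: "real \<Rightarrow> 'a minf \<Rightarrow> 'a minf" where
  "scaleR_minf r x = complex_of_real r *\<^sub>C x"

lift_definition adj_minf :: "'a minf \<Rightarrow> 'a minf" is "\<lambda>x i j. adj (x j i)"
proof -
  fix x :: "nat \<Rightarrow> nat \<Rightarrow> 'a"
  assume "\<exists>n. \<forall>i j. x i j \<noteq> 0 \<longrightarrow> i < n \<and> j < n"
  moreover have "adj (x j i) \<noteq> 0 \<longrightarrow> x j i \<noteq> 0" for i j by auto
  ultimately show "\<exists>n. \<forall>i j. adj (x j i) \<noteq> 0 \<longrightarrow> i < n \<and> j < n" by blast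
qed

lift_definition times_minf :: "'a minf \<Rightarrow> 'a minf \<Rightarrow> 'a minf"
  is "\<lambda>x y i j. \<Sum>k | x i k \<noteq> 0. x i k * y k j"
proof -
  fix x y :: "nat \<Rightarrow> nat \<Rightarrow> 'a"
  assume "\<exists>n. \<forall>i j. x i j \<noteq> 0 \<longrightarrow> i < n \<and> j < n" "\<exists>n. \<forall>i j. y i j \<noteq> 0 \<longrightarrow> i < n \<and> j < n"
  then obtain m n where mn: "\<And>i j. x i j \<noteq> 0 \<Longrightarrow> i < m \<and> j < m" "\<And>i j. y i j \<noteq> 0 \<Longrightarrow> i < n \<and> j < n"
    by blast
  have "i < max m n \<and> j < max m n" if s: "(\<Sum>k | x i k \<noteq> 0. x i k * y k j) \<noteq> 0" for i j
  proof -
    obtain k where "x i k * y k j \<noteq> 0"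
      using s by (rule sum.not_neutral_contains_not_neutral)
    then have "x i k \<noteq> 0" "y k j \<noteq> 0" by auto
    then show ?thesis using mn(1)[of i k] mn(2)[of k j] by (simp add: less_max_iff_disj)
  qed
  then show "\<exists>n. \<forall>i j. (\<Sum>k | x i k \<noteq> 0. x i k * y k j) \<noteq> 0 \<longrightarrow> i < n \<and> j < n"
    by blast
qed

lemma entry_times:
  assumes "x \<in> Mat n"
  shows "entry (x * y) i j = (\<Sum>k<n. entry x i k * entry y k j)"
  unfolding times_minf.rep_eq
  by (rule sum.mono_neutral_left) (use assms in \<open>auto simp: Mat_def\<close>)

lemma times_Mat: 
  assumes "x \<in> Mat n" "y \<in> Mat n" shows "x * y \<in> Mat n"
  unfolding Mat_def
proof (clarify)
  fix i j assume "entry (x * y) i j \<noteq> 0"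
  then obtain k where "entry x i k * entry y k j \<noteq> 0"
    unfolding entry_times[OF assms(1)] by (rule sum.not_neutral_contains_not_neutral)
  then have "entry x i k \<noteq> 0" "entry y k j \<noteq> 0" by auto
  with assms show "i < n \<and> j < n" by (auto simp: Mat_def)
qed

lemma plus_Mat: "x \<in> Mat n \<Longrightarrow> y \<in> Mat n \<Longrightarrow> x + y \<in> Mat n"
  unfolding Mat_def plus_minf.rep_eq mem_Collect_eq
  by (intro allI impI) (metis add_0)

lemma scaleC_Mat: "x \<in> Mat n \<Longrightarrow> c *\<^sub>C x \<in> Mat n"
  unfolding Mat_def scaleC_minf.rep_eq mem_Collect_eq
  by (intro allI impI) (metis scaleC_zero)

lemma adj_Mat: "x \<in> Mat n \<Longrightarrow> adj x \<in> Mat n"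
  unfolding Mat_def adj_minf.rep_eq mem_Collect_eq
  by (intro allI impI) (metis adj_zero)

instance
proof
  fix x y z :: "'a minf" and c d :: complex and r s :: real
  obtain n where n: "x \<in> Mat n" "y \<in> Mat n" "z \<in> Mat n"
    using ex_Mat3 by blast
  note rep = plus_minf.rep_eq zero_minf.rep_eq uminus_minf.rep_eq scaleC_minf.rep_eq adj_minf.rep_eq
  show "x + y + z = x + (y + z)" "x + y = y + x" "0 + x = x" "- x + x = 0"
    by (auto intro!: minf_eqI simp: rep add.assoc add.commute)
  show "x - y = x + - y" by (simp add: minus_minf_def)
  have C1: "c *\<^sub>C (x + y) = c *\<^sub>C x + c *\<^sub>C y" and C2: "(c + d) *\<^sub>C x = c *\<^sub>C x + d *\<^sub>C x"
    and C3: "c *\<^sub>C d *\<^sub>C x = (c * d) *\<^sub>C x" for c d and x y :: "'a minf"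
    by (auto intro!: minf_eqI simp: rep scaleC_add_right scaleC_add_left scaleC_scaleC)
  show "c *\<^sub>C (x + y) = c *\<^sub>C x + c *\<^sub>C y" "(c + d) *\<^sub>C x = c *\<^sub>C x + d *\<^sub>C x"
    "c *\<^sub>C d *\<^sub>C x = (c * d) *\<^sub>C x"
    by (fact C1 C2 C3)+
  show "complex_of_real r *\<^sub>C x = r *\<^sub>R x" by (simp add: scaleR_minf_def)
  show "r *\<^sub>R (x + y) = r *\<^sub>R x + r *\<^sub>R y" "(r + s) *\<^sub>R x = r *\<^sub>R x + s *\<^sub>R x"
    "r *\<^sub>R s *\<^sub>R x = (r * s) *\<^sub>R x"
    by (simp_all add: scaleR_minf_def C1 C2 C3)
  have one: "1 *\<^sub>C u = u" for u :: 'a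
    using scaleC_of_real[of 1 u] by simp
  show "1 *\<^sub>R x = x"
    by (rule minf_eqI) (simp add: scaleR_minf_def rep one)
  show "x * y * z = x * (y * z)"
    by (rule minf_eqI)
      (simp add: entry_times[OF n(1)] entry_times[OF n(2)] entry_times[OF times_Mat[OF n(1,2)]]
        sum_distrib_left sum_distrib_right mult.assoc, rule sum.swap)
  show "(x + y) * z = x * z + y * z" "x * (y + z) = x * y + x * z"
    by (auto intro!: minf_eqI simp: rep entry_times[OF n(1)] entry_times[OF n(2)]
        entry_times[OF plus_Mat[OF n(1,2)]] distrib_left distrib_right sum.distrib)
  have M1: "(c *\<^sub>C x) * y = c *\<^sub>C (x * y)" and M2: "x * (c *\<^sub>C y) = c *\<^sub>C (x * y)" for c
    by (auto intro!: minf_eqI simp: rep entry_times[OF n(1)] entry_times[OF scaleC_Mat[OF n(1)]]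
        mult_scaleC_left mult_scaleC_right scaleC_sum)
  show "(c *\<^sub>C x) * y = c *\<^sub>C (x * y)" "x * (c *\<^sub>C y) = c *\<^sub>C (x * y)"
    by (fact M1 M2)+
  show "r *\<^sub>R x * y = r *\<^sub>R (x * y)" "x * r *\<^sub>R y = r *\<^sub>R (x * y)"
    by (simp_all add: scaleR_minf_def M1 M2)
  show "adj (adj x) = x" "adj (x + y) = adj x + adj y" "adj (c *\<^sub>C x) = cnj c *\<^sub>C adj x"
    by (auto intro!: minf_eqI simp: rep adj_adj adj_add adj_scaleC)
  show "adj (x * y) = adj y * adj x"
    by (auto intro!: minf_eqI simp: rep entry_times[OF n(1)] entry_times[OF adj_Mat[OF n(2)]]
        adj_sum adj_mult)
qed

end

text \<open>The C*-norm of \<open>Mat n\<close>: a matrix acts on the Hilbert module of columns \<open>v\<close> of length \<open>n\<close>,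
  whose norm is the square root of the norm of \<open>\<Sum>i. adj (v i) * v i\<close>, and the norm of the
  matrix is its operator norm.\<close>

definition col_norm :: "nat \<Rightarrow> (nat \<Rightarrow> 'd::cstar_algebra) \<Rightarrow> real" where
  "col_norm n v = sqrt (norm (\<Sum>i<n. adj (v i) * v i))"

definition mat_norm :: "nat \<Rightarrow> 'd::cstar_algebra minf \<Rightarrow> real" where
  "mat_norm n x = (SUP v\<in>{v. col_norm n v \<le> 1}. col_norm n (\<lambda>i. \<Sum>j<n. entry x i j * v j))"

definition one_mat :: "nat \<Rightarrow> 'd::unital_cstar_algebra minf" where
  "one_mat n = (\<Sum>i<n. matrix_unit i i 1)"

definition stably_finite :: "'d::unital_cstar_algebra itself \<Rightarrow> bool" where
  "stably_finite _ \<longleftrightarrow> (\<forall>n. \<forall>v\<in>Mat n. adj v * v = (one_mat n :: 'd minf) \<longrightarrow> v * adj v = one_mat n)"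

definition cuntz_le :: "'d::cstar_algebra minf \<Rightarrow> 'd minf \<Rightarrow> bool" where
  "cuntz_le a b \<longleftrightarrow> (\<exists>n. a \<in> Mat n \<and> b \<in> Mat n \<and>
     (\<exists>r. (\<forall>k. r k \<in> Mat n) \<and> (\<lambda>k. mat_norm n (adj (r k) * b * r k - a)) \<longlonglongrightarrow> 0))"

section \<open>Quasitraces and comparison\<close>

definition quasitrace_on :: "'a::star_algebra set \<Rightarrow> ('a \<Rightarrow> complex) \<Rightarrow> bool" where
  "quasitrace_on S \<tau> \<longleftrightarrow>
     (\<forall>x\<in>S. \<tau> (adj x * x) \<in> \<real>\<^sub>\<ge>\<^sub>0 \<and> \<tau> (adj x * x) = \<tau> (x * adj x)) \<and>
     (\<forall>B. B \<subseteq> S \<and> star_subalgebra B \<and> (\<forall>x\<in>B. \<forall>y\<in>B. x * y = y * x) \<longrightarrow>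
        (\<forall>x\<in>B. \<forall>y\<in>B. \<tau> (x + y) = \<tau> x + \<tau> y) \<and> (\<forall>c. \<forall>x\<in>B. \<tau> (c *\<^sub>C x) = c * \<tau> x)) \<and>
     (\<forall>a\<in>S. \<forall>b\<in>S. adj a = a \<and> adj b = b \<longrightarrow> \<tau> (a + \<i> *\<^sub>C b) = \<tau> a + \<i> * \<tau> b)"

definition extends :: "('d::star_algebra minf \<Rightarrow> complex) \<Rightarrow> ('d \<Rightarrow> complex) \<Rightarrow> bool" where
  "extends T \<tau> \<longleftrightarrow> (\<forall>a. T (matrix_unit 0 0 a) = \<tau> a)"

definition two_quasitrace :: "('d::cstar_algebra \<Rightarrow> complex) \<Rightarrow> bool" where
  "two_quasitrace \<tau> \<longleftrightarrow> quasitrace_on UNIV \<tau> \<and> (\<exists>T. quasitrace_on (Mat 2) T \<and> extends T \<tau>)"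

definition QT21 :: "('d::unital_cstar_algebra \<Rightarrow> complex) set" where
  "QT21 = {\<tau>. two_quasitrace \<tau> \<and> \<tau> 1 = 1}"

text \<open>The canonical unnormalised extension to matrices of all sizes.  By Blackadar and Handelman,
  every 2-quasitrace \<open>\<tau>\<close> has exactly one such \<open>T\<close>, so the quantifier over \<open>T\<close> in \<open>dim_gap\<close> below
  merely names it.\<close>

definition matrix_extension :: "('d::cstar_algebra \<Rightarrow> complex) \<Rightarrow> ('d minf \<Rightarrow> complex) \<Rightarrow> bool" where
  "matrix_extension \<tau> T \<longleftrightarrow> extends T \<tau> \<and> (\<forall>n. quasitrace_on (Mat n) T)"

text \<open>\<open>pos_root n a\<close> is the unique positive \<open>n\<close>-th root of \<open>a\<close> for \<open>n \<ge> 1\<close>; the power is spelled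
  out because \<open>'d minf\<close> has no unit.\<close>

definition pos_root :: "nat \<Rightarrow> 'a::star_algebra \<Rightarrow> 'a" where
  "pos_root n a = (THE b. positive b \<and> (((*) b) ^^ (n - 1)) b = a)"

text \<open>This is \<open>d\<^sub>\<tau>\<close> when \<open>T\<close> is the extension of \<open>\<tau>\<close> to matrices.\<close>

definition dim_fun :: "('d::star_algebra minf \<Rightarrow> complex) \<Rightarrow> 'd minf \<Rightarrow> real" where
  "dim_fun T a = lim (\<lambda>n. Re (T (pos_root n a)))"

definition dim_gap :: "real \<Rightarrow> 'd::unital_cstar_algebra minf \<Rightarrow> 'd minf \<Rightarrow> bool" where
  "dim_gap r a b \<longleftrightarrow> (\<forall>\<tau>\<in>QT21. \<forall>T. matrix_extension \<tau> T \<longrightarrow> dim_fun T a + r < dim_fun T b)"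

definition has_comparison :: "'d::unital_cstar_algebra itself \<Rightarrow> real \<Rightarrow> bool" where
  "has_comparison _ r \<longleftrightarrow>
     (\<forall>a b :: 'd minf. positive a \<and> positive b \<and> dim_gap r a b \<longrightarrow> cuntz_le a b)"

definition strict_comparison :: "'d::unital_cstar_algebra itself \<Rightarrow> bool" where
  "strict_comparison D \<longleftrightarrow> has_comparison D 0"

definition rc :: "'d::unital_cstar_algebra itself \<Rightarrow> ereal" where
  "rc D = Inf {ereal r | r. 0 \<le> r \<and> has_comparison D r}"

definition rc_p :: "'d::unital_cstar_algebra itself \<Rightarrow> ereal" where
  "rc_p _ = Inf {ereal r | r. 0 \<le> r \<and>
     (\<forall>q b :: 'd minf. projection q \<and> positive b \<and> dim_gap r q b \<longrightarrow> cuntz_le q b)}"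

section \<open>Stabilisation\<close>

text \<open>\<open>span\<close> is the real span here and below; this makes no difference, neither for
  finite-dimensionality nor for the span of the elementary tensors in \<open>stabilisation\<close>.\<close>

definition separable_infinite_dim :: "'h::complex_hilbert_space itself \<Rightarrow> bool" where
  "separable_infinite_dim _ \<longleftrightarrow>
     (\<exists>S::'h set. countable S \<and> closure S = UNIV) \<and> \<not> (\<exists>B::'h set. finite B \<and> span B = UNIV)"

definition compact_operators :: "('h::complex_hilbert_space \<Rightarrow> 'h) set" where
  "compact_operators = {f. (\<forall>x y. f (x + y) = f x + f y) \<and> (\<forall>c x. f (c *\<^sub>C x) = c *\<^sub>C f x)
     \<and> compact (closure (f ` cball 0 1))}"

text \<open>\<open>stabilisation \<phi>\<close> states that the C*-algebra \<open>'a\<close> is the C*-tensor product of \<open>'d\<close> with the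
  compact operators, with \<open>\<phi> d k\<close> the elementary tensor of \<open>d\<close> and \<open>k\<close>: \<open>\<phi>\<close> induces an
  injective *-homomorphism with dense range on the algebraic tensor product (injectivity being
  tested on sums over linearly independent families of operators).  The compact operators are
  nuclear, so the C*-norm on the algebraic tensor product is unique, and with it \<open>'a\<close> up to
  isomorphism.\<close>

definition stabilisation ::
    "('d::cstar_algebra \<Rightarrow> ('h::complex_hilbert_space \<Rightarrow> 'h) \<Rightarrow> 'a::cstar_algebra) \<Rightarrow> bool" where
  "stabilisation \<phi> \<longleftrightarrow>
     (\<forall>k\<in>compact_operators. \<forall>d e. \<phi> (d + e) k = \<phi> d k + \<phi> e k) \<and>
     (\<forall>k\<in>compact_operators. \<forall>c d. \<phi> (c *\<^sub>C d) k = c *\<^sub>C \<phi> d k) \<and>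
     (\<forall>k\<in>compact_operators. \<forall>l\<in>compact_operators. \<forall>d. \<phi> d (\<lambda>x. k x + l x) = \<phi> d k + \<phi> d l) \<and>
     (\<forall>k\<in>compact_operators. \<forall>c d. \<phi> d (\<lambda>x. c *\<^sub>C k x) = c *\<^sub>C \<phi> d k) \<and>
     (\<forall>k\<in>compact_operators. \<forall>l\<in>compact_operators. \<forall>d e. \<phi> (d * e) (k \<circ> l) = \<phi> d k * \<phi> e l) \<and>
     (\<forall>k\<in>compact_operators. \<forall>l\<in>compact_operators. (\<forall>x y. cinner (k x) y = cinner x (l y)) \<longrightarrow>
        (\<forall>d. \<phi> (adj d) l = adj (\<phi> d k))) \<and>
     (\<forall>F d. finite F \<and> F \<subseteq> compact_operators \<and>
        (\<forall>c. (\<forall>x. (\<Sum>k\<in>F. c k *\<^sub>C k x) = 0) \<longrightarrow> (\<forall>k\<in>F. c k = 0)) \<and>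
        (\<Sum>k\<in>F. \<phi> (d k) k) = 0 \<longrightarrow> (\<forall>k\<in>F. d k = 0)) \<and>
     closure (span {\<phi> d k | d k. k \<in> compact_operators}) = UNIV"

end

theory Submission
  imports Defs "HOL-Computational_Algebra.Polynomial"
begin

text \<open>Write \<open>A\<close> for the stabilisation and \<open>P n\<close> for the unit of the \<open>n \<times> n\<close> matrices over \<open>D\<close> inside it.
  The hypothesis enters through one lemma: if \<open>z\<close> has range in \<open>P R\<close> and \<open>N > K + r + R\<close>, then
  there is an isometry \<open>t\<close> from \<open>P K\<close> into \<open>P N\<close> with \<open>z t\<close> arbitrarily small.  Indeed, cut \<open>z*z\<close>
  down to its spectral part near \<open>0\<close>; every normalised quasitrace gives this part a dimension of at
  least \<open>N - R\<close>, so that \<open>P K\<close> is Cuntz below it.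

  The Pedersen ideal is the algebraic ideal generated by \<open>P 1\<close>.  It does not contain the strictly
  positive element \<open>a = \<Sum>i. 2\<^sup>-\<^sup>i (P (i+1) - P i)\<close>: a sum of \<open>m\<close> terms \<open>x\<^sub>i P 1 y\<^sub>i\<close> has rank at most
  \<open>m\<close>, so it almost vanishes on some isometry into \<open>P N\<close>, whereas \<open>a\<close> is bounded below on \<open>P N\<close>.

  Let \<open>J\<close> be a maximal ideal.  As every element factors through some
  \<open>\<Sum>i. c\<^sup>i (P (n (i+1)) - P (n i))\<close>, some diagonal element \<open>l\<close> of this form satisfies
  \<open>l\<^sup>3 \<notin> J\<close>, so that \<open>A = J + A l A\<close>.  Now let \<open>b = \<Sum>j. 2\<^sup>-\<^sup>j (P (N (j+1)) - P (N j))\<close> with \<open>N\<close> growing so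
  fast that, for \<open>b = y + s\<close> with \<open>y \<in> J\<close> and \<open>s \<in> A l A\<close>, there are isometries \<open>t\<^sub>j\<close> from
  \<open>P (n (j+1))\<close> into \<open>P (N (j+1))\<close> almost annihilated by \<open>P (N j)\<close>, \<open>s\<close> and \<open>s*\<close>.  The matrix
  \<open>t\<^sub>i* y t\<^sub>j\<close> is then so close to the diagonal matrix with entries \<open>2\<^sup>-\<^sup>j\<close> that a Neumann series
  yields \<open>\<Sum>j. 8\<^sup>-\<^sup>j (P (n (j+1)) - P (n j)) \<in> J\<close>, and hence \<open>l\<^sup>3 \<in> J\<close>.\<close>

section \<open>Order and continuous functional calculus in unital C*-algebras\<close>

text \<open>The ideals need not be closed, so closeness to \<open>J\<close> is worthless and
  membership must come from an exact factorisation. The isometries do not sum to an element of the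
  algebra; weights 2^-i on either side make the two series converge, and together with the
  eigenvalues of \<open>b\<close> they leave 8^-i on the diagonal. Only after this decay has been
  divided out can an inverse exist, so the error has to be far smaller: with
  \<open>c = 1/256\<close>, the square of 1/16, the error at (i, k) is at most a constant times
  16^-i 16^-k, and the division costs 4^i. The third power of \<open>l\<close> appears because the
  algebra has no unit: what \<open>l\<close> generates consists of sums of products
  \<open>x * l * y\<close>. Quasitraces add up only on commuting elements, and dimensions are limits
  over roots. Every use of additivity therefore concerns commuting elements, mostly functions of a
  single positive one. The functional calculus behind this is developed on the interval [0,1], with
  norm estimates in place of spectra.\<close>

lemma scaleC_one [simp]: "1 *\<^sub>C (x::'a::complex_vector) = x"
  using scaleC_of_real[of 1 x] by simp

lemma scaleC_zero_left [simp]: "0 *\<^sub>C (x::'a::complex_vector) = 0"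
  using scaleC_of_real[of 0 x] by simp

lemma scaleC_minus_left [simp]: "(- c) *\<^sub>C (x::'a::complex_vector) = - (c *\<^sub>C x)"
  using scaleC_add_left[of "-c" c x] by (simp add: eq_neg_iff_add_eq_0)

lemma scaleC_minus_right [simp]: "c *\<^sub>C (- x::'a::complex_vector) = - (c *\<^sub>C x)"
  using scaleC_add_right[of c "-x" x] by (simp add: eq_neg_iff_add_eq_0)

lemma scaleC_diff_right: "c *\<^sub>C (x - y::'a::complex_vector) = c *\<^sub>C x - c *\<^sub>C y"
  using scaleC_add_right[of c x "-y"] by simp

lemma scaleC_scaleR: "c *\<^sub>C r *\<^sub>R (x::'a::complex_vector) = r *\<^sub>R c *\<^sub>C x"
  by (simp add: scaleC_of_real[symmetric] scaleC_scaleC mult.commute)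

lemma adj_minus [simp]: "adj (- x::'a::star_algebra) = - adj x"
  using adj_add[of "-x" x] by (simp add: eq_neg_iff_add_eq_0)

lemma adj_diff: "adj (x - y::'a::star_algebra) = adj x - adj y"
  using adj_add[of x "-y"] by simp

lemma adj_scaleR [simp]: "adj (r *\<^sub>R x::'a::star_algebra) = r *\<^sub>R adj x"
  by (metis adj_scaleC scaleC_of_real complex_cnj_complex_of_real)

lemma adj_one [simp]: "adj (1::'a::unital_cstar_algebra) = 1"
  by (metis adj_adj adj_mult mult_1 mult_1_right)

lemma adj_power [simp]: "adj (x ^ n::'a::unital_cstar_algebra) = adj x ^ n"
  by (induction n) (simp_all add: adj_mult power_commutes)

lemma norm_adj [simp]: "norm (adj x) = norm (x::'a::cstar_algebra)"
proof -
  have "norm x \<le> norm (adj x)" for x :: 'a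
  proof (cases "norm x = 0")
    case False
    have "norm x * norm x \<le> norm (adj x) * norm x"
      using cstar_identity[of x] norm_mult_ineq[of "adj x" x] by (simp add: power2_eq_square)
    then show ?thesis using False by simp
  qed simp
  from this[of x] this[of "adj x"] show ?thesis by (simp add: adj_adj)
qed

lemma cstar_identity': "norm (x * adj x) = (norm (x::'a::cstar_algebra))\<^sup>2"
  using cstar_identity[of "adj x"] by (simp add: adj_adj)

lemma bounded_linear_adj: "bounded_linear (adj :: 'a::cstar_algebra \<Rightarrow> 'a)"
  by (rule bounded_linear_intro[of _ 1]) (auto simp: adj_add)

lemmas continuous_on_adj [continuous_intros] = bounded_linear.continuous_on[OF bounded_linear_adj]
lemmas tendsto_adj [tendsto_intros] = bounded_linear.tendsto[OF bounded_linear_adj]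

lemma adj_mult_self_eq_0: "adj x * x = 0 \<longleftrightarrow> x = (0::'a::cstar_algebra)"
  using cstar_identity[of x] by auto

lemma norm_square_selfadjoint: "adj x = x \<Longrightarrow> norm (x * x) = (norm (x::'a::cstar_algebra))\<^sup>2"
  using cstar_identity[of x] by simp

section \<open>Square roots and the cone of positive elements\<close>

lemma norm_of_real_diff_triangle:
  "norm (of_real s - x) \<le> norm (of_real t - x) + \<bar>s - t\<bar>" for x :: "'a::real_normed_algebra_1"
proof -
  have "norm ((of_real t - x) + of_real (s - t)) \<le> norm (of_real t - x) + norm (of_real (s - t) :: 'a)"
    by (rule norm_triangle_ineq)
  then show ?thesis unfolding of_real_diff[symmetric] norm_of_real by simp
qed

text \<open>The element \<open>s + \<i> r\<close> is a multiple of a unitary.\<close>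

lemma norm_le_of_sum_squares:
  fixes s r :: "'a::unital_cstar_algebra"
  assumes "adj s = s" "adj r = r" "s * r = r * s" "s * s + r * r = of_real t" "0 \<le> t"
  shows "(norm s)\<^sup>2 \<le> t"
proof -
  define u where "u = s + \<i> *\<^sub>C r"
  have au: "adj u = s - \<i> *\<^sub>C r"
    using assms by (simp add: u_def adj_add adj_scaleC)
  have "adj u * u = s * s + r * r"
    unfolding au using assms(3) by (simp add: u_def algebra_simps mult_scaleC_left mult_scaleC_right scaleC_scaleC scaleC_diff_right)
  then have "norm (adj u * u) = t" using assms by (simp)
  then have u: "(norm u)\<^sup>2 = t" by (simp add: cstar_identity)
  have "2 *\<^sub>R s = u + adj u" unfolding au by (simp add: u_def scaleR_2)
  then have "2 * norm s \<le> norm u + norm (adj u)"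
    by (metis norm_scaleR norm_triangle_ineq abs_numeral)
  then have "norm s \<le> norm u" by simp
  then have "(norm s)\<^sup>2 \<le> (norm u)\<^sup>2" by (simp add: power_mono)
  then show ?thesis using u by simp
qed

text \<open>A fixed point \<open>g\<close> of g = (z + g^2)/2 satisfies (1 - g)^2 = 1 - z. On the
  ball of radius \<open>norm z\<close> the map is a contraction. Self-adjointness and commutation
  with everything that commutes with \<open>z\<close> are built into the complete set
  \<open>S\<close>, so the fixed point inherits both.\<close>

lemma sqrt_one_minus:
  fixes z :: "'a::unital_cstar_algebra"
  assumes z: "adj z = z" "norm z < 1"
  obtains r where "adj r = r" "r * r = 1 - z" "\<And>c. c * z = z * c \<Longrightarrow> c * r = r * c"
proof -
  define S where "S = {g. norm g \<le> norm z} \<inter> {g. adj g = g} \<inter> (\<Inter>c\<in>{c. c * z = z * c}. {g. c * g = g * c})"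
  define f where "f g = (1/2) *\<^sub>R (z + g * g)" for g
  have "closed S"
    unfolding S_def by (intro closed_Int closed_INT ballI closed_Collect_le closed_Collect_eq continuous_intros)
  then have "complete S" by (simp add: complete_eq_closed)
  have S: "g \<in> S \<longleftrightarrow> norm g \<le> norm z \<and> adj g = g \<and> (\<forall>c. c * z = z * c \<longrightarrow> c * g = g * c)" for g
    unfolding S_def by auto
  note \<open>complete S\<close>
  moreover have "0 \<in> S" by (simp add: S_def)
  moreover have "f ` S \<subseteq> S"
  proof safe
    fix g assume g: "g \<in> S"
    have "norm (f g) \<le> (norm z + norm (g * g)) / 2"
      using norm_triangle_ineq[of z "g * g"] by (simp add: f_def)
    moreover have "norm (g * g) \<le> norm z * 1"
      by (intro order_trans[OF norm_mult_ineq] mult_mono) (use g z in \<open>auto simp: S_def\<close>)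
    ultimately have "norm (f g) \<le> norm z" by simp
    moreover have "adj (f g) = f g" using conjunct1[OF conjunct2[OF iffD1[OF S g]]] z by (simp add: f_def adj_add adj_mult)
    moreover have "c * f g = f g * c" if c: "c * z = z * c" for c
    proof -
      have "c * g = g * c" using g c unfolding S by blast
      then have "c * (g * g) = g * g * c" by (metis mult.assoc)
      then show ?thesis using c by (simp add: f_def distrib_left distrib_right)
    qed
    ultimately show "f g \<in> S" unfolding S by blast
  qed
  moreover have "\<forall>x\<in>S. \<forall>y\<in>S. dist (f x) (f y) \<le> norm z * dist x y"
  proof safe
    fix x y assume xy: "x \<in> S" "y \<in> S"
    have "f x - f y = (1/2) *\<^sub>R (x * x - y * y)"
      by (simp add: f_def scaleR_diff_right scaleR_add_right)
    also have "x * x - y * y = (x - y) * x + y * (x - y)" by (simp add: algebra_simps)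
    finally have "norm (f x - f y) = norm ((x - y) * x + y * (x - y)) / 2" by simp
    also have "\<dots> \<le> (norm (x - y) * norm x + norm y * norm (x - y)) / 2"
      by (intro divide_right_mono order_trans[OF norm_triangle_ineq] add_mono norm_mult_ineq) auto
    also have "\<dots> \<le> (norm (x - y) * norm z + norm z * norm (x - y)) / 2"
      by (intro divide_right_mono add_mono mult_mono) (use xy in \<open>auto simp: S_def\<close>)
    finally show "dist (f x) (f y) \<le> norm z * dist x y" by (simp add: dist_norm)
  qed
  ultimately obtain g where g: "g \<in> S" "f g = g"
    using Banach_fix[of S "norm z" f] z by auto
  show ?thesis
  proof (rule that[of "1 - g"])
    show "adj (1 - g) = 1 - g" using conjunct1[OF conjunct2[OF iffD1[OF S g(1)]]] by (simp add: adj_diff)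
    have "2 *\<^sub>R f g = z + g * g" by (simp add: f_def)
    then have "z + g * g = 2 *\<^sub>R g" using g(2) by simp
    then show "(1 - g) * (1 - g) = 1 - z"
      by (simp add: algebra_simps scaleR_2)
    show "c * (1 - g) = (1 - g) * c" if "c * z = z * c" for c
    proof -
      have "c * g = g * c" using that g(1) unfolding S by blast
      then show ?thesis by (simp add: algebra_simps)
    qed
  qed
qed

text \<open>For self-adjoint \<open>x\<close> the inequality says that the spectrum lies between 0
  and 2t, so positivity is expressed by the norm alone.\<close>

definition nonneg :: "'a::unital_cstar_algebra \<Rightarrow> bool" where
  "nonneg x \<longleftrightarrow> adj x = x \<and> (\<exists>t. norm (of_real t - x) \<le> t)"

lemma nonnegI: "adj x = x \<Longrightarrow> norm (of_real t - x) \<le> t \<Longrightarrow> nonneg x"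
  by (auto simp: nonneg_def)

lemma nonneg_adj: "nonneg x \<Longrightarrow> adj x = x" by (simp add: nonneg_def)

text \<open>Dividing x + e by t + e gives 1 - z with \<open>norm z \<le> t / (t + e)\<close>; the
  shift by \<open>e\<close> buys the strict bound \<open>norm z < 1\<close> under which 1 - z has a
  root.\<close>

lemma nonneg_shift_sqrt:
  fixes x :: "'a::unital_cstar_algebra"
  assumes "nonneg x" "0 < e"
  obtains s where "adj s = s" "s * s = x + of_real e" "\<And>c. c * x = x * c \<Longrightarrow> c * s = s * c"
proof -
  obtain t where t: "norm (of_real t - x) \<le> t" and x: "adj x = x"
    using assms by (auto simp: nonneg_def)
  have t0: "0 \<le> t" using t norm_ge_zero[of "of_real t - x"] by linarith
  define M where "M = t + e"
  have M: "M > 0" using t0 assms by (simp add: M_def)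
  define z where "z = (1/M) *\<^sub>R (of_real t - x)"
  have "norm z \<le> t / M" using t M by (simp add: z_def divide_right_mono)
  also have "t / M < 1" using assms M by (simp add: M_def)
  finally have "norm z < 1" .
  moreover have "adj z = z" using x by (simp add: z_def adj_diff of_real_def)
  ultimately obtain r where r: "adj r = r" "r * r = 1 - z" "\<And>c. c * z = z * c \<Longrightarrow> c * r = r * c"
    using sqrt_one_minus by blast
  show ?thesis
  proof (rule that[of "sqrt M *\<^sub>R r"])
    show "adj (sqrt M *\<^sub>R r) = sqrt M *\<^sub>R r" using r(1) by simp
    have "sqrt M *\<^sub>R r * sqrt M *\<^sub>R r = M *\<^sub>R (r * r)" using M by simp
    also have "\<dots> = x + of_real e"
      using M by (simp add: r(2) z_def scaleR_diff_right of_real_def M_def scaleR_add_left)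
    finally show "sqrt M *\<^sub>R r * sqrt M *\<^sub>R r = x + of_real e" .
    fix c assume "c * x = x * c"
    then have "c * z = z * c" by (simp add: z_def algebra_simps of_real_def)
    then show "c * (sqrt M *\<^sub>R r) = sqrt M *\<^sub>R r * c" using r(3) by simp
  qed
qed

text \<open>With \<open>r\<close> a root of 1 - s^2/t one has s^2 + t r^2 = t, and the norm of t -
  s^2 is the square of the norm of sqrt(t) r, which the sum of squares bounds by t. The root exists
  only for \<open>(norm s)\<^sup>2 < t\<close>; equality is reached in the limit.\<close>

lemma nonneg_square:
  fixes s :: "'a::unital_cstar_algebra"
  assumes s: "adj s = s" "(norm s)\<^sup>2 \<le> t"
  shows "norm (of_real t - s * s) \<le> t"
proof -
  have *: "norm (of_real t - s * s) \<le> t" if t: "(norm s)\<^sup>2 < t" for t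
  proof -
    have t0: "t > 0" using t zero_le_power2[of "norm s"] by linarith
    define z where "z = (1/t) *\<^sub>R (s * s)"
    have "norm z < 1" using t t0 s norm_square_selfadjoint[of s] by (simp add: z_def)
    moreover have "adj z = z" using s by (simp add: z_def adj_mult)
    ultimately obtain r where r: "adj r = r" "r * r = 1 - z" "\<And>c. c * z = z * c \<Longrightarrow> c * r = r * c"
      using sqrt_one_minus by blast
    have "s * z = z * s" by (simp add: z_def mult.assoc)
    then have "s * r = r * s" using r(3) by blast
    moreover have "(sqrt t *\<^sub>R r) * (sqrt t *\<^sub>R r) = of_real t - s * s"
      using t0 r(1,2) by (simp add: z_def scaleR_diff_right of_real_def)
    ultimately have "(norm (sqrt t *\<^sub>R r))\<^sup>2 \<le> t"
      using s(1) r(1,2) t0 by (intro norm_le_of_sum_squares[of _ s]) auto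
    then have "(norm r)\<^sup>2 * t \<le> t" using t0 by (simp add: power_mult_distrib mult.commute)
    have "norm (of_real t - s * s) = norm ((sqrt t *\<^sub>R r) * (sqrt t *\<^sub>R r))"
      using \<open>(sqrt t *\<^sub>R r) * (sqrt t *\<^sub>R r) = of_real t - s * s\<close> by simp
    also have "\<dots> = (norm (sqrt t *\<^sub>R r))\<^sup>2"
      by (rule norm_square_selfadjoint) (use r(1) in simp)
    finally show ?thesis using \<open>(norm (sqrt t *\<^sub>R r))\<^sup>2 \<le> t\<close> by simp
  qed
  show ?thesis
  proof (rule field_le_epsilon)
    fix e :: real assume e: "0 < e"
    have "norm (of_real t - s * s) \<le> norm (of_real (t + e/2) - s * s) + \<bar>t - (t + e/2)\<bar>"
      by (rule norm_of_real_diff_triangle)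
    also have "\<dots> \<le> t + e" using *[of "t + e/2"] s e by simp
    finally show "norm (of_real t - s * s) \<le> t + e" .
  qed
qed

text \<open>Up to a shift by \<open>e\<close>, \<open>x\<close> is a square, and squares satisfy the
  bound for every \<open>t\<close> from their norm on. So the witness in \<open>nonneg\<close> may
  always be the norm itself, which turns the cone into a closed set.\<close>

lemma nonneg_norm_diff:
  fixes x :: "'a::unital_cstar_algebra"
  assumes "nonneg x" "norm x \<le> t"
  shows "norm (of_real t - x) \<le> t"
proof (rule field_le_epsilon)
  fix e :: real assume e: "0 < e"
  obtain s where s: "adj s = s" "s * s = x + of_real (e)"
    using nonneg_shift_sqrt assms e by blast
  have "(norm s)\<^sup>2 = norm (x + of_real e)" using s(1,2) norm_square_selfadjoint[of s] by simp
  also have "\<dots> \<le> t + e" using norm_triangle_ineq[of x "of_real e"] assms e by simp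
  finally have "norm (of_real (t + e) - s * s) \<le> t + e" using s nonneg_square by blast
  then show "norm (of_real t - x) \<le> t + e" using s by (simp add: algebra_simps)
qed

lemma nonneg_iff: "nonneg x \<longleftrightarrow> adj x = x \<and> norm (of_real (norm x) - x) \<le> norm x"
  using nonneg_norm_diff nonnegI nonneg_adj by blast

lemma nonneg_square': "adj s = s \<Longrightarrow> nonneg (s * s)"
  by (rule nonnegI[OF _ nonneg_square[OF _ order_refl]]) (simp_all add: adj_mult)

lemma nonneg_zero [simp]: "nonneg 0" using nonneg_square'[of 0] by simp

lemma nonneg_one [simp]: "nonneg 1" using nonneg_square'[of 1] by simp

lemma nonneg_add: assumes "nonneg x" "nonneg y" shows "nonneg (x + y)"
proof -
  obtain t u where "norm (of_real t - x) \<le> t" "norm (of_real u - y) \<le> u"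
    using assms by (auto simp: nonneg_def)
  then have "norm ((of_real t - x) + (of_real u - y)) \<le> t + u"
    by (rule norm_triangle_mono)
  then show ?thesis using assms
    by (intro nonnegI[of _ "t + u"]) (auto simp: nonneg_adj adj_add algebra_simps)
qed

lemma nonneg_scaleR: assumes "nonneg x" "0 \<le> c" shows "nonneg (c *\<^sub>R x)"
proof -
  obtain t where t: "norm (of_real t - x) \<le> t" using assms by (auto simp: nonneg_def)
  have "norm (of_real (c * t) - c *\<^sub>R x) = c * norm (of_real t - x)"
    using assms(2) by (simp add: of_real_def scaleR_diff_right[symmetric] flip: scaleR_scaleR)
  also have "\<dots> \<le> c * t" using t assms by (simp add: mult_left_mono)
  finally show ?thesis using assms by (intro nonnegI[of _ "c * t"]) (auto simp: nonneg_adj)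
qed

lemma nonneg_of_real: "0 \<le> c \<Longrightarrow> nonneg (of_real c)"
  unfolding of_real_def by (intro nonneg_scaleR nonneg_one)

lemma nonneg_sum: "(\<And>i. i \<in> I \<Longrightarrow> nonneg (f i)) \<Longrightarrow> nonneg (sum f I)"
  by (induction I rule: infinite_finite_induct) (auto intro: nonneg_add)

lemma closed_nonneg: "closed {x::'a::unital_cstar_algebra. nonneg x}"
  unfolding nonneg_iff Collect_conj_eq of_real_def
  by (intro closed_Int closed_Collect_eq closed_Collect_le continuous_intros)

lemma nonneg_of_shifts:
  assumes "\<And>e. 0 < e \<Longrightarrow> nonneg (x + e *\<^sub>R y)" shows "nonneg (x::'a::unital_cstar_algebra)"
proof -
  have "(\<lambda>n. x + (1 / real (Suc n)) *\<^sub>R y) \<longlonglongrightarrow> x + 0 *\<^sub>R y"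
    by (intro tendsto_intros LIMSEQ_Suc lim_1_over_n)
  then have "(\<lambda>n. x + (1 / real (Suc n)) *\<^sub>R y) \<longlonglongrightarrow> x" by simp
  then show ?thesis
    using closed_sequentially[OF closed_nonneg, of "\<lambda>n. x + (1 / real (Suc n)) *\<^sub>R y" x] assms by simp
qed

text \<open>The roots \<open>s\<close>, \<open>r\<close> of the shifted factors inherit commutation,
  so the shifted product is the square of s r. The two shifts are removed one after the other
  because the cone is closed.\<close>

lemma nonneg_mult_commute:
  fixes x y :: "'a::unital_cstar_algebra"
  assumes "nonneg x" "nonneg y" "x * y = y * x"
  shows "nonneg (x * y)"
proof -
  have *: "nonneg ((x + of_real e) * (y + of_real d))" if e: "0 < e" and d: "0 < d" for e d
  proof -
    obtain s where s: "adj s = s" "s * s = x + of_real e" "\<And>c. c * x = x * c \<Longrightarrow> c * s = s * c"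
      using nonneg_shift_sqrt[OF assms(1) e] by blast
    obtain r where r: "adj r = r" "r * r = y + of_real d" "\<And>c. c * y = y * c \<Longrightarrow> c * r = r * c"
      using nonneg_shift_sqrt[OF assms(2) d] by blast
    have "s * y = y * s" using s(3)[of y] assms by simp
    then have rs: "s * r = r * s" using r(3) by blast
    then have "nonneg ((s * r) * (s * r))" using s(1) r(1) by (intro nonneg_square') (simp add: adj_mult)
    moreover have "(s * r) * (s * r) = (s * s) * (r * r)" using rs by (metis mult.assoc)
    ultimately show ?thesis by (simp add: s(2) r(2))
  qed
  have **: "nonneg (x * (y + of_real d))" if "0 < d" for d
  proof (rule nonneg_of_shifts)
    fix e :: real assume "0 < e"
    from *[OF this that] show "nonneg (x * (y + of_real d) + e *\<^sub>R (y + of_real d))"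
      by (simp add: distrib_right of_real_def)
  qed
  show ?thesis
  proof (rule nonneg_of_shifts)
    fix e :: real assume "0 < e"
    from **[OF this] show "nonneg (x * y + e *\<^sub>R x)"
      by (simp add: distrib_left of_real_def)
  qed
qed

lemma nonneg_power: "nonneg x \<Longrightarrow> nonneg (x ^ n)"
  by (induction n) (auto intro: nonneg_mult_commute simp: power_commutes)

text \<open>The commuting factors M - x and M + x multiply to M^2 - x^2. Up to \<open>e\<close> this
  is a square r^2 with \<open>r\<close> commuting with \<open>x\<close>, and x^2 + r^2 = M^2 + e
  bounds the norm of \<open>x\<close>.\<close>

lemma nonneg_bound_norm:
  fixes x :: "'a::unital_cstar_algebra"
  assumes "nonneg (of_real M - x)" "nonneg (of_real M + x)" "0 \<le> M"
  shows "norm x \<le> M"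
proof -
  have x: "adj x = x"
    using nonneg_adj[OF assms(2)] by (simp add: adj_add of_real_def)
  have "nonneg ((of_real M - x) * (of_real M + x))"
    using assms by (intro nonneg_mult_commute) (auto simp: algebra_simps of_real_def)
  then have n: "nonneg (of_real (M\<^sup>2) - x * x)"
    by (simp add: algebra_simps of_real_def power2_eq_square)
  have "(norm x)\<^sup>2 \<le> M\<^sup>2"
  proof (rule field_le_epsilon)
    fix e :: real assume e: "0 < e"
    obtain r where r: "adj r = r" "r * r = of_real (M\<^sup>2) - x * x + of_real e"
      "\<And>c. c * (of_real (M\<^sup>2) - x * x) = (of_real (M\<^sup>2) - x * x) * c \<Longrightarrow> c * r = r * c"
      using nonneg_shift_sqrt[OF n e] by blast
    have "x * r = r * x" by (rule r(3)) (simp add: algebra_simps of_real_def)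
    then show "(norm x)\<^sup>2 \<le> M\<^sup>2 + e"
      using x r(1,2) e by (intro norm_le_of_sum_squares[of x r]) (auto simp: of_real_def scaleR_add_left)
  qed
  then show ?thesis using assms(3) by (rule power2_le_imp_le)
qed

lemma nonneg_norm_minus:
  assumes "adj x = x" "norm x \<le> M" shows "nonneg (of_real M - x)"
  by (rule nonnegI[of _ M]) (use assms in \<open>auto simp: adj_diff of_real_def\<close>)

lemma nonneg_norm_mono:
  fixes x y :: "'a::unital_cstar_algebra"
  assumes "nonneg x" "nonneg (y - x)"
  shows "norm x \<le> norm y"
proof (rule nonneg_bound_norm)
  have "nonneg y" using nonneg_add[OF assms] by simp
  then have "nonneg (of_real (norm y) - y)" by (intro nonneg_norm_minus nonneg_adj) auto
  from nonneg_add[OF this assms(2)] show "nonneg (of_real (norm y) - x)" by simp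
  show "nonneg (of_real (norm y) + x)" by (intro nonneg_add nonneg_of_real assms) auto
qed auto

lemma nonneg_antisym: "nonneg x \<Longrightarrow> nonneg (- x) \<Longrightarrow> x = 0"
  using nonneg_bound_norm[of 0 x] by simp

section \<open>Polynomials of an element and Bernstein polynomials\<close>

definition peval :: "real poly \<Rightarrow> 'a::real_algebra_1 \<Rightarrow> 'a" where
  "peval p x = fold_coeffs (\<lambda>a b. of_real a + x * b) p 0"

lemma peval_0 [simp]: "peval 0 x = 0" by (simp add: peval_def)

lemma peval_pCons [simp]: "peval (pCons a p) x = of_real a + x * peval p x"
  by (cases "p = 0 \<and> a = 0") (auto simp: peval_def)

lemma peval_add: "peval (p + q) x = peval p x + peval q x"
  by (induction p q rule: poly_induct2) (auto simp: algebra_simps)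

lemma peval_smult: "peval (smult c p) x = c *\<^sub>R peval p x"
  by (induction p) (auto simp: algebra_simps of_real_def)

lemma peval_mult: "peval (p * q) x = peval p x * peval q x"
  by (induction p) (auto simp: algebra_simps peval_add peval_smult of_real_def)

lemma peval_one [simp]: "peval 1 x = 1" by (simp add: one_pCons)

lemma peval_power: "peval (p ^ n) x = peval p x ^ n"
  by (induction n) (auto simp: peval_mult)

lemma peval_sum: "peval (sum f A) x = (\<Sum>i\<in>A. peval (f i) x)"
  by (induction A rule: infinite_finite_induct) (auto simp: peval_add)

lemma peval_diff: "peval (p - q) x = peval p x - peval q x"
  using peval_add[of "p - q" q x] by (simp add: algebra_simps)

lemma peval_commute: "c * x = x * c \<Longrightarrow> c * peval p x = peval p x * c"
proof (induction p)
  case (pCons a p)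
  then have "c * (x * peval p x) = x * peval p x * c" by (metis mult.assoc)
  then show ?case by (simp add: algebra_simps of_real_def)
qed simp

lemma adj_peval: "adj x = x \<Longrightarrow> adj (peval p x) = peval p (x::'a::unital_cstar_algebra)"
proof (induction p)
  case (pCons a p)
  then show ?case using peval_commute[of x x p] by (simp add: adj_add adj_mult of_real_def)
qed simp

definition bern :: "nat \<Rightarrow> nat \<Rightarrow> real poly" where
  "bern n k = smult (of_nat (n choose k)) ([:0, 1:] ^ k * [:1, -1:] ^ (n - k))"

lemma poly_bern: "poly (bern n k) x = Bernstein n k x"
  by (simp add: bern_def Bernstein_def)

text \<open>Since (k choose j)(n choose k) = (n choose j)(n-j choose k-j), each term is (n choose j)
  x^j times a Bernstein polynomial of degree n - j, and these sum to 1.\<close>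

lemma sum_choose_Bernstein:
  assumes "j \<le> n"
  shows "(\<Sum>k\<le>n. real (k choose j) * Bernstein n k x) = real (n choose j) * x ^ j"
proof -
  have "(\<Sum>k\<le>n. real (k choose j) * Bernstein n k x) = (\<Sum>k=j..n. real (k choose j) * Bernstein n k x)"
    by (rule sum.mono_neutral_right) auto
  also have "\<dots> = (\<Sum>i\<le>n - j. real (n choose j) * x ^ j * Bernstein (n - j) i x)"
  proof (rule sum.reindex_bij_witness[of _ "\<lambda>i. i + j" "\<lambda>k. k - j"])
    fix k assume k: "k \<in> {j..n}"
    have "real (k choose j) * real (n choose k) = real (n choose j) * real ((n - j) choose (k - j))"
      using choose_mult[of j k n] k by (simp flip: of_nat_mult add: mult.commute)
    moreover have "x ^ k = x ^ j * x ^ (k - j)" using k by (simp flip: power_add)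
    ultimately show "real (n choose j) * x ^ j * Bernstein (n - j) (k - j) x = real (k choose j) * Bernstein n k x"
      using k by (simp add: Bernstein_def) 
  qed (use assms in auto)
  also have "\<dots> = real (n choose j) * x ^ j" by (simp flip: sum_distrib_left)
  finally show ?thesis .
qed

lemma sum_choose_bern:
  assumes "j \<le> n"
  shows "(\<Sum>k\<le>n. smult (real (k choose j)) (bern n k)) = smult (real (n choose j)) (monom 1 j)"
  by (subst poly_eq_poly_eq_iff[symmetric])
    (simp add: fun_eq_iff poly_sum poly_bern poly_monom sum_choose_Bernstein[OF assms])

text \<open>Both quantities are products of \<open>j\<close> factors of modulus at most 1, so the
  difference is at most the sum of the differences of the factors. For k < i the factor (k-i)/(n-i)
  is negative; \<open>2 * d < n\<close> keeps it above -1.\<close>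

lemma choose_ratio_bound:
  assumes "k \<le> n" "j \<le> d" "2 * d < n"
  shows "\<bar>real (k choose j) / real (n choose j) - (real k / real n) ^ j\<bar> \<le> real d * real d / real (n - d)"
proof -
  have ch: "real (m choose j) = (\<Prod>i=0..<j. real m - real i) / fact j" for m
    by (simp add: binomial_gbinomial gbinomial_prod_rev)
  have e1: "real (k choose j) / real (n choose j) = (\<Prod>i=0..<j. (real k - real i) / (real n - real i))"
    by (simp add: ch prod_dividef)
  have e2: "(real k / real n) ^ j = (\<Prod>i=0..<j. real k / real n)" by simp
  have "\<bar>real (k choose j) / real (n choose j) - (real k / real n) ^ j\<bar> = norm ((\<Prod>i=0..<j. (real k - real i) / (real n - real i)) - (\<Prod>i=0..<j. real k / real n))"
    by (simp only: e1 e2 real_norm_def)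
  also have "norm ((\<Prod>i=0..<j. (real k - real i) / (real n - real i)) - (\<Prod>i=0..<j. real k / real n))
      \<le> (\<Sum>i=0..<j. norm ((real k - real i) / (real n - real i) - real k / real n))"
  proof (rule norm_prod_diff)
    fix i assume i: "i \<in> {0..<j}"
    have "\<bar>real k - real i\<bar> \<le> real n - real i" using i assms by auto
    then show "norm ((real k - real i) / (real n - real i)) \<le> 1" using i assms by (simp add: divide_le_eq_1)
    show "norm (real k / real n) \<le> 1" using assms by (simp add: divide_le_eq_1)
  qed
  also have "(\<Sum>i=0..<j. norm ((real k - real i) / (real n - real i) - real k / real n))
      \<le> (\<Sum>i=0..<j. real d / real (n - d))"
  proof (rule sum_mono)
    fix i assume i: "i \<in> {0..<j}"
    have pos: "real n - real i > 0" "real n > 0" using i assms by auto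
    have "(real k - real i) / (real n - real i) - real k / real n = - (real i / (real n - real i)) * ((real n - real k) / real n)"
      using pos by (simp add: field_simps)
    then have "norm ((real k - real i) / (real n - real i) - real k / real n) = real i / (real n - real i) * ((real n - real k) / real n)"
      using pos assms by (simp add: abs_mult)
    also have "\<dots> \<le> real i / (real n - real i) * 1"
      using pos assms by (intro mult_left_mono) auto
    also have "\<dots> \<le> real d / real (n - d)"
      using i assms pos by (simp, intro frac_le) auto
    finally show "norm ((real k - real i) / (real n - real i) - real k / real n) \<le> real d / real (n - d)" .
  qed
  also have "(\<Sum>i=0..<j. real d / real (n - d)) \<le> real d * real d / real (n - d)"
    using assms by (simp add: divide_right_mono mult_right_mono)
  finally show ?thesis .
qed

definition unit01 :: "'a::unital_cstar_algebra \<Rightarrow> bool" where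
  "unit01 h \<longleftrightarrow> nonneg h \<and> nonneg (1 - h)"

lemma unit01_adj: "unit01 h \<Longrightarrow> adj h = h" by (simp add: unit01_def nonneg_adj)

lemma unit01I: "nonneg h \<Longrightarrow> norm h \<le> 1 \<Longrightarrow> unit01 h"
  using nonneg_norm_minus[of h 1] by (simp add: unit01_def nonneg_adj)

lemma nonneg_peval_bern: assumes "unit01 h" shows "nonneg (peval (bern n k) h)"
proof -
  have "nonneg (h ^ k * (1 - h) ^ (n - k))"
  proof (rule nonneg_mult_commute)
    have "h * (1 - h) ^ (n - k) = (1 - h) ^ (n - k) * h"
      by (rule power_commuting_commutes[symmetric]) (simp add: algebra_simps)
    then show "h ^ k * (1 - h) ^ (n - k) = (1 - h) ^ (n - k) * h ^ k"
      by (rule power_commuting_commutes)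
  qed (use assms in \<open>auto simp: unit01_def intro: nonneg_power\<close>)
  then show ?thesis
    by (simp add: bern_def peval_smult peval_mult peval_power nonneg_scaleR)
qed

lemma sum_peval_bern: "(\<Sum>k\<le>n. peval (bern n k) h) = 1"
proof -
  have "peval (\<Sum>k\<le>n. bern n k) h = 1"
    using sum_choose_bern[of 0 n] by (simp add: monom_0)
  then show ?thesis by (simp add: peval_sum)
qed

text \<open>The elements \<open>peval (bern n k) h\<close> are positive and sum to 1, so a
  combination with coefficients between -M and M lies between -M and M in the order.\<close>

lemma norm_sum_bern_le:
  fixes h :: "'a::unital_cstar_algebra"
  assumes h: "unit01 h" and M: "\<And>k. k \<le> n \<Longrightarrow> \<bar>g k\<bar> \<le> M"
  shows "norm (\<Sum>k\<le>n. g k *\<^sub>R peval (bern n k) h) \<le> M"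
proof (rule nonneg_bound_norm)
  have one: "of_real M = (\<Sum>k\<le>n. M *\<^sub>R peval (bern n k) h)"
    by (simp add: sum_peval_bern of_real_def flip: scaleR_sum_right)
  have "of_real M - (\<Sum>k\<le>n. g k *\<^sub>R peval (bern n k) h) = (\<Sum>k\<le>n. (M - g k) *\<^sub>R peval (bern n k) h)"
    unfolding one by (simp add: sum_subtractf scaleR_diff_left)
  also have "nonneg \<dots>"
    by (intro nonneg_sum nonneg_scaleR nonneg_peval_bern h) (use M in \<open>force simp: abs_le_iff\<close>)
  finally show "nonneg (of_real M - (\<Sum>k\<le>n. g k *\<^sub>R peval (bern n k) h))" .
  have "of_real M + (\<Sum>k\<le>n. g k *\<^sub>R peval (bern n k) h) = (\<Sum>k\<le>n. (M + g k) *\<^sub>R peval (bern n k) h)"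
    unfolding one by (simp add: sum.distrib scaleR_add_left)
  also have "nonneg \<dots>"
    by (intro nonneg_sum nonneg_scaleR nonneg_peval_bern h) (use M in \<open>force simp: abs_le_iff\<close>)
  finally show "nonneg (of_real M + (\<Sum>k\<le>n. g k *\<^sub>R peval (bern n k) h))" .
  show "0 \<le> M" using M[of 0] by simp
qed

text \<open>The monomial \<open>t\<^sup>j\<close> is the Bernstein combination with coefficients \<open>(k choose j) / (n choose j)\<close>,
  which differ from \<open>(k/n)\<^sup>j\<close> by \<open>O(1/n)\<close>.\<close>

lemma norm_peval_le:
  fixes h :: "'a::unital_cstar_algebra"
  assumes h: "unit01 h" and M: "\<And>t. t \<in> {0..1} \<Longrightarrow> \<bar>poly p t\<bar> \<le> M"
  shows "norm (peval p h) \<le> M"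
proof -
  define d where "d = degree p"
  define A where "A = (\<Sum>j\<le>d. \<bar>coeff p j\<bar>)"
  have bound: "norm (peval p h) \<le> M + A * (real d * real d / real (n - d))" if n: "2 * d < n" for n
  proof -
    define g where "g k = (\<Sum>j\<le>d. coeff p j * (real (k choose j) / real (n choose j)))" for k
    have "p = (\<Sum>j\<le>d. smult (coeff p j / real (n choose j)) (smult (real (n choose j)) (monom 1 j)))"
    proof -
      have "p = (\<Sum>j\<le>d. monom (coeff p j) j)" by (simp add: d_def poly_as_sum_of_monoms)
      also have "\<dots> = (\<Sum>j\<le>d. smult (coeff p j / real (n choose j)) (smult (real (n choose j)) (monom 1 j)))"
        using n by (intro sum.cong) (auto simp: smult_monom)
      finally show ?thesis .
    qed
    also have "\<dots> = (\<Sum>j\<le>d. smult (coeff p j / real (n choose j)) (\<Sum>k\<le>n. smult (real (k choose j)) (bern n k)))"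
      using n by (intro sum.cong refl arg_cong2[where f = smult] sum_choose_bern[symmetric]) auto
    finally have p: "p = (\<Sum>j\<le>d. smult (coeff p j / real (n choose j)) (\<Sum>k\<le>n. smult (real (k choose j)) (bern n k)))" .
    have "peval p h = (\<Sum>j\<le>d. \<Sum>k\<le>n. (coeff p j * (real (k choose j) / real (n choose j))) *\<^sub>R peval (bern n k) h)"
      by (subst p) (simp add: peval_sum peval_smult scaleR_sum_right)
    also have "\<dots> = (\<Sum>k\<le>n. g k *\<^sub>R peval (bern n k) h)"
      by (subst sum.swap) (simp add: g_def scaleR_sum_left)
    also have "norm \<dots> \<le> M + A * (real d * real d / real (n - d))"
    proof (rule norm_sum_bern_le[OF h])
      fix k assume k: "k \<le> n"
      have "poly p (real k / real n) = (\<Sum>j\<le>d. coeff p j * (real k / real n) ^ j)"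
        by (simp add: poly_altdef d_def)
      then have "g k - poly p (real k / real n)
          = (\<Sum>j\<le>d. coeff p j * (real (k choose j) / real (n choose j) - (real k / real n) ^ j))"
        by (simp add: g_def sum_subtractf[symmetric] algebra_simps)
      also have "\<bar>\<dots>\<bar> \<le> (\<Sum>j\<le>d. \<bar>coeff p j\<bar> * (real d * real d / real (n - d)))"
      proof (rule order_trans[OF sum_abs sum_mono])
        fix j assume "j \<in> {..d}"
        then show "\<bar>coeff p j * (real (k choose j) / real (n choose j) - (real k / real n) ^ j)\<bar>
            \<le> \<bar>coeff p j\<bar> * (real d * real d / real (n - d))"
          unfolding abs_mult by (intro mult_left_mono choose_ratio_bound[OF k _ n]) auto
      qed
      also have "\<dots> = A * (real d * real d / real (n - d))" unfolding A_def by (rule sum_distrib_right[symmetric])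
      finally have "\<bar>g k - poly p (real k / real n)\<bar> \<le> A * (real d * real d / real (n - d))" .
      moreover have "\<bar>poly p (real k / real n)\<bar> \<le> M"
        using k n by (intro M) auto
      moreover have "\<bar>g k\<bar> \<le> \<bar>poly p (real k / real n)\<bar> + \<bar>g k - poly p (real k / real n)\<bar>" by simp
      ultimately show "\<bar>g k\<bar> \<le> M + A * (real d * real d / real (n - d))"
        by (blast intro: order_trans add_mono)
    qed
    finally show ?thesis .
  qed
  have "(\<lambda>n. M + A * (real d * real d * (1 / real n))) \<longlonglongrightarrow> M + A * (real d * real d * 0)"
    by (intro tendsto_intros lim_1_over_n)
  then have "(\<lambda>n. M + A * (real d * real d / real n)) \<longlonglongrightarrow> M" by simp
  then have "(\<lambda>n. M + A * (real d * real d / real (n - d))) \<longlonglongrightarrow> M"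
    by (rule filterlim_compose) (rule filterlim_minus_const_nat_at_top)
  then show ?thesis
    by (rule LIMSEQ_le_const) (use bound in \<open>auto intro: exI[of _ "Suc (2 * d)"]\<close>)
qed

section \<open>Continuous functional calculus on the unit interval\<close>

definition bpoly :: "nat \<Rightarrow> (real \<Rightarrow> real) \<Rightarrow> real poly" where
  "bpoly n f = (\<Sum>k\<le>n. smult (f (real k / real n)) (bern n k))"

lemma peval_bpoly: "peval (bpoly n f) h = (\<Sum>k\<le>n. f (real k / real n) *\<^sub>R peval (bern n k) h)"
  by (simp add: bpoly_def peval_sum peval_smult)

lemma uniform_limit_bpoly:
  assumes "continuous_on {0..1} f"
  shows "uniform_limit {0..1} (\<lambda>n. poly (bpoly n f)) f sequentially"
proof (rule uniform_limitI)
  fix e :: real assume "0 < e"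
  from Bernstein_Weierstrass[OF assms this]
  obtain N where N: "\<And>n x. N \<le> n \<Longrightarrow> x \<in> {0..1} \<Longrightarrow> \<bar>f x - (\<Sum>k\<le>n. f (k / n) * Bernstein n k x)\<bar> < e"
    by blast
  show "\<forall>\<^sub>F n in sequentially. \<forall>x\<in>{0..1}. dist (poly (bpoly n f) x) (f x) < e"
    using N by (intro eventually_sequentiallyI[of N])
      (auto simp: bpoly_def poly_sum poly_bern dist_norm abs_minus_commute)
qed

text \<open>Functions on the whole interval take the place of functions on the spectrum. The use of
  \<open>lim\<close> makes the definition total; it carries information for \<open>unit01 h\<close>
  and \<open>f\<close> continuous on [0,1].\<close>

definition fcalc :: "'a::unital_cstar_algebra \<Rightarrow> (real \<Rightarrow> real) \<Rightarrow> 'a" where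
  "fcalc h f = lim (\<lambda>n. peval (bpoly n f) h)"

lemma fcalc_tendsto_bpoly:
  assumes h: "unit01 h" and f: "continuous_on {0..1} f"
  shows "(\<lambda>n. peval (bpoly n f) h) \<longlonglongrightarrow> fcalc h f"
proof -
  have "Cauchy (\<lambda>n. peval (bpoly n f) h)"
  proof (rule metric_CauchyI)
    fix e :: real assume e: "0 < e"
    then have "\<forall>\<^sub>F n in sequentially. \<forall>x\<in>{0..1}. dist (poly (bpoly n f) x) (f x) < e / 4"
      using uniform_limitD[OF uniform_limit_bpoly[OF f], of "e/4"] by simp
    then obtain N where N: "\<And>n x. N \<le> n \<Longrightarrow> x \<in> {0..1} \<Longrightarrow> dist (poly (bpoly n f) x) (f x) < e / 4"
      unfolding eventually_sequentially by blast
    have "dist (peval (bpoly m f) h) (peval (bpoly n f) h) < e" if mn: "N \<le> m" "N \<le> n" for m n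
    proof -
      have "norm (peval (bpoly m f - bpoly n f) h) \<le> e / 2"
      proof (rule norm_peval_le[OF h])
        fix t :: real assume t: "t \<in> {0..1}"
        show "\<bar>poly (bpoly m f - bpoly n f) t\<bar> \<le> e / 2"
          using N[OF mn(1) t] N[OF mn(2) t] unfolding dist_real_def poly_diff by linarith
      qed
      then show ?thesis using e by (simp add: peval_diff dist_norm)
    qed
    then show "\<exists>M. \<forall>m\<ge>M. \<forall>n\<ge>M. dist (peval (bpoly m f) h) (peval (bpoly n f) h) < e" by blast
  qed
  then show ?thesis
    unfolding fcalc_def by (rule convergent_LIMSEQ_iff[THEN iffD1, OF Cauchy_convergent])
qed

text \<open>The product of two polynomials \<open>bpoly n f\<close> and \<open>bpoly n g\<close> is
  not the Bernstein polynomial of the product; independence of the approximating sequence is what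
  makes the calculus multiplicative.\<close>

lemma fcalc_tendsto:
  assumes h: "unit01 h" and f: "continuous_on {0..1} f"
    and q: "uniform_limit {0..1} (\<lambda>n. poly (q n)) f sequentially"
  shows "(\<lambda>n. peval (q n) h) \<longlonglongrightarrow> fcalc h f"
proof -
  have "(\<lambda>n. peval (q n) h - peval (bpoly n f) h) \<longlonglongrightarrow> 0"
  proof (rule LIMSEQ_I)
    fix e :: real assume e: "0 < e"
    have "\<forall>\<^sub>F n in sequentially. \<forall>x\<in>{0..1}. dist (poly (bpoly n f) x) (f x) < e / 4"
      "\<forall>\<^sub>F n in sequentially. \<forall>x\<in>{0..1}. dist (poly (q n) x) (f x) < e / 4"
      using uniform_limitD[OF uniform_limit_bpoly[OF f], of "e/4"] uniform_limitD[OF q, of "e/4"] e by simp_all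
    then have "\<forall>\<^sub>F n in sequentially. norm (peval (q n) h - peval (bpoly n f) h - 0) < e"
    proof eventually_elim
      case (elim n)
      have "norm (peval (q n - bpoly n f) h) \<le> e / 2"
      proof (rule norm_peval_le[OF h])
        fix t :: real assume t: "t \<in> {0..1}"
        have "dist (poly (bpoly n f) t) (f t) < e / 4" "dist (poly (q n) t) (f t) < e / 4"
          using elim t by auto
        then show "\<bar>poly (q n - bpoly n f) t\<bar> \<le> e / 2"
          unfolding dist_real_def poly_diff by linarith
      qed
      then show ?case using e by (simp add: peval_diff)
    qed
    then show "\<exists>no. \<forall>n\<ge>no. norm (peval (q n) h - peval (bpoly n f) h - 0) < e"
      by (simp add: eventually_sequentially)
  qed
  from tendsto_add[OF this fcalc_tendsto_bpoly[OF h f]] show ?thesis by simp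
qed

lemma fcalc_poly: "unit01 h \<Longrightarrow> fcalc h (poly q) = peval q h"
  by (rule LIMSEQ_unique[OF fcalc_tendsto[of h "poly q" "\<lambda>_. q"]])
    (auto intro!: continuous_intros uniform_limit_const)

lemma fcalc_const: "unit01 h \<Longrightarrow> fcalc h (\<lambda>t. c) = of_real c"
  using fcalc_poly[of h "[:c:]"] by (simp add: poly_pCons[abs_def])

lemma fcalc_ident: "unit01 h \<Longrightarrow> fcalc h (\<lambda>t. t) = h"
  using fcalc_poly[of h "[:0, 1:]"] by (simp add: poly_pCons[abs_def])

lemma fcalc_add:
  assumes "unit01 h" "continuous_on {0..1} f" "continuous_on {0..1} g"
  shows "fcalc h (\<lambda>t. f t + g t) = fcalc h f + fcalc h g"
proof (rule LIMSEQ_unique)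
  have "(\<lambda>n. peval (bpoly n f + bpoly n g) h) \<longlonglongrightarrow> fcalc h (\<lambda>t. f t + g t)"
    using assms
    by (intro fcalc_tendsto continuous_intros) (auto simp: poly_add[abs_def] intro!: uniform_limit_add uniform_limit_bpoly)
  then show "(\<lambda>n. peval (bpoly n f) h + peval (bpoly n g) h) \<longlonglongrightarrow> fcalc h (\<lambda>t. f t + g t)"
    by (simp add: peval_add)
  show "(\<lambda>n. peval (bpoly n f) h + peval (bpoly n g) h) \<longlonglongrightarrow> fcalc h f + fcalc h g"
    by (intro tendsto_add fcalc_tendsto_bpoly assms)
qed

lemma fcalc_mult:
  assumes "unit01 h" "continuous_on {0..1} f" "continuous_on {0..1} g"
  shows "fcalc h (\<lambda>t. f t * g t) = fcalc h f * fcalc h g"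
proof (rule LIMSEQ_unique)
  have "bounded (f ` {0..1})" "bounded (g ` {0..1})"
    using assms by (auto intro!: compact_imp_bounded compact_continuous_image)
  then have "(\<lambda>n. peval (bpoly n f * bpoly n g) h) \<longlonglongrightarrow> fcalc h (\<lambda>t. f t * g t)"
    using assms
    by (intro fcalc_tendsto continuous_intros) (auto simp: poly_mult[abs_def] intro!: uniform_lim_mult uniform_limit_bpoly)
  then show "(\<lambda>n. peval (bpoly n f) h * peval (bpoly n g) h) \<longlonglongrightarrow> fcalc h (\<lambda>t. f t * g t)"
    by (simp add: peval_mult)
  show "(\<lambda>n. peval (bpoly n f) h * peval (bpoly n g) h) \<longlonglongrightarrow> fcalc h f * fcalc h g"
    by (intro tendsto_mult fcalc_tendsto_bpoly assms)
qed

lemma fcalc_cmult: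
  assumes "unit01 h" "continuous_on {0..1} f"
  shows "fcalc h (\<lambda>t. c * f t) = c *\<^sub>R fcalc h f"
  using fcalc_mult[OF assms(1) _ assms(2), of "\<lambda>_. c"] assms(1) by (simp add: fcalc_const of_real_def)

lemma fcalc_diff:
  assumes "unit01 h" "continuous_on {0..1} f" "continuous_on {0..1} g"
  shows "fcalc h (\<lambda>t. f t - g t) = fcalc h f - fcalc h g"
  using fcalc_add[OF assms(1,2), of "\<lambda>t. -1 * g t"] fcalc_cmult[OF assms(1,3), of "-1"] assms(3)
  by (simp add: continuous_on_minus)

lemma fcalc_power:
  assumes "unit01 h" "continuous_on {0..1} f"
  shows "fcalc h (\<lambda>t. f t ^ n) = fcalc h f ^ n"
proof (induction n)
  case (Suc n)
  then show ?case
    using fcalc_mult[OF assms(1,2) continuous_on_power[OF assms(2), of n]] by simp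
qed (use fcalc_const[OF assms(1), of 1] in simp)

lemma fcalc_cong: 
  assumes "\<And>t. t \<in> {0..1} \<Longrightarrow> f t = g t"
  shows "fcalc h f = fcalc h g"
proof -
  have "f (real k / real n) = g (real k / real n)" if "k \<le> n" for k n
    using that by (intro assms) (auto simp: divide_le_eq_1)
  then have "bpoly n f = bpoly n g" for n unfolding bpoly_def by (intro sum.cong) auto
  then show ?thesis by (simp add: fcalc_def)
qed

lemma norm_fcalc_le:
  assumes "unit01 h" "continuous_on {0..1} f" "\<And>t. t \<in> {0..1} \<Longrightarrow> \<bar>f t\<bar> \<le> M"
  shows "norm (fcalc h f) \<le> M"
proof (rule Lim_bounded)
  show "(\<lambda>n. norm (peval (bpoly n f) h)) \<longlonglongrightarrow> norm (fcalc h f)"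
    by (intro tendsto_norm fcalc_tendsto_bpoly assms)
  show "\<forall>n\<ge>0. norm (peval (bpoly n f) h) \<le> M"
    unfolding peval_bpoly by (intro allI impI norm_sum_bern_le assms(1) assms(3)) (auto simp: divide_le_eq_1)
qed

lemma adj_fcalc:
  assumes "unit01 h" "continuous_on {0..1} f"
  shows "adj (fcalc h f) = fcalc h f"
  using LIMSEQ_unique[OF tendsto_adj[OF fcalc_tendsto_bpoly[OF assms]]] fcalc_tendsto_bpoly[OF assms]
  by (simp add: adj_peval unit01_adj assms)

lemma nonneg_fcalc:
  assumes "unit01 h" "continuous_on {0..1} f" "\<And>t. t \<in> {0..1} \<Longrightarrow> 0 \<le> f t"
  shows "nonneg (fcalc h f)"
proof -
  have "nonneg (peval (bpoly n f) h)" for n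
    unfolding peval_bpoly by (intro nonneg_sum nonneg_scaleR nonneg_peval_bern assms(1) assms(3)) (auto simp: divide_le_eq_1)
  then show ?thesis
    using closed_sequentially[OF closed_nonneg _ fcalc_tendsto_bpoly[OF assms(1,2)]] by simp
qed

lemma fcalc_commute:
  assumes "unit01 h" "continuous_on {0..1} f" "c * h = h * c"
  shows "c * fcalc h f = fcalc h f * c"
proof (rule LIMSEQ_unique)
  show "(\<lambda>n. c * peval (bpoly n f) h) \<longlonglongrightarrow> c * fcalc h f"
    by (intro tendsto_intros fcalc_tendsto_bpoly assms)
  show "(\<lambda>n. c * peval (bpoly n f) h) \<longlonglongrightarrow> fcalc h f * c"
    unfolding peval_commute[OF assms(3)] by (intro tendsto_intros fcalc_tendsto_bpoly assms)
qed

lemma unit01_fcalc: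
  assumes "unit01 h" "continuous_on {0..1} g" "\<And>t. t \<in> {0..1} \<Longrightarrow> g t \<in> {0..1}"
  shows "unit01 (fcalc h g)"
  unfolding unit01_def
proof
  show "nonneg (fcalc h g)" using assms by (intro nonneg_fcalc) auto
  have "nonneg (fcalc h (\<lambda>t. 1 - g t))" using assms by (intro nonneg_fcalc continuous_intros) auto
  then show "nonneg (1 - fcalc h g)" using assms by (simp add: fcalc_diff fcalc_const)
qed

text \<open>Both sides are limits of the same sequence: for polynomials in \<open>fcalc h g\<close>
  the identity is algebra, and \<open>norm_fcalc_le\<close> carries the uniform error over, since
  \<open>g\<close> stays inside [0,1].\<close>

lemma fcalc_compose:
  assumes h: "unit01 h" and f: "continuous_on {0..1} f" 
    and g: "continuous_on {0..1} g" "\<And>t. t \<in> {0..1} \<Longrightarrow> g t \<in> {0..1}"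
  shows "fcalc (fcalc h g) f = fcalc h (\<lambda>t. f (g t))"
proof (rule LIMSEQ_unique)
  have gf: "continuous_on {0..1} (\<lambda>t. f (g t))"
    using continuous_on_compose2[OF f g(1)] g(2) by blast
  have pg: "peval q (fcalc h g) = fcalc h (\<lambda>t. poly q (g t))" for q
  proof (induction q)
    case 0 then show ?case using fcalc_const[OF h, of 0] by simp
  next
    case (pCons a q)
    then show ?case using h g by (simp add: fcalc_add fcalc_mult fcalc_const continuous_on_const continuous_on_mult continuous_on_poly)
  qed
  show "(\<lambda>n. peval (bpoly n f) (fcalc h g)) \<longlonglongrightarrow> fcalc (fcalc h g) f"
    by (intro fcalc_tendsto_bpoly unit01_fcalc assms)
  show "(\<lambda>n. peval (bpoly n f) (fcalc h g)) \<longlonglongrightarrow> fcalc h (\<lambda>t. f (g t))"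
  proof (rule LIMSEQ_I)
    fix e :: real assume e: "0 < e"
    have "\<forall>\<^sub>F n in sequentially. \<forall>x\<in>{0..1}. dist (poly (bpoly n f) x) (f x) < e / 2"
      using uniform_limitD[OF uniform_limit_bpoly[OF f], of "e/2"] e by simp
    then have "\<forall>\<^sub>F n in sequentially. norm (peval (bpoly n f) (fcalc h g) - fcalc h (\<lambda>t. f (g t))) < e"
    proof eventually_elim
      case (elim n)
      have "norm (fcalc h (\<lambda>t. poly (bpoly n f) (g t) - f (g t))) \<le> e / 2"
      proof (rule norm_fcalc_le[OF h])
        show "continuous_on {0..1} (\<lambda>t. poly (bpoly n f) (g t) - f (g t))"
          by (intro continuous_intros gf g)
        show "\<bar>poly (bpoly n f) (g t) - f (g t)\<bar> \<le> e / 2" if "t \<in> {0..1}" for t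
          using elim g(2)[OF that] by (force simp: dist_real_def)
      qed
      moreover have "fcalc h (\<lambda>t. poly (bpoly n f) (g t) - f (g t)) = peval (bpoly n f) (fcalc h g) - fcalc h (\<lambda>t. f (g t))"
        unfolding pg by (intro fcalc_diff h gf continuous_intros g)
      ultimately show ?case using e by simp
    qed
    then show "\<exists>no. \<forall>n\<ge>no. norm (peval (bpoly n f) (fcalc h g) - fcalc h (\<lambda>t. f (g t))) < e"
      by (simp add: eventually_sequentially)
  qed
qed

section \<open>Square roots and the positivity of \<open>adj x * x\<close>\<close>

lemma nonneg_scaled_unit01:
  assumes "nonneg x" "norm x \<le> M" "0 < M"
  shows "unit01 ((1/M) *\<^sub>R x)"
  using assms by (intro unit01I nonneg_scaleR) (auto simp: divide_le_eq_1)

lemma nonneg_sqrt: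
  fixes x :: "'a::unital_cstar_algebra"
  assumes "nonneg x"
  obtains s where "adj s = s" "s * s = x" "nonneg s" "\<And>c. c * x = x * c \<Longrightarrow> c * s = s * c"
proof -
  define M where "M = norm x + 1"
  have M: "0 < M" by (simp add: M_def add_nonneg_pos)
  define h where "h = (1/M) *\<^sub>R x"
  have h: "unit01 h" unfolding h_def using assms M by (intro nonneg_scaled_unit01) (auto simp: M_def)
  define s where "s = fcalc h (\<lambda>t. sqrt M * sqrt t)"
  have "s * s = fcalc h (\<lambda>t. (sqrt M * sqrt t) * (sqrt M * sqrt t))"
    unfolding s_def by (intro fcalc_mult[symmetric] h continuous_intros)
  also have "\<dots> = fcalc h (\<lambda>t. M * t)"
    by (rule fcalc_cong) (use M in \<open>auto simp: algebra_simps\<close>)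
  also have "\<dots> = M *\<^sub>R h"
    using fcalc_cmult[OF h continuous_on_id, of M] by (simp add: fcalc_ident[OF h])
  also have "\<dots> = x" using M by (simp add: h_def)
  finally have "s * s = x" .
  moreover have "nonneg s" unfolding s_def using M by (intro nonneg_fcalc h continuous_intros) auto
  moreover have "c * s = s * c" if "c * x = x * c" for c
    unfolding s_def using that by (intro fcalc_commute h continuous_intros) (simp add: h_def)
  ultimately show ?thesis using that nonneg_adj by blast
qed

text \<open>Kelley and Vaught: with \<open>h = x*x\<close> and \<open>y = x h\<^sub>-\<close> we have \<open>y*y = -h\<^sub>-\<^sup>3 = -s\<close>.  For
  \<open>m = y \<surd>s\<close> then \<open>m m* = -(y y*)\<^sup>2\<close>, and as \<open>m*m + m m*\<close> is a sum of squares of self-adjoint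
  elements, \<open>m*m = -s\<^sup>2\<close> is nonnegative, whence \<open>s = 0\<close>.\<close>

lemma nonneg_adj_mult_of_neg:
  fixes m :: "'a::unital_cstar_algebra"
  assumes "nonneg (- (m * adj m))"
  shows "nonneg (adj m * m)"
proof -
  define a where "a = (1/2) *\<^sub>R (m + adj m)"
  define b where "b = (\<i> / 2) *\<^sub>C (m - adj m)"
  have ab: "adj a = a" "adj b = b"
    by (auto simp: a_def b_def adj_add adj_diff adj_scaleC adj_adj scaleC_diff_right add.commute)
  have bb: "b * b = - ((1/4) *\<^sub>R ((m - adj m) * (m - adj m)))"
    using scaleC_of_real[of "1/4" "(m - adj m) * (m - adj m)"]
    by (simp add: b_def mult_scaleC_left mult_scaleC_right scaleC_scaleC)
  have aa: "a * a = (1/4) *\<^sub>R ((m + adj m) * (m + adj m))"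
    by (simp add: a_def)
  have "adj m * m + m * adj m = 2 *\<^sub>R (a * a + b * b)"
    unfolding aa bb scaleR_diff_right[symmetric] diff_conv_add_uminus[symmetric]
    by (simp add: algebra_simps scaleR_2[symmetric])
  then have "adj m * m = 2 *\<^sub>R (a * a + b * b) + (- (m * adj m))"
    by (simp add: algebra_simps)
  then show ?thesis
    using assms ab by (simp only:) (intro nonneg_add nonneg_scaleR nonneg_square'; simp)
qed

lemma adj_mult_eq_neg_nonneg_imp_0:
  fixes y :: "'a::unital_cstar_algebra"
  assumes "nonneg (- (adj y * y))"
  shows "y = 0"
proof -
  define s where "s = - (adj y * y)"
  obtain q where q: "adj q = q" "q * q = s" "\<And>c. c * s = s * c \<Longrightarrow> c * q = q * c"
    using nonneg_sqrt[of s] assms s_def by blast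
  define m where "m = y * q"
  have "m * adj m = y * s * adj y" using q(1,2) by (simp add: m_def adj_mult mult.assoc[symmetric]) (simp add: mult.assoc)
  also have "\<dots> = - ((y * adj y) * (y * adj y))" by (simp add: s_def mult.assoc)
  finally have "nonneg (- (m * adj m))" by (simp add: nonneg_square' adj_mult adj_adj)
  then have "nonneg (adj m * m)" by (rule nonneg_adj_mult_of_neg)
  moreover have "adj m * m = - (s * s)"
  proof -
    have "s * q = q * s" using q(3)[of s] by simp
    have "adj m * m = q * (adj y * y) * q" using q(1) by (simp add: m_def adj_mult mult.assoc)
    also have "\<dots> = - (q * s * q)" by (simp add: s_def)
    also have "q * s * q = s * (q * q)" using \<open>s * q = q * s\<close> by (metis mult.assoc)
    finally show ?thesis by (simp add: q(2))
  qed
  moreover have "adj s = s" by (simp add: s_def adj_mult adj_adj)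
  ultimately have "s * s = 0" using nonneg_antisym[of "s * s"] nonneg_square'[of s] by simp
  then have "norm s = 0" using norm_square_selfadjoint[of s] \<open>adj s = s\<close> by simp
  then show ?thesis by (simp add: s_def adj_mult_self_eq_0)
qed

theorem nonneg_adj_mult: "nonneg (adj x * (x::'a::unital_cstar_algebra))"
proof -
  define k where "k = adj x * x"
  have k: "adj k = k" by (simp add: k_def adj_mult adj_adj)
  define M where "M = norm k + 1"
  have M: "0 < M" by (simp add: M_def add_nonneg_pos)
  \<comment> \<open>The calculus asks for spectrum in [0,1]. This affine change moves the zero of
    \<open>k\<close> to 1/2, so that \<open>max 0 (1 - 2 * t)\<close> below is the negative part of
    \<open>k\<close> divided by \<open>M\<close>.\<close>
  define h where "h = (1/2) *\<^sub>R (1 + (1/M) *\<^sub>R k)"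
  have nk: "norm ((1/M) *\<^sub>R k) \<le> 1" using M by (simp add: M_def divide_le_eq_1)
  have "nonneg (1 - (1/M) *\<^sub>R k)" "nonneg (1 + (1/M) *\<^sub>R k)"
    using nonneg_norm_minus[of "(1/M) *\<^sub>R k" 1] nonneg_norm_minus[of "-((1/M) *\<^sub>R k)" 1] nk k by simp_all
  then have "nonneg ((1/2) *\<^sub>R (1 - (1/M) *\<^sub>R k))" "nonneg h" unfolding h_def by (auto intro: nonneg_scaleR)
  moreover have "(1/2) *\<^sub>R (1 - (1/M) *\<^sub>R k) = 1 - h"
  proof -
    have "(1/2) *\<^sub>R (1 - (1/M) *\<^sub>R k) + h = (1/2) *\<^sub>R (1 + 1)"
      unfolding h_def scaleR_add_right[symmetric] by simp
    also have "\<dots> = 1" by (simp add: scaleR_2[symmetric])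
    finally show ?thesis by (simp add: algebra_simps)
  qed
  ultimately have h: "unit01 h" by (simp add: unit01_def)
  have kfc: "k = fcalc h (\<lambda>t. M * (2 * t - 1))"
  proof -
    have "fcalc h (\<lambda>t. M * (2 * t - 1)) = peval [:-M, 2 * M:] h"
      by (subst fcalc_poly[OF h, symmetric]) (rule fcalc_cong, simp add: algebra_simps)
    also have "\<dots> = k" using M by (simp add: h_def algebra_simps of_real_def)
    finally show ?thesis ..
  qed
  define n where "n = fcalc h (\<lambda>t. max 0 (1 - 2 * t))"
  have an: "adj n = n" unfolding n_def by (intro adj_fcalc h continuous_intros)
  have "n * k * n = fcalc h (\<lambda>t. max 0 (1 - 2 * t) * (M * (2 * t - 1)) * max 0 (1 - 2 * t))"
    unfolding n_def kfc by (simp add: fcalc_mult[OF h] continuous_intros)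
  then have "- (n * k * n) = fcalc h (\<lambda>t. - 1 * (max 0 (1 - 2 * t) * (M * (2 * t - 1)) * max 0 (1 - 2 * t)))"
    by (subst fcalc_cmult[OF h]) (auto intro!: continuous_intros)
  also have "nonneg \<dots>"
  proof (intro nonneg_fcalc h continuous_intros)
    fix t :: real
    show "0 \<le> - 1 * (max 0 (1 - 2 * t) * (M * (2 * t - 1)) * max 0 (1 - 2 * t))"
      using M by (cases "2 * t \<le> 1") (auto simp: max_def mult_le_0_iff)
  qed
  finally have "nonneg (- (adj (x * n) * (x * n)))" by (simp add: adj_mult an k_def mult.assoc)
  then have "x * n = 0" by (rule adj_mult_eq_neg_nonneg_imp_0)
  then have "k * n = 0" by (simp add: k_def mult.assoc)
  have "n = 0"
  proof -
    have "fcalc h (\<lambda>t. M * (max 0 (1 - 2 * t) * max 0 (1 - 2 * t))) = fcalc h (\<lambda>t. - 1 * ((M * (2 * t - 1)) * max 0 (1 - 2 * t)))"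
      by (rule fcalc_cong) (auto simp: max_def algebra_simps)
    also have "\<dots> = - (k * n)"
      unfolding kfc n_def by (subst fcalc_cmult[OF h], intro continuous_intros) (subst fcalc_mult[OF h], auto intro!: continuous_intros)
    finally have "M *\<^sub>R (n * n) = 0"
      using \<open>k * n = 0\<close> by (simp add: n_def fcalc_mult[OF h, symmetric] fcalc_cmult[OF h, symmetric] continuous_intros)
    then have "n * n = 0" using M by simp
    then show ?thesis using norm_square_selfadjoint[OF an] by simp
  qed
  have "k = fcalc h (\<lambda>t. M * (max 0 (2 * t - 1)) - M * max 0 (1 - 2 * t))"
    unfolding kfc by (rule fcalc_cong) (auto simp: max_def algebra_simps)
  also have "\<dots> = fcalc h (\<lambda>t. M * (max 0 (2 * t - 1))) - M *\<^sub>R n"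
    unfolding n_def by (simp add: fcalc_diff[OF h] fcalc_cmult[OF h] continuous_intros)
  also have "\<dots> = fcalc h (\<lambda>t. M * (max 0 (2 * t - 1)))" by (simp add: \<open>n = 0\<close>)
  also have "nonneg \<dots>" using M by (intro nonneg_fcalc h continuous_intros) auto
  finally show ?thesis by (simp add: k_def)
qed

lemma nonneg_conj: "nonneg x \<Longrightarrow> nonneg (adj y * x * (y::'a::unital_cstar_algebra))"
proof -
  assume "nonneg x"
  then obtain s where s: "adj s = s" "s * s = x" using nonneg_sqrt by blast
  have "adj (s * y) * (s * y) = adj y * x * y"
    using s by (simp add: adj_mult mult.assoc[symmetric]) (simp add: mult.assoc)
  then show ?thesis using nonneg_adj_mult[of "s * y"] by simp
qed

text \<open>A positive contraction is recovered from its power as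
  \<open>fcalc (h ^ n) (root n)\<close>, so equal powers force equal elements; a common factor
  \<open>M\<close> scales both into the unit interval. This is the uniqueness behind
  \<open>pos_root\<close>.\<close>

lemma nonneg_power_inject:
  fixes b c :: "'a::unital_cstar_algebra"
  assumes "nonneg b" "nonneg c" "b ^ n = c ^ n" "0 < n"
  shows "b = c"
proof -
  define M where "M = norm b + norm c + 1"
  have M: "0 < M" by (simp add: M_def add_nonneg_pos)
  have *: "(1/M) *\<^sub>R x = fcalc (((1/M) *\<^sub>R x) ^ n) (root n)" if x: "nonneg x" "norm x \<le> M" for x
  proof -
    define h where "h = (1/M) *\<^sub>R x"
    have h: "unit01 h" unfolding h_def using x M by (intro nonneg_scaled_unit01)
    have "h ^ n = fcalc h (\<lambda>t. t ^ n)" using fcalc_power[OF h, of "\<lambda>t. t" n] by (simp add: fcalc_ident[OF h] continuous_on_id)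
    then have "fcalc (h ^ n) (root n) = fcalc h (\<lambda>t. root n (t ^ n))"
      by (simp only:) (subst fcalc_compose[OF h], auto intro!: continuous_intros simp: power_le_one)
    also have "\<dots> = fcalc h (\<lambda>t. t)" using assms by (intro fcalc_cong) (auto simp: real_root_power_cancel)
    finally show ?thesis unfolding fcalc_ident[OF h] by (simp only: h_def)
  qed
  have "(1/M) *\<^sub>R b = (1/M) *\<^sub>R c"
    using *[OF assms(1)] *[OF assms(2)] assms(3) by (simp add: M_def scaleR_power add_nonneg_nonneg)
  then show ?thesis using M by simp
qed

section \<open>Unitization\<close>

datatype 'a unitz = Unitz (uc: complex) (ua: 'a)

lemma unitz_eqI: "uc x = uc y \<Longrightarrow> ua x = ua y \<Longrightarrow> x = y"
  by (simp add: unitz.expand)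

lemma bounded_linear_scaleC: "bounded_linear (\<lambda>b::'a::cstar_algebra. c *\<^sub>C b)"
  by (rule bounded_linear_intro[of _ "cmod c"])
    (auto simp: scaleC_add_right scaleC_scaleR norm_scaleC mult.commute)

text \<open>The formal sum of scalar and element acts on the original algebra by left
  multiplication; the operator norm of this action supplies the C*-norm of the unitization.\<close>

definition uop :: "'a::cstar_algebra unitz \<Rightarrow> 'a \<Rightarrow> 'a" where
  "uop x b = uc x *\<^sub>C b + ua x * b"

lemma bounded_linear_uop: "bounded_linear (uop x)"
  unfolding uop_def by (intro bounded_linear_add bounded_linear_scaleC bounded_linear_mult_right)

instantiation unitz :: (cstar_algebra) star_algebra
begin

definition zero_unitz :: "'a unitz" where "zero_unitz = Unitz 0 0"
definition plus_unitz :: "'a unitz \<Rightarrow> 'a unitz \<Rightarrow> 'a unitz" where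
  "plus_unitz x y = Unitz (uc x + uc y) (ua x + ua y)"
definition uminus_unitz :: "'a unitz \<Rightarrow> 'a unitz" where
  "uminus_unitz x = Unitz (- uc x) (- ua x)"
definition minus_unitz :: "'a unitz \<Rightarrow> 'a unitz \<Rightarrow> 'a unitz" where
  "minus_unitz x y = Unitz (uc x - uc y) (ua x - ua y)"
definition times_unitz :: "'a unitz \<Rightarrow> 'a unitz \<Rightarrow> 'a unitz" where
  "times_unitz x y = Unitz (uc x * uc y) (uc x *\<^sub>C ua y + uc y *\<^sub>C ua x + ua x * ua y)"
definition scaleR_unitz :: "real \<Rightarrow> 'a unitz \<Rightarrow> 'a unitz" where
  "scaleR_unitz r x = Unitz (r *\<^sub>R uc x) (r *\<^sub>R ua x)"
definition scaleC_unitz :: "complex \<Rightarrow> 'a unitz \<Rightarrow> 'a unitz" where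
  "scaleC_unitz c x = Unitz (c * uc x) (c *\<^sub>C ua x)"
definition adj_unitz :: "'a unitz \<Rightarrow> 'a unitz" where
  "adj_unitz x = Unitz (cnj (uc x)) (adj (ua x))"

lemmas unitz_defs0 = zero_unitz_def plus_unitz_def uminus_unitz_def minus_unitz_def
  times_unitz_def scaleR_unitz_def scaleC_unitz_def adj_unitz_def

instance
proof
  fix x y z :: "'a unitz" and c d :: complex and r s :: real
  show "x + y + z = x + (y + z)" "x + y = y + x" "0 + x = x" "- x + x = 0" "x - y = x + - y"
    by (simp_all add: unitz_defs0 algebra_simps)
  show "r *\<^sub>R (x + y) = r *\<^sub>R x + r *\<^sub>R y" "(r + s) *\<^sub>R x = r *\<^sub>R x + s *\<^sub>R x"
    "r *\<^sub>R s *\<^sub>R x = (r * s) *\<^sub>R x" "1 *\<^sub>R x = x"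
    by (simp_all add: unitz_defs0 algebra_simps)
  show "c *\<^sub>C (x + y) = c *\<^sub>C x + c *\<^sub>C y" "(c + d) *\<^sub>C x = c *\<^sub>C x + d *\<^sub>C x"
    "c *\<^sub>C d *\<^sub>C x = (c * d) *\<^sub>C x" "complex_of_real r *\<^sub>C x = r *\<^sub>R x"
    by (simp_all add: unitz_defs0 algebra_simps scaleC_add_right scaleC_add_left scaleC_scaleC scaleC_of_real
        scaleR_conv_of_real)
  show "x * y * z = x * (y * z)" "(x + y) * z = x * z + y * z" "x * (y + z) = x * y + x * z"
    by (simp_all add: unitz_defs0 algebra_simps scaleC_add_right scaleC_add_left scaleC_scaleC
        mult_scaleC_left mult_scaleC_right)
  show "r *\<^sub>R x * y = r *\<^sub>R (x * y)" "x * r *\<^sub>R y = r *\<^sub>R (x * y)"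
    by (simp_all add: unitz_defs0 algebra_simps scaleC_scaleC scaleC_of_real[symmetric] mult_scaleC_left
        mult_scaleC_right scaleC_add_right scaleR_conv_of_real)
  show "c *\<^sub>C x * y = c *\<^sub>C (x * y)" "x * c *\<^sub>C y = c *\<^sub>C (x * y)"
    by (simp_all add: unitz_defs0 algebra_simps scaleC_scaleC mult_scaleC_left mult_scaleC_right scaleC_add_right)
  show "adj (adj x) = x" "adj (x + y) = adj x + adj y" "adj (c *\<^sub>C x) = cnj c *\<^sub>C adj x"
    "adj (x * y) = adj y * adj x"
    by (simp_all add: unitz_defs0 adj_adj adj_add adj_scaleC adj_mult algebra_simps)
qed

end

instantiation unitz :: (cstar_algebra) real_normed_algebra_1
begin

definition one_unitz :: "'a unitz" where "one_unitz = Unitz 1 0"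

text \<open>The operator norm of left multiplication alone fails to be definite if \<open>'a\<close> has a unit.\<close>

definition norm_unitz :: "'a unitz \<Rightarrow> real" where
  "norm_unitz x = max (cmod (uc x)) (onorm (uop x))"
definition dist_unitz :: "'a unitz \<Rightarrow> 'a unitz \<Rightarrow> real" where
  "dist_unitz x y = norm (x - y)"
definition sgn_unitz :: "'a unitz \<Rightarrow> 'a unitz" where
  "sgn_unitz x = x /\<^sub>R norm x"
definition uniformity_unitz :: "('a unitz \<times> 'a unitz) filter" where
  "uniformity_unitz = (INF e\<in>{0<..}. principal {(x, y). dist x y < e})"
definition open_unitz :: "'a unitz set \<Rightarrow> bool" where
  "open_unitz U \<longleftrightarrow> (\<forall>x\<in>U. eventually (\<lambda>(x', y). x' = x \<longrightarrow> y \<in> U) uniformity)"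

lemmas unitz_defs = unitz_defs0 one_unitz_def

lemma uop_plus: "uop (x + y) = (\<lambda>b. uop x b + uop y b)"
  by (simp add: fun_eq_iff uop_def unitz_defs scaleC_add_left algebra_simps)

lemma uop_times: "uop (x * y) = uop x \<circ> uop y"
  by (simp add: fun_eq_iff uop_def unitz_defs scaleC_add_left scaleC_add_right scaleC_scaleC
      algebra_simps mult_scaleC_left mult_scaleC_right)

lemma uop_scaleC: "uop (c *\<^sub>C x) b = c *\<^sub>C uop x b"
  by (simp add: uop_def unitz_defs scaleC_add_right scaleC_scaleC mult_scaleC_left)

lemma norm_uop: "norm (uop x b) \<le> onorm (uop x) * norm b"
  by (rule onorm[OF bounded_linear_uop])

text \<open>Applying the operator to the adjoint of \<open>ua x\<close> produces the square of the
  norm of \<open>ua x\<close>, up to the scalar part. This gives definiteness and completeness of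
  the norm of the unitization.\<close>

lemma norm_ua: "norm (ua x) \<le> cmod (uc x) + onorm (uop x)"
proof (cases "ua x = 0")
  case True
  then show ?thesis using onorm_pos_le[OF bounded_linear_uop, of x] by simp
next
  case False
  have "norm (ua x) * norm (ua x) = norm (uop x (adj (ua x)) - uc x *\<^sub>C adj (ua x))"
    by (simp add: uop_def cstar_identity' power2_eq_square)
  also have "\<dots> \<le> onorm (uop x) * norm (ua x) + cmod (uc x) * norm (ua x)"
    by (rule order_trans[OF norm_triangle_ineq4 add_mono])
      (use norm_uop[of x "adj (ua x)"] in \<open>simp_all add: norm_scaleC\<close>)
  finally have "norm (ua x) * norm (ua x) \<le> (cmod (uc x) + onorm (uop x)) * norm (ua x)"
    by (simp add: algebra_simps)
  then show ?thesis using False by simp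
qed

lemma norm_unitz_le: "norm x \<le> cmod (uc x) + norm (ua x)" for x :: "'a unitz"
proof -
  have "onorm (uop x) \<le> cmod (uc x) + norm (ua x)"
  proof (rule onorm_bound)
    fix b
    show "norm (uop x b) \<le> (cmod (uc x) + norm (ua x)) * norm b"
      unfolding uop_def distrib_right
      by (intro order_trans[OF norm_triangle_ineq] add_mono norm_mult_ineq) (simp add: norm_scaleC)
  qed simp
  then show ?thesis by (simp add: norm_unitz_def)
qed

text \<open>The product of \<open>uop x b\<close> with its adjoint is
  \<open>adj b * uop (adj x * x) b\<close>, so the C*-identity of the original algebra yields the
  half of the new one that submultiplicativity does not give.\<close>

lemma norm_uop_adj_mult: "(onorm (uop x))\<^sup>2 \<le> onorm (uop (adj x * x))"
proof -
  have "onorm (uop x) \<le> sqrt (onorm (uop (adj x * x)))"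
  proof (rule onorm_bound)
    fix b
    have *: "adj (uop x b) * uop x b = adj b * uop (adj x * x) b"
      by (simp add: uop_times) (simp add: uop_def unitz_defs adj_add adj_scaleC adj_mult algebra_simps
          mult_scaleC_left mult_scaleC_right scaleC_add_right scaleC_scaleC)
    have "(norm (uop x b))\<^sup>2 \<le> norm b * (onorm (uop (adj x * x)) * norm b)"
      unfolding cstar_identity[symmetric] *
      by (rule order_trans[OF norm_mult_ineq]) (simp add: mult_left_mono norm_uop)
    also have "\<dots> = (sqrt (onorm (uop (adj x * x))) * norm b)\<^sup>2"
      by (simp add: power_mult_distrib onorm_pos_le[OF bounded_linear_uop] power2_eq_square)
    finally show "norm (uop x b) \<le> sqrt (onorm (uop (adj x * x))) * norm b"
      by (rule power2_le_imp_le) (simp add: onorm_pos_le[OF bounded_linear_uop])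
  qed (simp add: onorm_pos_le[OF bounded_linear_uop])
  then have "(onorm (uop x))\<^sup>2 \<le> (sqrt (onorm (uop (adj x * x))))\<^sup>2"
    by (rule power_mono) (rule onorm_pos_le[OF bounded_linear_uop])
  then show ?thesis by (simp add: onorm_pos_le[OF bounded_linear_uop])
qed

lemma norm_unitz_scaleC: "norm (c *\<^sub>C x) = cmod c * norm (x :: 'a unitz)"
  proof -
    have le: "onorm (uop (c *\<^sub>C x)) \<le> cmod c * onorm (uop x)" for c x
      by (rule onorm_bound) (auto simp: uop_scaleC norm_scaleC onorm_pos_le[OF bounded_linear_uop]
          mult_left_mono norm_uop mult.assoc)
    have "onorm (uop (c *\<^sub>C x)) = cmod c * onorm (uop x)"
    proof (cases "c = 0")
      case True
      then show ?thesis using le[of c x] onorm_pos_le[OF bounded_linear_uop, of "c *\<^sub>C x"] by simp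
    next
      case False
      have "inverse c *\<^sub>C c *\<^sub>C x = x"
        using False by (simp add: scaleC_scaleC)
      then have "cmod c * onorm (uop x) \<le> cmod c * (cmod (inverse c) * onorm (uop (c *\<^sub>C x)))"
        using le[of "inverse c" "c *\<^sub>C x"] by (intro mult_left_mono) auto
      also have "\<dots> = onorm (uop (c *\<^sub>C x))" using False by (simp add: norm_inverse)
      finally show ?thesis using le[of c x] by simp
    qed
    then show ?thesis by (simp add: norm_unitz_def scaleC_unitz_def norm_mult max_mult_distrib_left)
  qed

lemma norm_unitz_mult: "norm (x * y) \<le> norm x * norm (y :: 'a unitz)"
proof -
  have "onorm (uop (x * y)) \<le> onorm (uop x) * onorm (uop y)"
    unfolding uop_times by (rule onorm_compose[OF bounded_linear_uop bounded_linear_uop])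
  also have "\<dots> \<le> norm x * norm y"
    by (intro mult_mono) (auto simp: norm_unitz_def onorm_pos_le[OF bounded_linear_uop] le_max_iff_disj)
  moreover have "cmod (uc (x * y)) \<le> norm x * norm y"
    unfolding times_unitz_def unitz.sel norm_mult by (intro mult_mono) (auto simp: norm_unitz_def le_max_iff_disj)
  ultimately show ?thesis by (simp add: norm_unitz_def)
qed

lemma norm_unitz_adj_mult_ge: "(norm x)\<^sup>2 \<le> norm (adj x * x :: 'a unitz)"
proof -
  have "cmod (uc (adj x * x)) = (cmod (uc x))\<^sup>2"
    by (simp add: unitz_defs norm_mult power2_eq_square)
  then show ?thesis using norm_uop_adj_mult[of x] by (simp add: norm_unitz_def max_def)
qed

instance
proof
  fix x y z :: "'a unitz" and c d :: complex and r s :: real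
  show "1 * x = x" "x * 1 = x" "(0::'a unitz) \<noteq> 1"
    by (simp_all add: unitz_defs)
  show "dist x y = norm (x - y)" "sgn x = x /\<^sub>R norm x"
    "uniformity = (INF e\<in>{0<..}. principal {(x, y :: 'a unitz). dist x y < e})"
    by (simp_all add: dist_unitz_def sgn_unitz_def uniformity_unitz_def)
  show "open U \<longleftrightarrow> (\<forall>x\<in>U. eventually (\<lambda>(x', y). x' = x \<longrightarrow> y \<in> U) uniformity)" for U :: "'a unitz set"
    by (simp add: open_unitz_def)
  have opos: "0 \<le> onorm (uop x)" by (rule onorm_pos_le[OF bounded_linear_uop])
  show "norm x = 0 \<longleftrightarrow> x = 0"
  proof
    assume "norm x = 0"
    then have "cmod (uc x) = 0" "onorm (uop x) = 0"
      using opos norm_ge_zero[of "uc x"] unfolding norm_unitz_def max_def by (auto split: if_splits)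
    then show "x = 0" using norm_ua[of x] by (intro unitz_eqI) (auto simp: zero_unitz_def)
  next
    assume "x = 0"
    then show "norm x = 0" using norm_unitz_le[of x] opos by (simp add: zero_unitz_def norm_unitz_def)
  qed
  show "norm (x + y) \<le> norm x + norm y"
  proof -
    have "onorm (uop (x + y)) \<le> onorm (uop x) + onorm (uop y)"
      unfolding uop_plus by (rule onorm_triangle[OF bounded_linear_uop bounded_linear_uop])
    moreover have "cmod (uc (x + y)) \<le> cmod (uc x) + cmod (uc y)"
      by (simp add: plus_unitz_def norm_triangle_ineq)
    ultimately show ?thesis by (simp add: norm_unitz_def max_def)
  qed
  show "norm (r *\<^sub>R x) = \<bar>r\<bar> * norm x"
  proof -
    have "r *\<^sub>R x = complex_of_real r *\<^sub>C x"
      by (simp add: unitz_defs scaleC_of_real scaleR_conv_of_real)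
    then show ?thesis by (simp add: norm_unitz_scaleC)
  qed
  show mult: "norm (x * y) \<le> norm x * norm y" by (rule norm_unitz_mult)
  show "norm (1::'a unitz) = 1"
  proof (rule antisym)
    show "norm (1::'a unitz) \<le> 1" using norm_unitz_le[of 1] by (simp add: one_unitz_def)
    show "1 \<le> norm (1::'a unitz)" by (simp add: norm_unitz_def one_unitz_def)
  qed
qed

end

instance unitz :: (cstar_algebra) unital_cstar_algebra
proof
  fix c and x :: "'a unitz"
  show "norm (c *\<^sub>C x) = cmod c * norm x" by (rule norm_unitz_scaleC)
  show "norm (adj x * x) = (norm x)\<^sup>2"
  proof (rule antisym)
    have le: "norm x \<le> norm (adj x)" for x :: "'a unitz"
    proof (cases "norm x = 0")
      case False
      have "norm x * norm x \<le> norm (adj x) * norm x"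
        using norm_unitz_adj_mult_ge[of x] norm_unitz_mult[of "adj x" x] by (simp add: power2_eq_square)
      moreover have "norm x > 0" using False by simp
      ultimately show ?thesis by simp
    qed simp
    have "adj (adj x) = x" by (simp add: adj_unitz_def adj_adj)
    then have "norm (adj x) = norm x" using le[of x] le[of "adj x"] by simp
    then show "norm (adj x * x) \<le> (norm x)\<^sup>2"
      using norm_unitz_mult[of "adj x" x] by (simp add: power2_eq_square)
  qed (rule norm_unitz_adj_mult_ge)
next
  fix X :: "nat \<Rightarrow> 'a unitz"
  assume "Cauchy X"
  have dist: "dist (uc x) (uc y) \<le> dist x y" "dist (ua x) (ua y) \<le> 2 * dist x y" for x y :: "'a unitz"
    using norm_ua[of "x - y"]
    by (auto simp: dist_unitz_def norm_unitz_def minus_unitz_def dist_norm max_def)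
  have "Cauchy (\<lambda>n. uc (X n))"
    using \<open>Cauchy X\<close> dist(1) unfolding Cauchy_def by (meson le_less_trans)
  moreover have "Cauchy (\<lambda>n. ua (X n))"
    unfolding Cauchy_def
  proof (intro allI impI)
    fix e :: real assume "0 < e"
    then obtain M where "\<forall>m\<ge>M. \<forall>n\<ge>M. dist (X m) (X n) < e / 2"
      using \<open>Cauchy X\<close> unfolding Cauchy_def by (meson half_gt_zero)
    then have "dist (ua (X m)) (ua (X n)) < e" if "m \<ge> M" "n \<ge> M" for m n
      using dist(2)[of "X m" "X n"] that by fastforce
    then show "\<exists>M. \<forall>m\<ge>M. \<forall>n\<ge>M. dist (ua (X m)) (ua (X n)) < e" by blast
  qed
  ultimately obtain c a where ca: "(\<lambda>n. uc (X n)) \<longlonglongrightarrow> c" "(\<lambda>n. ua (X n)) \<longlonglongrightarrow> a"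
    by (meson Cauchy_convergent convergent_def)
  have "X \<longlonglongrightarrow> Unitz c a"
    unfolding tendsto_dist_iff[of X]
  proof (rule tendsto_sandwich[of "\<lambda>_. 0"])
    show "(\<lambda>n. cmod (uc (X n) - c) + norm (ua (X n) - a)) \<longlonglongrightarrow> 0"
      using tendsto_add[OF tendsto_norm[OF LIM_zero[OF ca(1)]] tendsto_norm[OF LIM_zero[OF ca(2)]]] by simp
    show "\<forall>\<^sub>F n in sequentially. dist (X n) (Unitz c a) \<le> cmod (uc (X n) - c) + norm (ua (X n) - a)"
      using norm_unitz_le[of "X n - Unitz c a" for n]
      by (intro always_eventually) (simp add: dist_unitz_def minus_unitz_def)
  qed auto
  then show "convergent X" by (auto simp: convergent_def)
qed

definition emb :: "'a::cstar_algebra \<Rightarrow> 'a unitz" where "emb a = Unitz 0 a"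

lemma emb_inject [simp]: "emb a = emb b \<longleftrightarrow> a = b" by (simp add: emb_def)
lemma emb_0 [simp]: "emb 0 = 0" by (simp add: emb_def unitz_defs)
lemma emb_add: "emb (a + b) = emb a + emb b" by (simp add: emb_def unitz_defs)
lemma emb_mult: "emb (a * b) = emb a * emb b" by (simp add: emb_def unitz_defs)
lemma emb_adj: "emb (adj a) = adj (emb a)" by (simp add: emb_def unitz_defs)
lemma emb_scaleC: "emb (c *\<^sub>C a) = c *\<^sub>C emb a" by (simp add: emb_def unitz_defs)

lemma emb_ideal: "emb a * x \<in> range emb" "x * emb a \<in> range emb"
  by (auto simp: emb_def times_unitz_def)

lemma norm_emb [simp]: "norm (emb a) = norm a"
proof (rule antisym)
  show "norm (emb a) \<le> norm a" using norm_unitz_le[of "emb a"] by (simp add: emb_def)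
  show "norm a \<le> norm (emb a)" using norm_ua[of "emb a"] by (simp add: emb_def norm_unitz_def)
qed

section \<open>Homomorphisms of C*-algebras\<close>

lemma neumann:
  fixes x :: "'a::unital_cstar_algebra"
  assumes "norm x < 1"
  obtains y where "y * (1 - x) = 1" "(1 - x) * y = 1" "\<And>c. c * x = x * c \<Longrightarrow> c * y = y * c" "adj x = x \<Longrightarrow> adj y = y"
proof -
  define y where "y = (\<Sum>n. x ^ n)"
  have s: "summable (\<lambda>n. x ^ n)" using assms by (rule complete_algebra_summable_geometric)
  have "y - 1 = (\<Sum>n. x ^ Suc n)" using suminf_split_head[OF s] by (simp add: y_def)
  moreover have "(\<Sum>n. x ^ Suc n) = x * y" "(\<Sum>n. x ^ Suc n) = y * x"
    using suminf_mult[OF s, of x] suminf_mult2[OF s, of x] by (simp_all add: y_def power_commutes)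
  ultimately have "y * (1 - x) = 1" "(1 - x) * y = 1" by (auto simp: algebra_simps)
  moreover have "c * y = y * c" if "c * x = x * c" for c
    unfolding y_def using s suminf_mult[OF s, of c] suminf_mult2[OF s, of c]
      power_commuting_commutes[OF that[symmetric]] by simp
  moreover have "adj y = y" if "adj x = x"
    unfolding y_def using bounded_linear.suminf[OF bounded_linear_adj s] that by simp
  ultimately show ?thesis using that by blast
qed

locale star_hom =
  fixes H :: "'d::star_algebra \<Rightarrow> 'b::star_algebra"
  assumes add: "H (x + y) = H x + H y"
    and scaleC: "H (c *\<^sub>C x) = c *\<^sub>C H x"
    and mult: "H (x * y) = H x * H y"
    and adj: "H (adj x) = adj (H x)"
begin

lemma scaleR: "H (r *\<^sub>R x) = r *\<^sub>R H x"
  by (metis scaleC scaleC_of_real)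

lemma zero [simp]: "H 0 = 0" using scaleR[of 0 0] by simp

lemma minus: "H (- x) = - H x" using scaleR[of "-1" x] by simp

lemma diff: "H (x - y) = H x - H y" using add[of x "-y"] by (simp add: minus)

lemma sum: "H (sum f A) = (\<Sum>i\<in>A. H (f i))"
  by (induction A rule: infinite_finite_induct) (auto simp: add)

end

lemma norm_projection_le_1:
  fixes e :: "'b::cstar_algebra"
  assumes "adj e = e" "e * e = e"
  shows "norm e \<le> 1"
proof -
  have "norm e = (norm e)\<^sup>2" using cstar_identity[of e] assms by simp
  then have "norm e = 0 \<or> norm e = 1" by (simp add: power2_eq_square)
  then show ?thesis by auto
qed

lemma star_hom_emb: "star_hom H \<Longrightarrow> star_hom (\<lambda>x. emb (H x))"
  by (simp add: star_hom_def emb_add emb_scaleC emb_mult emb_adj)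

text \<open>The difference of the squared norm of \<open>x\<close> and \<open>adj x * x\<close> is a
  square s^2, and its image is the square of the self-adjoint \<open>H s\<close>. Hence
  \<open>adj (H x) * H x\<close> is dominated by a multiple of \<open>H 1\<close>, a projection that
  may differ from 1.\<close>

lemma star_hom_contractive:
  fixes H :: "'d::unital_cstar_algebra \<Rightarrow> 'b::unital_cstar_algebra"
  assumes "star_hom H"
  shows "norm (H x) \<le> norm x"
proof -
  interpret star_hom H by fact
  have "nonneg (of_real (norm (adj x * x)) - adj x * x)"
    by (rule nonneg_norm_minus) (auto simp: adj_mult adj_adj)
  then obtain s where s: "adj s = s" "s * s = of_real ((norm x)\<^sup>2) - adj x * x"
    using nonneg_sqrt unfolding cstar_identity by metis
  have "H s * H s = (norm x)\<^sup>2 *\<^sub>R H 1 - adj (H x) * H x"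
    by (simp add: s mult[symmetric] of_real_def diff scaleR adj[symmetric])
  moreover have "adj (H s) = H s" using s adj by metis
  ultimately have "nonneg ((norm x)\<^sup>2 *\<^sub>R H 1 - adj (H x) * H x)" using nonneg_square'[of "H s"] by simp
  from nonneg_norm_mono[OF nonneg_adj_mult this]
  have "(norm (H x))\<^sup>2 \<le> (norm x)\<^sup>2 * norm (H 1)" by (simp add: cstar_identity)
  moreover have "norm (H 1) \<le> 1"
    by (rule norm_projection_le_1) (simp_all add: adj[symmetric] mult[symmetric])
  then have "(norm x)\<^sup>2 * norm (H 1) \<le> (norm x)\<^sup>2" by (simp add: mult_left_le)
  ultimately have "(norm (H x))\<^sup>2 \<le> (norm x)\<^sup>2" by (rule order_trans)
  then show ?thesis by (rule power2_le_imp_le) simp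
qed

text \<open>If the norm dropped, \<open>f\<close> could be chosen to vanish up to
  \<open>norm (H h)\<close> but not at 1, the norm of \<open>h\<close>. Then \<open>H\<close> kills
  \<open>fcalc h f\<close>, so injectivity gives \<open>fcalc h f = 0\<close> and \<open>h\<close>
  would have norm below 1.\<close>

lemma star_hom_isometric:
  fixes H :: "'d::unital_cstar_algebra \<Rightarrow> 'b::unital_cstar_algebra"
  assumes "star_hom H" and inj: "\<And>x. H x = 0 \<Longrightarrow> x = 0"
  shows "norm (H x) = norm x"
proof (rule ccontr)
  interpret star_hom H by fact
  have contr: "norm (H y) \<le> norm y" for y by (rule star_hom_contractive) fact
  assume "norm (H x) \<noteq> norm x"
  then have less: "norm (H x) < norm x" using contr[of x] by simp
  then have x0: "norm x > 0" by (meson less_le_trans norm_ge_zero not_less)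
  define h where "h = (1 / (norm x)\<^sup>2) *\<^sub>R (adj x * x)"
  have h: "unit01 h" unfolding h_def using x0 by (intro nonneg_scaled_unit01 nonneg_adj_mult) (auto simp: cstar_identity)
  have nh: "norm h = 1" using x0 by (simp add: h_def cstar_identity)
  have Hh: "H h = (1 / (norm x)\<^sup>2) *\<^sub>R (adj (H x) * H x)" by (simp add: h_def scaleR mult adj)
  then have nHh: "norm (H h) = (norm (H x))\<^sup>2 / (norm x)\<^sup>2" by (simp add: cstar_identity)
  have "norm (H h) < 1" using less x0 unfolding nHh by (simp add: power_strict_mono)
  \<comment> \<open>Any number strictly between 0 and 1 and not below \<open>norm (H h)\<close>
    would do; the 1/2 only makes \<open>c\<close> positive, since \<open>H h\<close> is divided by
    it.\<close>
  define c where "c = max (norm (H h)) (1/2)"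
  have c: "0 < c" "c < 1" "norm (H h) \<le> c" using \<open>norm (H h) < 1\<close> by (auto simp: c_def)
  have nnHh: "nonneg (H h)" unfolding Hh by (intro nonneg_scaleR nonneg_adj_mult) auto
  define f where "f = (\<lambda>t::real. max 0 (t - c))"
  have f: "continuous_on S f" for S unfolding f_def by (intro continuous_intros)
  have Hpe: "H (peval p h) = H 1 * peval p (H h)" for p
  proof (induction p)
    case (pCons a p)
    have "H 1 * H h = H h * H 1" by (simp add: mult[symmetric])
    then have "H h * (H 1 * peval p (H h)) = H 1 * (H h * peval p (H h))" by (metis mult.assoc)
    then show ?case using pCons by (simp add: add mult scaleR of_real_def algebra_simps)
  qed simp
  have u: "unit01 (H h)" using nnHh contr[of h] nh by (intro unit01I) auto
  have bl: "bounded_linear H"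
    by (rule bounded_linear_intro[of _ 1]) (auto simp: add scaleR contr)
  have "(\<lambda>n. H (peval (bpoly n f) h)) \<longlonglongrightarrow> H (fcalc h f)"
    by (intro bounded_linear.tendsto[OF bl] fcalc_tendsto_bpoly h f)
  moreover have "(\<lambda>n. H (peval (bpoly n f) h)) \<longlonglongrightarrow> H 1 * fcalc (H h) f"
    unfolding Hpe by (intro tendsto_intros fcalc_tendsto_bpoly u f)
  ultimately have "H (fcalc h f) = H 1 * fcalc (H h) f" by (rule LIMSEQ_unique)
  moreover have "fcalc (H h) f = 0"
  proof -
    define g where "g = (1/c) *\<^sub>R H h"
    have g: "unit01 g" unfolding g_def using nnHh c by (intro nonneg_scaled_unit01)
    have "H h = c *\<^sub>R g" using c by (simp add: g_def)
    also have "\<dots> = fcalc g (\<lambda>t. c * t)" by (simp add: fcalc_cmult[OF g] fcalc_ident[OF g] continuous_on_id)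
    finally have "fcalc (H h) f = fcalc g (\<lambda>t. f (c * t))"
      using c by (simp only:) (subst fcalc_compose[OF g f], auto intro!: continuous_intros mult_le_one)
    also have "\<dots> = fcalc g (\<lambda>t. 0)" by (rule fcalc_cong) (use c in \<open>auto simp: f_def mult_left_le\<close>)
    finally show ?thesis using fcalc_const[OF g, of 0] by simp
  qed
  ultimately have "fcalc h f = 0" using inj by simp
  have "h = fcalc h (\<lambda>t. f t + min t c)"
    by (subst fcalc_ident[OF h, symmetric], rule fcalc_cong) (auto simp: f_def)
  also have "\<dots> = fcalc h (\<lambda>t. min t c)"
    using \<open>fcalc h f = 0\<close> by (subst fcalc_add[OF h f]) (auto intro!: continuous_intros)
  finally have "h = fcalc h (\<lambda>t. min t c)" .
  moreover have "norm (fcalc h (\<lambda>t. min t c)) \<le> c"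
    by (rule norm_fcalc_le[OF h]) (use c in \<open>auto intro!: continuous_intros\<close>)
  ultimately show False using nh c by simp
qed

section \<open>Matrix units and the matrix norm\<close>

lemma entry_matrix_unit: "entry (matrix_unit i j d) k l = (if k = i \<and> l = j then d else 0)"
  by (simp add: matrix_unit.rep_eq)

lemma entry_0 [simp]: "entry 0 i j = 0" by (simp add: zero_minf.rep_eq)

lemma entry_add: "entry (x + y) i j = entry x i j + entry y i j" by (simp add: plus_minf.rep_eq)

lemma entry_adj: "entry (adj x) i j = adj (entry x j i)" by (simp add: adj_minf.rep_eq)

lemma entry_sum: "entry (sum f A) i j = (\<Sum>k\<in>A. entry (f k) i j)"
  by (induction A rule: infinite_finite_induct) (auto simp: entry_add)

lemma matrix_unit_Mat: "i < n \<Longrightarrow> j < n \<Longrightarrow> matrix_unit i j d \<in> Mat n"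
  by (auto simp: Mat_def entry_matrix_unit)

lemma matrix_unit_add: "matrix_unit i j (a + b) = matrix_unit i j a + matrix_unit i j (b::'d::star_algebra)"
  by (rule minf_eqI) (simp add: entry_matrix_unit entry_add)

lemma matrix_unit_scaleC: "matrix_unit i j (c *\<^sub>C a) = c *\<^sub>C matrix_unit i j (a::'d::star_algebra)"
  by (rule minf_eqI) (simp add: entry_matrix_unit scaleC_minf.rep_eq)

lemma matrix_unit_mult:
  "matrix_unit i j a * matrix_unit k l b = (if j = k then matrix_unit i l (a * b :: 'd::star_algebra) else 0)"
proof (rule minf_eqI)
  fix p q
  define n where "n = Suc (max i j)"
  have "matrix_unit i j a \<in> Mat n" by (rule matrix_unit_Mat) (auto simp: n_def)
  then have "entry (matrix_unit i j a * matrix_unit k l b) p q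
      = (\<Sum>m<n. entry (matrix_unit i j a) p m * entry (matrix_unit k l b) m q)"
    by (rule entry_times)
  also have "\<dots> = (\<Sum>m<n. if m = j then (if p = i \<and> j = k \<and> q = l then a * b else 0) else 0)"
    by (rule sum.cong) (auto simp: entry_matrix_unit)
  also have "\<dots> = (if p = i \<and> j = k \<and> q = l then a * b else 0)"
    by (simp add: n_def less_Suc_eq_le)
  finally show "entry (matrix_unit i j a * matrix_unit k l b) p q
      = entry (if j = k then matrix_unit i l (a * b) else 0) p q"
    by (simp add: entry_matrix_unit)
qed

lemma adj_matrix_unit: "adj (matrix_unit i j a) = matrix_unit j i (adj (a::'d::star_algebra))"
  by (rule minf_eqI) (simp add: entry_matrix_unit entry_adj)

lemma zero_Mat: "0 \<in> Mat n" by (simp add: Mat_def)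

lemma sum_Mat: "(\<And>i. i \<in> A \<Longrightarrow> f i \<in> Mat n) \<Longrightarrow> sum f A \<in> Mat n" for f :: "'i \<Rightarrow> 'd::star_algebra minf"
  by (induction A rule: infinite_finite_induct) (auto intro: plus_Mat zero_Mat)

lemma Mat_expand:
  assumes "x \<in> Mat n"
  shows "x = (\<Sum>i<n. \<Sum>j<n. matrix_unit i j (entry x i j :: 'd::star_algebra))"
proof (rule minf_eqI)
  fix p q
  have "entry (\<Sum>i<n. \<Sum>j<n. matrix_unit i j (entry x i j)) p q
      = (\<Sum>i<n. if i = p then (\<Sum>j<n. if j = q then entry x p q else 0) else 0)"
    unfolding entry_sum by (intro sum.cong refl) (auto simp: entry_matrix_unit intro!: sum.cong sum.neutral)
  also have "\<dots> = entry x p q" using assms by (auto simp: Mat_def)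
  finally show "entry x p q = entry (\<Sum>i<n. \<Sum>j<n. matrix_unit i j (entry x i j)) p q" by simp
qed

lemma one_mat_Mat: "one_mat n \<in> Mat n"
  unfolding one_mat_def by (intro sum_Mat matrix_unit_Mat) auto

lemma entry_one_mat: "entry (one_mat n) i j = (if i = j \<and> i < n then 1 else 0)"
proof -
  have "entry (one_mat n) i j = (\<Sum>k<n. if k = i then (if i = j then 1 else 0 :: 'a) else 0)"
    unfolding one_mat_def entry_sum by (rule sum.cong) (auto simp: entry_matrix_unit)
  then show ?thesis by simp
qed

lemma adj_one_mat [simp]: "adj (one_mat n) = one_mat n"
  by (rule minf_eqI) (auto simp: entry_adj entry_one_mat)

lemma entry_one_mat_mult: "entry (one_mat n * x) i j = (if i < n then entry x i j else 0)"
proof -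
  have "entry (one_mat n * x) i j = (\<Sum>k<n. if k = i then entry x i j else 0)"
    unfolding entry_times[OF one_mat_Mat] by (rule sum.cong) (auto simp: entry_one_mat)
  then show ?thesis by simp
qed

lemma entry_mult_one_mat: "entry (x * one_mat n) i j = (if j < n then entry x i j else 0)"
proof -
  obtain m where m: "x \<in> Mat m" using ex_Mat by blast
  have "entry (x * one_mat n) i j = (\<Sum>k<m. if k = j then (if j < n then entry x i j else 0) else 0)"
    unfolding entry_times[OF m] by (rule sum.cong) (auto simp: entry_one_mat)
  also have "\<dots> = (if j < n then entry x i j else 0)" using m by (auto simp: Mat_def)
  finally show ?thesis .
qed

lemma one_mat_mult: "x \<in> Mat m \<Longrightarrow> m \<le> n \<Longrightarrow> one_mat n * x = x"
  by (rule minf_eqI) (force simp: entry_one_mat_mult Mat_def)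

lemma mult_one_mat: "x \<in> Mat m \<Longrightarrow> m \<le> n \<Longrightarrow> x * one_mat n = x"
  by (rule minf_eqI) (force simp: entry_mult_one_mat Mat_def)

lemma compress_Mat: "one_mat n * x * one_mat n \<in> Mat n"
  by (auto simp: Mat_def entry_one_mat_mult entry_mult_one_mat split: if_splits)

lemma projection_one_mat: "projection (one_mat n)"
  by (simp add: projection_def one_mat_mult[OF one_mat_Mat])

lemma norm_le_col_norm:
  fixes v :: "nat \<Rightarrow> 'd::unital_cstar_algebra"
  assumes "k < n" shows "norm (v k) \<le> col_norm n v"
proof -
  have "norm (adj (v k) * v k) \<le> norm (\<Sum>i<n. adj (v i) * v i)"
  proof (rule nonneg_norm_mono[OF nonneg_adj_mult])
    have "(\<Sum>i<n. adj (v i) * v i) = adj (v k) * v k + (\<Sum>i\<in>{..<n} - {k}. adj (v i) * v i)"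
      using assms by (intro sum.remove) auto
    then show "nonneg ((\<Sum>i<n. adj (v i) * v i) - adj (v k) * v k)"
      by (simp add: nonneg_sum nonneg_adj_mult)
  qed
  then have "(norm (v k))\<^sup>2 \<le> norm (\<Sum>i<n. adj (v i) * v i)" by (simp add: cstar_identity)
  then show ?thesis unfolding col_norm_def by (rule real_le_rsqrt)
qed

text \<open>The matrix sends the j-th unit column to its own j-th column. The supremum in
  \<open>mat_norm\<close> dominates a member only if it is taken over a bounded set, so boundedness
  on the unit ball of columns is shown on the way.\<close>

lemma norm_entry_le_mat_norm:
  fixes x :: "'d::unital_cstar_algebra minf"
  assumes "i < n" "j < n"
  shows "norm (entry x i j) \<le> mat_norm n x"
proof -
  define v :: "nat \<Rightarrow> 'd" where "v k = (if k = j then 1 else 0)" for k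
  define xv where "xv w i = (\<Sum>j<n. entry x i j * w j)" for w :: "nat \<Rightarrow> 'd" and i :: nat
  have "(\<Sum>i<n. adj (v i) * v i) = (\<Sum>i<n. if i = j then 1 else 0)"
    by (rule sum.cong) (auto simp: v_def)
  then have v: "col_norm n v \<le> 1" using assms by (simp add: col_norm_def)
  have "xv v i = (\<Sum>k<n. if k = j then entry x i j else 0)"
    unfolding xv_def by (rule sum.cong) (auto simp: v_def)
  then have "entry x i j = xv v i" using assms by simp
  then have "norm (entry x i j) \<le> col_norm n (xv v)" using norm_le_col_norm[OF assms(1)] by metis
  also have "\<dots> \<le> (SUP w\<in>{w. col_norm n w \<le> 1}. col_norm n (xv w))"
  proof (rule cSUP_upper)
    show "bdd_above ((\<lambda>w. col_norm n (xv w)) ` {w. col_norm n w \<le> 1})"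
    proof (rule bdd_aboveI2)
      fix w :: "nat \<Rightarrow> 'd" assume "w \<in> {w. col_norm n w \<le> 1}"
      then have w: "norm (w k) \<le> 1" if "k < n" for k
        using norm_le_col_norm[OF that, of w] by simp
      have e: "norm (xv w i) \<le> (\<Sum>j<n. norm (entry x i j))" for i
        unfolding xv_def
      proof (rule order_trans[OF norm_sum sum_mono])
        fix k assume "k \<in> {..<n}"
        then have "norm (entry x i k) * norm (w k) \<le> norm (entry x i k) * 1"
          using w by (intro mult_left_mono) auto
        then show "norm (entry x i k * w k) \<le> norm (entry x i k)"
          using norm_mult_ineq[of "entry x i k" "w k"] by simp
      qed
      have "norm (\<Sum>i<n. adj (xv w i) * xv w i) \<le> (\<Sum>i<n. (\<Sum>j<n. norm (entry x i j))\<^sup>2)"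
        by (rule order_trans[OF norm_sum sum_mono]) (simp add: cstar_identity power_mono e)
      then show "col_norm n (xv w) \<le> sqrt (\<Sum>i<n. (\<Sum>j<n. norm (entry x i j))\<^sup>2)"
        by (simp add: col_norm_def)
    qed
  qed (use v in simp)
  finally show ?thesis by (simp add: mat_norm_def xv_def[abs_def])
qed

section \<open>Quasitraces on matrices\<close>

lemma positiveI: "positive (adj x * x)" by (auto simp: positive_def)

text \<open>Linearity is given only on commutative *-subalgebras. The elements of
  \<open>Mat n\<close> that commute with the commutant \<open>C\<close> of \<open>a\<close> and
  \<open>b\<close> form one: as \<open>a\<close> and \<open>b\<close> commute, they lie in
  \<open>C\<close>, hence \<open>B\<close> lies in \<open>C\<close> and commutes with
  itself.\<close>

lemma quasitrace_add:
  fixes a b :: "'d::star_algebra minf"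
  assumes T: "quasitrace_on (Mat n) T" and ab: "a \<in> Mat n" "b \<in> Mat n"
    and sa: "adj a = a" "adj b = b" and com: "a * b = b * a"
  shows "T (a + b) = T a + T b"
proof -
  define C where "C = {c. c * a = a * c \<and> c * b = b * c}"
  define B where "B = {x \<in> Mat n. \<forall>c\<in>C. c * x = x * c}"
  have Cadj: "adj c \<in> C" if "c \<in> C" for c
  proof -
    have "adj (c * a) = adj (a * c)" "adj (c * b) = adj (b * c)" using that by (auto simp: C_def)
    then show ?thesis by (simp add: C_def adj_mult sa)
  qed
  have BC: "B \<subseteq> C"
  proof
    fix x assume "x \<in> B"
    moreover have "a \<in> C" "b \<in> C" using com by (auto simp: C_def)
    ultimately show "x \<in> C" unfolding B_def by (auto simp: C_def)
  qed
  have "star_subalgebra B"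
    unfolding star_subalgebra_def
  proof (intro conjI ballI allI)
    show "0 \<in> B" by (simp add: B_def zero_Mat)
  next
    fix x y assume xy: "x \<in> B" "y \<in> B"
    then show "x + y \<in> B" by (auto simp: B_def plus_Mat distrib_left distrib_right)
    have "c * (x * y) = x * y * c" if "c \<in> C" for c
      using xy that by (auto simp: B_def) (metis mult.assoc)
    then show "x * y \<in> B" using xy by (auto simp: B_def times_Mat)
  next
    fix c x assume "x \<in> B"
    then show "c *\<^sub>C x \<in> B" by (auto simp: B_def scaleC_Mat mult_scaleC_left mult_scaleC_right)
  next
    fix x assume x: "x \<in> B"
    have "c * adj x = adj x * c" if "c \<in> C" for c
    proof -
      have "adj c * x = x * adj c" using x Cadj[OF that] by (auto simp: B_def)
      then have "adj (adj c * x) = adj (x * adj c)" by simp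
      then show ?thesis by (simp add: adj_mult adj_adj)
    qed
    then show "adj x \<in> B" using x by (auto simp: B_def adj_Mat)
  qed
  moreover have "\<forall>x\<in>B. \<forall>y\<in>B. x * y = y * x" using BC by (auto simp: B_def)
  moreover have "B \<subseteq> Mat n" by (auto simp: B_def)
  moreover have "a \<in> B" "b \<in> B" using ab by (auto simp: B_def C_def)
  ultimately show ?thesis using T unfolding quasitrace_on_def by blast
qed

lemma quasitrace_adj_mult:
  assumes "quasitrace_on (Mat n) T" "x \<in> Mat n"
  shows "0 \<le> Re (T (adj x * x))" "T (x * adj x) = T (adj x * x)"
  using assms unfolding quasitrace_on_def by (auto simp: complex_nonneg_Reals_iff)

text \<open>The matrix unit \<open>?v\<close> exchanges the new diagonal projection with the corner
  one, so both have trace 1; orthogonal projections commute, so their traces add up.\<close>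

lemma quasitrace_one_mat:
  assumes T: "\<And>n. quasitrace_on (Mat n) T" and one: "T (matrix_unit 0 0 1) = 1"
  shows "T (one_mat n :: 'd::unital_cstar_algebra minf) = of_nat n"
proof (induction n)
  case 0
  have "T (0 + 0) = T 0 + T (0 :: 'd minf)" by (rule quasitrace_add[OF T]) (auto simp: zero_Mat)
  then show ?case by (simp add: one_mat_def)
next
  case (Suc n)
  let ?e = "matrix_unit n n 1 :: 'd minf" and ?v = "matrix_unit 0 n 1 :: 'd minf"
  have "T ?e = T (adj ?v * ?v)" by (simp add: adj_matrix_unit matrix_unit_mult)
  also have "\<dots> = T (?v * adj ?v)"
    by (rule quasitrace_adj_mult(2)[OF T, of _ "Suc n", symmetric]) (simp add: matrix_unit_Mat)
  also have "\<dots> = 1" by (simp add: adj_matrix_unit matrix_unit_mult one)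
  finally have e: "T ?e = 1" .
  have z: "one_mat n * ?e = 0" "?e * one_mat n = 0"
    by (auto simp: one_mat_def sum_distrib_left sum_distrib_right matrix_unit_mult)
  have "T (one_mat n + ?e) = T (one_mat n) + T ?e"
    by (rule quasitrace_add[OF T, of _ "Suc n"])
      (auto simp: z adj_matrix_unit matrix_unit_Mat intro: Mat_mono[OF one_mat_Mat])
  then show ?case using Suc e by (simp add: one_mat_def)
qed

text \<open>All that the ideal theory needs to know about the stabilisation. Norms enter through
  injectivity: an injective *-homomorphism is isometric on the corner isomorphic to
  \<open>'d\<close>, and matrix units carry this to every entry.\<close>

locale matrix_dense = star_hom \<psi> for \<psi> :: "'d::unital_cstar_algebra minf \<Rightarrow> 'a::cstar_algebra" +
  assumes inj: "\<psi> x = 0 \<Longrightarrow> x = 0"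
    and dense: "closure (range \<psi>) = UNIV"
begin

definition P :: "nat \<Rightarrow> 'a" where "P n = \<psi> (one_mat n)"

definition E :: "nat \<Rightarrow> nat \<Rightarrow> 'a" where "E i j = \<psi> (matrix_unit i j 1)"

lemma inject: "\<psi> x = \<psi> y \<longleftrightarrow> x = y"
  using inj[of "x - y"] by (auto simp: diff)

lemma adj_P [simp]: "adj (P n) = P n"
  unfolding P_def by (simp only: adj[symmetric] adj_one_mat)

lemma P_mult_le: "m \<le> n \<Longrightarrow> P m * P n = P m" "m \<le> n \<Longrightarrow> P n * P m = P m"
  by (simp_all only: P_def mult[symmetric] one_mat_mult[OF one_mat_Mat] mult_one_mat[OF one_mat_Mat])

lemma P_idem [simp]: "P n * P n = P n" by (simp add: P_mult_le)

lemma norm_P: "norm (P n) \<le> 1" by (rule norm_projection_le_1) simp_all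

lemma E_mult: "E i j * E k l = (if j = k then E i l else 0)"
  by (simp add: E_def mult[symmetric] matrix_unit_mult)

lemma adj_E: "adj (E i j) = E j i"
  unfolding E_def by (simp only: adj[symmetric] adj_matrix_unit adj_one)

lemma norm_E: "norm (E i j) \<le> 1"
proof -
  have "norm (E j j) \<le> 1" by (rule norm_projection_le_1) (simp_all add: adj_E E_mult)
  then have "(norm (E i j))\<^sup>2 \<le> 1" by (simp add: cstar_identity[symmetric] adj_E E_mult)
  then show ?thesis by (simp add: power2_le_imp_le)
qed

definition corner :: "'d \<Rightarrow> 'a" where "corner d = \<psi> (matrix_unit 0 0 d)"

lemma star_hom_corner: "star_hom corner"
  by unfold_locales
    (simp_all only: corner_def matrix_unit_add matrix_unit_scaleC add scaleC mult[symmetric] adj[symmetric]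
      adj_matrix_unit, simp_all add: matrix_unit_mult)

lemma norm_corner: "norm (corner d) = norm d"
proof -
  have "norm (emb (corner d)) = norm d"
  proof (rule star_hom_isometric[OF star_hom_emb[OF star_hom_corner]])
    fix x assume "emb (corner x) = 0"
    then have "corner x = 0" by (metis emb_0 emb_inject)
    then have "matrix_unit 0 0 x = 0" unfolding corner_def by (rule inj)
    then have "entry (matrix_unit 0 0 x) 0 0 = 0" by simp
    then show "x = 0" by (simp add: entry_matrix_unit)
  qed
  then show ?thesis by simp
qed

lemma matrix_unit_corner: "\<psi> (matrix_unit i j d) = E i 0 * corner d * E 0 j"
  by (simp add: E_def corner_def mult[symmetric] matrix_unit_mult)

lemma corner_entry:
  assumes "x \<in> Mat n"
  shows "corner (entry x i j) = E 0 i * \<psi> x * E j 0"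
proof -
  have "matrix_unit 0 i 1 * x * matrix_unit j 0 1 = matrix_unit 0 0 (entry x i j)"
  proof (rule minf_eqI)
    fix p q
    define m where "m = Suc (max n (max i j))"
    have M: "x \<in> Mat m" "matrix_unit 0 i (1::'d) \<in> Mat m" "matrix_unit j 0 (1::'d) \<in> Mat m"
      using assms by (auto simp: m_def intro: Mat_mono matrix_unit_Mat)
    have 1: "entry (matrix_unit 0 i 1 * x) p k = (if p = 0 then entry x i k else 0)" for k
    proof -
      have "entry (matrix_unit 0 i 1 * x) p k = (\<Sum>l<m. if l = i then (if p = 0 then entry x i k else 0) else 0)"
        unfolding entry_times[OF M(2)] by (rule sum.cong) (auto simp: entry_matrix_unit)
      then show ?thesis by (simp add: m_def less_Suc_eq_le)
    qed
    have "entry (matrix_unit 0 i 1 * x * matrix_unit j 0 1) p q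
        = (\<Sum>k<m. if k = j then (if p = 0 \<and> q = 0 then entry x i j else 0) else 0)"
      unfolding entry_times[OF times_Mat[OF M(2,1)]] 1 by (rule sum.cong) (auto simp: entry_matrix_unit)
    then show "entry (matrix_unit 0 i 1 * x * matrix_unit j 0 1) p q = entry (matrix_unit 0 0 (entry x i j)) p q"
      by (simp add: m_def less_Suc_eq_le entry_matrix_unit)
  qed
  then show ?thesis unfolding corner_def E_def mult[symmetric] by simp
qed

text \<open>The crude factor n^2 is harmless: the estimate only has to turn convergence in
  \<open>mat_norm n\<close>, with \<open>n\<close> fixed, into convergence in the algebra.\<close>

lemma norm_psi_le:
  assumes "x \<in> Mat n"
  shows "norm (\<psi> x) \<le> real n * real n * mat_norm n x"
proof -
  have "norm (\<psi> x) = norm (\<Sum>i<n. \<Sum>j<n. E i 0 * corner (entry x i j) * E 0 j)"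
    by (subst Mat_expand[OF assms]) (simp add: sum matrix_unit_corner)
  also have "\<dots> \<le> (\<Sum>i<n. \<Sum>j<n. mat_norm n x)"
  proof (intro order_trans[OF norm_sum sum_mono] norm_sum)
    fix i j assume "i \<in> {..<n}" "j \<in> {..<n}"
    then have "norm (corner (entry x i j)) \<le> mat_norm n x"
      by (simp add: norm_corner norm_entry_le_mat_norm)
    moreover have "norm (E i 0 * corner (entry x i j) * E 0 j) \<le> norm (E i 0 * corner (entry x i j)) * 1"
      by (rule order_trans[OF norm_mult_ineq mult_left_mono]) (simp_all add: norm_E)
    moreover have "norm (E i 0 * corner (entry x i j)) \<le> 1 * norm (corner (entry x i j))"
      by (rule order_trans[OF norm_mult_ineq mult_right_mono]) (simp_all add: norm_E)
    ultimately show "norm (E i 0 * corner (entry x i j) * E 0 j) \<le> mat_norm n x" by simp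
  qed
  finally show ?thesis by simp
qed

text \<open>Approximants from the range of \<open>\<psi>\<close>, cut down to
  \<open>n \<times> n\<close>, have Cauchy entries because \<open>corner\<close> is isometric.
  Completeness of \<open>'d\<close> gives limit entries, so a corner of the completed algebra
  contains nothing beyond honest matrices.\<close>

lemma corner_ex:
  assumes z: "P n * z = z" "z * P n = z"
  obtains y where "y \<in> Mat n" "\<psi> y = z"
proof -
  have "z \<in> closure (range \<psi>)" by (simp add: dense)
  then obtain w where w: "\<And>k. w k \<in> range \<psi>" "w \<longlonglongrightarrow> z" by (auto simp: closure_sequential)
  then have "\<forall>k. \<exists>x. w k = \<psi> x" by blast
  then obtain x where x: "\<And>k. w k = \<psi> (x k)" by metis
  define y where "y k = one_mat n * x k * one_mat n" for k
  have y: "y k \<in> Mat n" for k unfolding y_def by (rule compress_Mat)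
  have "(\<lambda>k. P n * w k * P n) \<longlonglongrightarrow> P n * z * P n" by (intro tendsto_intros w)
  then have lim: "(\<lambda>k. \<psi> (y k)) \<longlonglongrightarrow> z" by (simp add: y_def mult P_def[symmetric] x z)
  have "\<exists>d. (\<lambda>k. entry (y k) i j) \<longlonglongrightarrow> d" for i j
  proof -
    have "(\<lambda>k. E 0 i * \<psi> (y k) * E j 0) \<longlonglongrightarrow> E 0 i * z * E j 0" by (intro tendsto_intros lim)
    then have "Cauchy (\<lambda>k. corner (entry (y k) i j))"
      unfolding corner_entry[OF y] by (rule LIMSEQ_imp_Cauchy)
    moreover have "dist (corner a) (corner b) = dist a b" for a b
      using norm_corner[of "a - b"] star_hom.diff[OF star_hom_corner] by (simp add: dist_norm)
    ultimately have "Cauchy (\<lambda>k. entry (y k) i j)" by (simp add: Cauchy_def)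
    then show ?thesis by (meson Cauchy_convergent convergent_def)
  qed
  then obtain d where d: "\<And>i j. (\<lambda>k. entry (y k) i j) \<longlonglongrightarrow> d i j" by metis
  define yy where "yy = (\<Sum>i<n. \<Sum>j<n. matrix_unit i j (d i j))"
  have yy: "yy \<in> Mat n" unfolding yy_def by (intro sum_Mat matrix_unit_Mat) auto
  have cl: "(\<lambda>k. corner (entry (y k) i j)) \<longlonglongrightarrow> corner (d i j)" for i j
  proof -
    have "corner (entry (y k) i j) - corner (d i j) = corner (entry (y k) i j - d i j)" for k
      by (simp add: star_hom.diff[OF star_hom_corner])
    then have "(\<lambda>k. norm (corner (entry (y k) i j) - corner (d i j))) \<longlonglongrightarrow> 0"
      using tendsto_norm_zero[OF LIM_zero[OF d[of i j]]] by (simp add: norm_corner)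
    then show ?thesis by (rule LIM_zero_cancel[OF tendsto_norm_zero_cancel])
  qed
  have "(\<lambda>k. \<Sum>i<n. \<Sum>j<n. E i 0 * corner (entry (y k) i j) * E 0 j)
      \<longlonglongrightarrow> (\<Sum>i<n. \<Sum>j<n. E i 0 * corner (d i j) * E 0 j)"
    by (intro tendsto_intros cl)
  moreover have "(\<Sum>i<n. \<Sum>j<n. E i 0 * corner (entry (y k) i j) * E 0 j) = \<psi> (y k)" for k
    by (subst Mat_expand[OF y]) (simp add: sum matrix_unit_corner)
  moreover have "(\<Sum>i<n. \<Sum>j<n. E i 0 * corner (d i j) * E 0 j) = \<psi> yy"
    by (simp add: yy_def sum matrix_unit_corner)
  ultimately have "\<psi> yy = z" using LIMSEQ_unique[OF _ lim] by simp
  then show ?thesis using that yy by blast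
qed

lemma P_psi: "x \<in> Mat n \<Longrightarrow> P n * \<psi> x = \<psi> x" "x \<in> Mat n \<Longrightarrow> \<psi> x * P n = \<psi> x"
  by (simp_all add: P_def mult[symmetric] one_mat_mult mult_one_mat)

lemma dense_approx:
  assumes "0 < e"
  obtains n where "norm (z - P n * z) < e" "norm (z - z * P n) < e"
proof -
  have "z \<in> closure (range \<psi>)" by (simp add: dense)
  then obtain x where x: "dist (\<psi> x) z < e / 2"
    using assms by (auto simp: closure_approachable dest: spec[of _ "e/2"])
  obtain n where n: "x \<in> Mat n" using ex_Mat by blast
  have x': "norm (z - \<psi> x) < e / 2" using x by (simp add: dist_norm norm_minus_commute)
  have e1: "z - P n * z = (z - \<psi> x) - P n * (z - \<psi> x)" by (simp add: algebra_simps P_psi[OF n])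
  have "norm (P n * (z - \<psi> x)) \<le> 1 * norm (z - \<psi> x)"
    by (rule order_trans[OF norm_mult_ineq mult_right_mono]) (simp_all add: norm_P)
  then have 1: "norm (z - P n * z) < e"
    using x' norm_triangle_ineq4[of "z - \<psi> x" "P n * (z - \<psi> x)"] unfolding e1 by linarith
  have e2: "z - z * P n = (z - \<psi> x) - (z - \<psi> x) * P n" by (simp add: algebra_simps P_psi[OF n])
  have "norm ((z - \<psi> x) * P n) \<le> norm (z - \<psi> x) * 1"
    by (rule order_trans[OF norm_mult_ineq mult_left_mono]) (simp_all add: norm_P)
  then have "norm (z - z * P n) < e"
    using x' norm_triangle_ineq4[of "z - \<psi> x" "(z - \<psi> x) * P n"] unfolding e2 by linarith
  with 1 show ?thesis using that by blast
qed

text \<open>Square roots and functional calculus need a unit, hence the passage to the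
  unitization.\<close>

definition \<Psi> :: "'d minf \<Rightarrow> 'a unitz" where "\<Psi> x = emb (\<psi> x)"

lemma star_hom_Psi: "star_hom \<Psi>"
  unfolding \<Psi>_def[abs_def] by (rule star_hom_emb) unfold_locales

lemma Psi_inject: "\<Psi> x = \<Psi> y \<longleftrightarrow> x = y" by (simp add: \<Psi>_def inject)

lemma Psi_power: "\<Psi> ((((*) x) ^^ n) x) = \<Psi> x ^ Suc n"
  by (induction n) (simp_all add: star_hom.mult[OF star_hom_Psi])

text \<open>The description \<open>THE\<close> is resolved in the unitization, where powers make
  sense and positive roots are unique. \<open>Suc n\<close> corresponds to \<open>n\<close> further
  factors multiplied onto one copy of the element.\<close>

lemma pos_root_eqI:
  assumes b: "positive b" and a: "\<Psi> b ^ Suc n = \<Psi> a"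
  shows "pos_root (Suc n) a = b"
  unfolding pos_root_def
proof (rule the_equality)
  show "positive b \<and> (((*) b) ^^ (Suc n - 1)) b = a"
    using b a by (simp add: Psi_inject[symmetric] Psi_power)
  fix c assume c: "positive c \<and> (((*) c) ^^ (Suc n - 1)) c = a"
  have nonneg: "nonneg (\<Psi> x)" if "positive x" for x
    using that nonneg_adj_mult by (auto simp: positive_def star_hom.mult[OF star_hom_Psi] star_hom.adj[OF star_hom_Psi])
  have "\<Psi> c ^ Suc n = \<Psi> a" using c Psi_power[of n c] by simp
  then have "\<Psi> c ^ Suc n = \<Psi> b ^ Suc n" using a by simp
  then have "\<Psi> c = \<Psi> b" using c b nonneg nonneg_power_inject[of "\<Psi> c" "\<Psi> b" "Suc n"] by blast
  then show "c = b" by (simp add: Psi_inject)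
qed

lemma dim_fun_one_mat:
  fixes T :: "'d minf \<Rightarrow> complex"
  assumes T: "\<And>n. quasitrace_on (Mat n) T" and one: "T (matrix_unit 0 0 1) = 1"
  shows "dim_fun T (one_mat k) = real k"
proof -
  have p: "adj (one_mat k) * one_mat k = (one_mat k :: 'd minf)" by (simp add: one_mat_mult[OF one_mat_Mat])
  have "pos_root (Suc n) (one_mat k) = (one_mat k :: 'd minf)" for n
  proof (rule pos_root_eqI)
    show "positive (one_mat k :: 'd minf)" by (metis p positiveI)
    have "\<Psi> (one_mat k) * \<Psi> (one_mat k) = \<Psi> (one_mat k)"
      using p by (simp flip: star_hom.mult[OF star_hom_Psi])
    then show "\<Psi> (one_mat k) ^ Suc n = \<Psi> (one_mat k)"
      by (induction n) (simp_all only: power_Suc power_0 mult_1_right)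
  qed
  then have "(\<lambda>n. Re (T (pos_root (Suc n) (one_mat k)))) \<longlonglongrightarrow> real k"
    by (simp add: quasitrace_one_mat[OF T one])
  \<comment> \<open>The value at index 0, which is no root at all, does not affect the
    limit.\<close>
  then have "(\<lambda>n. Re (T (pos_root n (one_mat k)))) \<longlonglongrightarrow> real k" by (rule LIMSEQ_imp_Suc)
  then show ?thesis unfolding dim_fun_def by (rule limI)
qed

end

section \<open>Isometries almost annihilated by elements of small rank\<close>

text \<open>The element \<open>g\<close> is \<open>h\<close> to the power -1/2, formed as the square
  root \<open>s\<close> times the Neumann inverse \<open>y\<close>; both commute with whatever
  commutes with \<open>h\<close>.\<close>

lemma gap_inverse_sqrt:
  fixes h :: "'a::unital_cstar_algebra"
  assumes "adj h = h" "norm (1 - h) < 1"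
  obtains g where "adj g = g" "g * h * g = 1" "\<And>c. c * h = h * c \<Longrightarrow> c * g = g * c"
proof -
  have "nonneg h" using assms by (intro nonnegI[of _ 1]) auto
  then obtain s where s: "adj s = s" "s * s = h" "\<And>c. c * h = h * c \<Longrightarrow> c * s = s * c"
    using nonneg_sqrt by blast
  obtain y where y: "y * (1 - (1 - h)) = 1" "(1 - (1 - h)) * y = 1"
    "\<And>c. c * (1 - h) = (1 - h) * c \<Longrightarrow> c * y = y * c" "adj (1 - h) = 1 - h \<Longrightarrow> adj y = y"
    using neumann[OF assms(2)] by blast
  have yc: "c * y = y * c" if "c * h = h * c" for c
    by (rule y(3)) (simp add: that algebra_simps)
  have sh: "s * h = h * s" using s(2) by (metis mult.assoc)
  have sy: "s * y = y * s" using yc sh by blast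
  have hy: "h * y = 1" "y * h = 1" using y(1,2) by simp_all
  show ?thesis
  proof (rule that[of "s * y"])
    have "adj y = y" using assms(1) by (intro y(4)) (simp add: adj_diff)
    then show "adj (s * y) = s * y" using s(1) sy by (simp add: adj_mult)
    have "s * y * h * (s * y) = s * (y * h) * s * y" by (simp add: mult.assoc)
    also have "\<dots> = 1" using hy s(2) by simp
    finally show "s * y * h * (s * y) = 1" .
    show "c * (s * y) = s * y * c" if "c * h = h * c" for c
      using s(3)[OF that] yc[OF that] by (metis mult.assoc)
  qed
qed

context matrix_dense
begin

abbreviation p :: "nat \<Rightarrow> 'a unitz" where "p n \<equiv> emb (P n)"

lemma Psi_one_mat: "\<Psi> (one_mat n) = p n" by (simp add: \<Psi>_def P_def)

lemma p_simps [simp]: "p n * p n = p n" "adj (p n) = p n"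
  by (simp_all add: emb_mult[symmetric] emb_adj[symmetric])

lemma p_assoc [simp]: "p n * (p n * x) = p n * x" by (simp add: mult.assoc[symmetric])

lemma nonneg_p: "nonneg (p n)" using nonneg_square'[of "p n"] by simp

lemma Psi_ex:
  assumes "p n * x = x" "x * p n = x"
  obtains y where "y \<in> Mat n" "\<Psi> y = x"
proof -
  have "x \<in> range emb" using emb_ideal(1)[of "P n" x] assms by simp
  then obtain z where z: "x = emb z" by blast
  then have "P n * z = z" "z * P n = z" using assms by (simp_all add: emb_mult[symmetric])
  then obtain y where "y \<in> Mat n" "\<psi> y = z" using corner_ex by blast
  then show ?thesis using that z by (simp add: \<Psi>_def)
qed

section \<open>Functional calculus in a matrix corner and dimension\<close>

context
  fixes h :: "'a unitz" and N :: nat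
  assumes h: "unit01 h" and com: "p N * h = h * p N"
begin

lemma p_fcalc_commute: "continuous_on {0..1} g \<Longrightarrow> p N * fcalc h g = fcalc h g * p N"
  by (rule fcalc_commute[OF h _ com])

lemma p_fcalc_mult:
  assumes "continuous_on {0..1} f" "continuous_on {0..1} g"
  shows "p N * fcalc h f * (p N * fcalc h g) = p N * fcalc h (\<lambda>t. f t * g t)"
proof -
  have "p N * fcalc h f * (p N * fcalc h g) = p N * (fcalc h f * p N) * fcalc h g" by (simp add: mult.assoc)
  also have "\<dots> = p N * (fcalc h f * fcalc h g)" unfolding p_fcalc_commute[OF assms(1), symmetric] by (simp add: mult.assoc)
  finally show ?thesis by (simp add: fcalc_mult[OF h assms])
qed

lemma p_fcalc_power:
  assumes "continuous_on {0..1} f"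
  shows "(p N * fcalc h f) ^ Suc n = p N * fcalc h (\<lambda>t. f t ^ Suc n)"
proof (induction n)
  case (Suc n)
  have "(p N * fcalc h f) ^ Suc (Suc n) = p N * fcalc h f * (p N * fcalc h (\<lambda>t. f t ^ Suc n))"
    using Suc by (simp only: power_Suc)
  also have "\<dots> = p N * fcalc h (\<lambda>t. f t * f t ^ Suc n)"
    by (rule p_fcalc_mult) (intro continuous_intros assms)+
  finally show ?case by simp
qed simp

text \<open>\<open>fcalc h g\<close> may have a scalar part, such as g(0), and then lies outside the
  algebra; multiplying by \<open>p N\<close> brings it back into the corner, where it is a
  matrix.\<close>

lemma mfc_ex:
  assumes "continuous_on {0..1} g"
  obtains y where "y \<in> Mat N" "\<Psi> y = p N * fcalc h g"
proof (rule Psi_ex[of N "p N * fcalc h g"])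
  show "p N * fcalc h g * p N = p N * fcalc h g"
    using p_fcalc_commute[OF assms] by (simp add: mult.assoc)
qed (use that in auto)

lemma mfc_adj:
  assumes "continuous_on {0..1} g" "\<Psi> y = p N * fcalc h g"
  shows "adj y = y"
proof -
  have "\<Psi> (adj y) = \<Psi> y"
    using assms p_fcalc_commute[OF assms(1)] adj_fcalc[OF h assms(1)]
    by (simp add: star_hom.adj[OF star_hom_Psi] adj_mult)
  then show ?thesis by (simp add: Psi_inject)
qed

lemma mfc_commute:
  assumes "continuous_on {0..1} f" "\<Psi> x = p N * fcalc h f" "continuous_on {0..1} g" "\<Psi> y = p N * fcalc h g"
  shows "x * y = y * x"
proof -
  have "\<Psi> (x * y) = \<Psi> (y * x)"
    using assms by (simp add: star_hom.mult[OF star_hom_Psi] p_fcalc_mult) (simp add: mult.commute)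
  then show ?thesis by (simp add: Psi_inject)
qed

lemma mfc_positive:
  assumes "continuous_on {0..1} g" "\<And>t. t \<in> {0..1} \<Longrightarrow> 0 \<le> g t" "\<Psi> y = p N * fcalc h g"
  obtains x where "x \<in> Mat N" "adj x * x = y"
proof -
  have sg: "continuous_on {0..1} (\<lambda>t. sqrt (g t))" by (intro continuous_intros assms)
  obtain x where x: "x \<in> Mat N" "\<Psi> x = p N * fcalc h (\<lambda>t. sqrt (g t))" by (rule mfc_ex[OF sg])
  have "\<Psi> (adj x * x) = p N * fcalc h (\<lambda>t. sqrt (g t) * sqrt (g t))"
    using mfc_adj[OF sg x(2)] x(2) p_fcalc_mult[OF sg sg] by (simp add: star_hom.mult[OF star_hom_Psi])
  also have "\<dots> = \<Psi> y" unfolding assms(3) by (intro arg_cong2[where f = "(*)"] refl fcalc_cong) (use assms(2) in auto)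
  finally show ?thesis using that x(1) by (simp add: Psi_inject)
qed

text \<open>Within the calculus of one \<open>h\<close> the difference z - y commutes with y and is
  of the form \<open>adj x * x\<close>, so additivity and positivity of \<open>T\<close> both
  apply.\<close>

lemma quasitrace_mfc_mono:
  assumes T: "quasitrace_on (Mat N) T"
    and y: "y \<in> Mat N" "\<Psi> y = p N * fcalc h f" "continuous_on {0..1} f"
    and z: "z \<in> Mat N" "\<Psi> z = p N * fcalc h g" "continuous_on {0..1} g"
    and le: "\<And>t. t \<in> {0..1} \<Longrightarrow> f t \<le> g t"
  shows "Re (T y) \<le> Re (T z)"
proof -
  have d: "z - y \<in> Mat N" using plus_Mat[OF z(1) scaleC_Mat[OF y(1), of "-1"]] by simp
  have c: "continuous_on {0..1} (\<lambda>t. g t - f t)" by (intro continuous_intros y z)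
  have dP: "\<Psi> (z - y) = p N * fcalc h (\<lambda>t. g t - f t)"
    by (simp add: star_hom.diff[OF star_hom_Psi] y z fcalc_diff[OF h z(3) y(3)] right_diff_distrib)
  obtain x where x: "x \<in> Mat N" "adj x * x = z - y"
    by (rule mfc_positive[OF c _ dP]) (use le in auto)
  have "T (y + (z - y)) = T y + T (z - y)"
    by (rule quasitrace_add[OF T y(1) d mfc_adj[OF y(3,2)] mfc_adj[OF c dP] mfc_commute[OF y(3,2) c dP]])
  moreover have "0 \<le> Re (T (z - y))" using quasitrace_adj_mult(1)[OF T x(1)] x(2) by simp
  ultimately show ?thesis by simp
qed

text \<open>For values in [0,1] the roots grow with their order, so the traces of the roots
  increase, are bounded by the trace \<open>N\<close> of the unit, and have a limit no smaller than
  the first of them, the trace of \<open>b\<close> itself.\<close>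

lemma dim_fun_mfc_ge:
  fixes T :: "'d minf \<Rightarrow> complex"
  assumes T: "\<And>n. quasitrace_on (Mat n) T" and one: "T (matrix_unit 0 0 1) = 1"
    and f: "continuous_on {0..1} f" "\<And>t. t \<in> {0..1} \<Longrightarrow> f t \<in> {0..1}"
    and b: "b \<in> Mat N" "\<Psi> b = p N * fcalc h f"
  shows "Re (T b) \<le> dim_fun T b"
proof -
  have c: "continuous_on {0..1} (\<lambda>t. root (Suc k) (f t))" for k by (intro continuous_intros f)
  have "\<forall>k. \<exists>y\<in>Mat N. \<Psi> y = p N * fcalc h (\<lambda>t. root (Suc k) (f t))" using mfc_ex[OF c] by metis
  then obtain y where y: "\<And>k. y k \<in> Mat N" "\<And>k. \<Psi> (y k) = p N * fcalc h (\<lambda>t. root (Suc k) (f t))"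
    by metis
  have root: "pos_root (Suc k) b = y k" for k
  proof (rule pos_root_eqI)
    obtain x where "adj x * x = y k"
      by (rule mfc_positive[OF c _ y(2)[of k]]) (use f in \<open>auto simp: real_root_ge_zero\<close>)
    then show "positive (y k)" by (metis positiveI)
    have "\<Psi> (y k) ^ Suc k = p N * fcalc h (\<lambda>t. root (Suc k) (f t) ^ Suc k)"
      unfolding y(2) by (rule p_fcalc_power[OF c])
    also have "fcalc h (\<lambda>t. root (Suc k) (f t) ^ Suc k) = fcalc h f"
      by (rule fcalc_cong) (use f in \<open>auto simp del: power_Suc\<close>)
    finally show "\<Psi> (y k) ^ Suc k = \<Psi> b" by (simp add: b)
  qed
  have y0: "y 0 = b" using y(2)[of 0] b(2) by (simp add: Psi_inject[symmetric])
  define X where "X k = Re (T (y k))" for k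
  have "X k \<le> X (Suc k)" for k
    unfolding X_def
  proof (rule quasitrace_mfc_mono[OF T y(1) y(2) c y(1) y(2) c])
    fix t :: real assume t: "t \<in> {0..1}"
    show "root (Suc k) (f t) \<le> root (Suc (Suc k)) (f t)"
      using f(2)[OF t] by (cases "f t = 1") (auto intro!: real_root_increasing)
  qed
  then have inc: "incseq X" by (rule incseq_SucI)
  have "X k \<le> real N" for k
  proof -
    have "\<Psi> (one_mat N) = p N * fcalc h (\<lambda>t. 1)" using fcalc_const[OF h, of 1] by (simp add: Psi_one_mat)
    then have "X k \<le> Re (T (one_mat N))"
      unfolding X_def
      by (rule quasitrace_mfc_mono[OF T y(1) y(2) c one_mat_Mat]) 
        (use f in \<open>auto simp: real_root_le_1_iff\<close>)
    then show ?thesis by (simp add: quasitrace_one_mat[OF T one])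
  qed
  then obtain L where L: "X \<longlonglongrightarrow> L" "\<And>k. X k \<le> L" using incseq_convergent[OF inc] by blast
  have "(\<lambda>n. Re (T (pos_root (Suc n) b))) \<longlonglongrightarrow> L" using L(1) by (simp add: root X_def[abs_def])
  then have "(\<lambda>n. Re (T (pos_root n b))) \<longlonglongrightarrow> L" by (rule LIMSEQ_imp_Suc)
  then have "dim_fun T b = L" unfolding dim_fun_def by (rule limI)
  then show ?thesis using L(2)[of 0] by (simp add: X_def y0)
qed

end

text \<open>\<open>T\<close> does not distinguish \<open>adj x * x\<close> from
  \<open>x * adj x\<close>, and the latter lies below the unit of the corner of rank
  \<open>R\<close>. The complement is written as \<open>adj y * y\<close>; it commutes with
  \<open>x * adj x\<close>, so the two traces add up to \<open>R\<close>.\<close>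

lemma quasitrace_le_rank:
  fixes T :: "'d minf \<Rightarrow> complex"
  assumes T: "\<And>n. quasitrace_on (Mat n) T" and one: "T (matrix_unit 0 0 1) = 1"
    and x: "x \<in> Mat m" "R \<le> m" "P R * \<psi> x = \<psi> x" "norm (\<psi> x) \<le> 1"
  shows "Re (T (adj x * x)) \<le> real R"
proof -
  define w where "w = \<Psi> x * adj (\<Psi> x)"
  have wa: "adj w = w" by (simp add: w_def adj_mult adj_adj)
  have "norm w \<le> 1" using x(4) by (simp add: w_def cstar_identity' \<Psi>_def power_le_one)
  then have "nonneg (1 - w)" using nonneg_norm_minus[OF wa, of 1] by simp
  then obtain s where s: "adj s = s" "s * s = 1 - w" "\<And>c. c * (1 - w) = (1 - w) * c \<Longrightarrow> c * s = s * c"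
    using nonneg_sqrt by blast
  have pw: "p R * w = w" using x(3) by (simp add: w_def \<Psi>_def mult.assoc[symmetric] emb_mult[symmetric])
  have "adj (p R * w) = adj w" by (simp add: pw)
  then have wp: "w * p R = w" by (simp add: adj_mult wa)
  have ps: "p R * s = s * p R" by (rule s(3)) (simp add: algebra_simps pw wp)
  obtain y where y: "y \<in> Mat R" "\<Psi> y = s * p R"
    by (rule Psi_ex[of R "s * p R"]) (simp_all add: mult.assoc ps[symmetric])
  have "\<Psi> (adj y * y) = p R * (s * s) * p R"
    by (simp add: star_hom.mult[OF star_hom_Psi] star_hom.adj[OF star_hom_Psi] y adj_mult s(1) mult.assoc)
  also have "\<dots> = p R - w" by (simp add: s(2) algebra_simps pw wp)
  also have "\<dots> = \<Psi> (one_mat R - x * adj x)"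
    by (simp add: w_def Psi_one_mat star_hom.diff[OF star_hom_Psi] star_hom.mult[OF star_hom_Psi] star_hom.adj[OF star_hom_Psi])
  finally have yy: "adj y * y = one_mat R - x * adj x" by (simp add: Psi_inject)
  have "\<Psi> (one_mat R * (x * adj x)) = \<Psi> (x * adj x * one_mat R)"
    using pw wp by (simp add: w_def Psi_one_mat star_hom.mult[OF star_hom_Psi] star_hom.adj[OF star_hom_Psi])
  then have com: "one_mat R * (x * adj x) = x * adj x * one_mat R" by (simp only: Psi_inject)
  have "T (x * adj x + adj y * y) = T (x * adj x) + T (adj y * y)"
  proof (rule quasitrace_add[OF T, of _ m])
    show "x * adj x \<in> Mat m" using x(1) by (intro times_Mat adj_Mat)
    show "adj y * y \<in> Mat m" using y(1) x(2) by (intro times_Mat adj_Mat) (auto intro: Mat_mono)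
    show "adj (x * adj x) = x * adj x" "adj (adj y * y) = adj y * y" by (simp_all add: adj_mult adj_adj)
    show "x * adj x * (adj y * y) = adj y * y * (x * adj x)"
      unfolding yy left_diff_distrib right_diff_distrib by (simp only: com)
  qed
  moreover have "x * adj x + adj y * y = one_mat R" by (simp add: yy)
  ultimately have "T (x * adj x) + T (adj y * y) = of_nat R" by (simp add: quasitrace_one_mat[OF T one])
  then have "Re (T (x * adj x) + T (adj y * y)) = Re (of_nat R)" by (rule arg_cong)
  then have "real R = Re (T (x * adj x)) + Re (T (adj y * y))" by simp
  moreover have "T (x * adj x) = T (adj x * x)" by (rule quasitrace_adj_mult(2)[OF T x(1)])
  moreover have "0 \<le> Re (T (adj y * y))" by (rule quasitrace_adj_mult(1)[OF T y(1)])
  ultimately show ?thesis by simp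
qed

text \<open>Below a projection, approximate comparison can be made exact: some
  \<open>adj v * \<Psi> b * v\<close> is within distance 1 of \<open>p K\<close>, hence invertible
  in that corner after compression, and its inverse square root corrects \<open>v\<close>.\<close>

lemma cuntz_le_one_mat:
  assumes cz: "cuntz_le (one_mat K) b" and b: "adj b = b"
  obtains y where "adj y * \<Psi> b * y = p K"
proof -
  obtain n where n1: "one_mat K \<in> (Mat n :: 'd minf set)" "b \<in> Mat n"
    and ex: "\<exists>r. (\<forall>k. r k \<in> Mat n) \<and> (\<lambda>k. mat_norm n (adj (r k) * b * r k - one_mat K)) \<longlonglongrightarrow> 0"
    using cz unfolding cuntz_le_def by blast
  then obtain r where n2: "\<And>k. r k \<in> Mat n"
    and lim: "(\<lambda>k. mat_norm n (adj (r k) * b * r k - one_mat K)) \<longlonglongrightarrow> 0" by blast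
  note n = n1 n2
  have "(\<lambda>k. real n * real n * mat_norm n (adj (r k) * b * r k - one_mat K)) \<longlonglongrightarrow> real n * real n * 0"
    by (intro tendsto_intros lim)
  then have "\<forall>\<^sub>F k in sequentially. real n * real n * mat_norm n (adj (r k) * b * r k - one_mat K) < 1"
    by (rule order_tendstoD) simp
  then obtain k where k: "real n * real n * mat_norm n (adj (r k) * b * r k - one_mat K) < 1"
    using eventually_happens' sequentially_bot by blast
  have "adj (r k) * b * r k - one_mat K \<in> Mat n"
    using plus_Mat[OF times_Mat[OF times_Mat[OF adj_Mat[OF n(3)] n(2)] n(3)] scaleC_Mat[OF n(1), of "-1"]] by simp
  from norm_psi_le[OF this] k have "norm (\<Psi> (adj (r k) * b * r k - one_mat K)) < 1" by (simp add: \<Psi>_def)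
  moreover define v where "v = \<Psi> (r k)"
  ultimately have small: "norm (adj v * \<Psi> b * v - p K) < 1"
    by (simp add: star_hom.diff[OF star_hom_Psi] star_hom.mult[OF star_hom_Psi] star_hom.adj[OF star_hom_Psi] Psi_one_mat)
  define g0 where "g0 = p K * (adj v * \<Psi> b * v) * p K"
  have "g0 - p K = p K * (adj v * \<Psi> b * v - p K) * p K" by (simp add: g0_def algebra_simps)
  also have "norm \<dots> \<le> norm (p K) * norm (adj v * \<Psi> b * v - p K) * norm (p K)"
    by (intro order_trans[OF norm_mult_ineq] mult_right_mono norm_mult_ineq norm_ge_zero)
  also have "\<dots> \<le> 1 * norm (adj v * \<Psi> b * v - p K) * 1"
    by (intro mult_mono) (use norm_P in auto)
  finally have g0: "norm (g0 - p K) < 1" using small by simp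
  have "adj (\<Psi> b) = \<Psi> b" using b star_hom.adj[OF star_hom_Psi] by metis
  then have g0a: "adj g0 = g0" by (simp add: g0_def adj_mult adj_adj mult.assoc)
  \<comment> \<open>Adding the complementary projection turns invertibility in the corner into
    invertibility in the unital algebra, and \<open>p K\<close> commutes with the result.\<close>
  define H where "H = g0 + (1 - p K)"
  have Ha: "adj H = H" by (simp add: H_def g0a adj_add adj_diff)
  have "1 - H = - (g0 - p K)" by (simp add: H_def)
  then have "norm (1 - H) < 1" using g0 by (metis norm_minus_cancel)
  then obtain g where g: "adj g = g" "g * H * g = 1" "\<And>c. c * H = H * c \<Longrightarrow> c * g = g * c"
    using gap_inverse_sqrt[OF Ha] by blast
  have pH: "p K * H = g0" "H * p K = g0"
    by (simp_all add: H_def g0_def algebra_simps)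
  have pg: "p K * g = g * p K" by (rule g(3)) (simp add: pH)
  show ?thesis
  proof (rule that[of "v * p K * g"])
    have "adj (v * p K * g) * \<Psi> b * (v * p K * g) = g * g0 * g"
      by (simp add: adj_mult g(1) g0_def mult.assoc)
    also have "\<dots> = g * H * (p K * g)" by (simp add: pH(2)[symmetric] mult.assoc)
    also have "\<dots> = p K" unfolding pg by (simp add: mult.assoc[symmetric] g(2))
    finally show "adj (v * p K * g) * \<Psi> b * (v * p K * g) = p K" .
  qed
qed

text \<open>The compression of \<open>w = W*W\<close> to the spectral part below \<open>d\<close> has dimension at least \<open>N - R\<close>
  in every quasitrace, because \<open>min(w, d)/d\<close> is equivalent to a contraction in the corner
  of rank \<open>R\<close>.\<close>

lemma almost_annihilated_isometry:
  assumes comp: "\<And>q b :: 'd minf. projection q \<Longrightarrow> positive b \<Longrightarrow> dim_gap r q b \<Longrightarrow> cuntz_le q b"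
    and W: "P R * W = W" "W * P N = W" and size: "real K + r + real R < real N" and e: "0 < e"
  obtains t where "P N * t = t" "t * P K = t" "adj t * t = P K" "norm (W * t) \<le> e"
proof -
  define W' where "W' = emb W"
  have W'p: "p R * W' = W'" "W' * p N = W'" using W by (simp_all add: W'_def emb_mult[symmetric])
  define w where "w = adj W' * W'"
  have wp: "w * p N = w" using W'p by (simp add: w_def mult.assoc)
  have "adj (w * p N) = adj w" by (simp add: wp)
  then have pw: "p N * w = w" by (simp add: w_def adj_mult adj_adj)
  define M where "M = norm w + 1"
  have M: "0 < M" by (simp add: M_def add_nonneg_pos)
  define h where "h = (1/M) *\<^sub>R w"
  have h: "unit01 h" unfolding h_def
    using M by (intro nonneg_scaled_unit01) (auto simp: w_def nonneg_adj_mult M_def)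
  have wh: "w = M *\<^sub>R h" using M by (simp add: h_def)
  have ph: "p N * h = h" "h * p N = h" by (simp_all add: h_def pw wp)
  then have com: "p N * h = h * p N" by simp
  \<comment> \<open>The spectral part of \<open>h\<close> below \<open>d\<close> makes the square of
    \<open>norm (W' * t)\<close> at most \<open>M * d\<close>; the choice of \<open>d\<close> turns
    this into the square of \<open>e\<close>.\<close>
  define d where "d = e\<^sup>2 / M"
  have d: "0 < d" using e M by (simp add: d_def)
  define f where "f t = max 0 (1 - t / d)" for t :: real
  have f: "continuous_on {0..1} f" unfolding f_def using d by (intro continuous_intros) auto
  have f01: "f t \<in> {0..1}" if "t \<in> {0..1}" for t using that d by (auto simp: f_def)
  obtain b where b: "b \<in> Mat N" "\<Psi> b = p N * fcalc h f" by (rule mfc_ex[OF h com f])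
  have badj: "adj b = b" by (rule mfc_adj[OF h com f b(2)])
  \<comment> \<open>Then k(t) t k(t) = t / max(t, d) = 1 - f(t), so the rescaled
    \<open>W' * fcalc h k\<close> gives the complement of \<open>b\<close> as
    \<open>adj x * x\<close>. The \<open>max\<close> keeps \<open>k\<close> continuous at 0.\<close>
  define k where "k t = 1 / sqrt (max t d)" for t :: real
  have k: "continuous_on {0..1} k" unfolding k_def using d by (intro continuous_intros) (auto simp: max_def)
  define x where "x = (1 / sqrt M) *\<^sub>R (W' * fcalc h k)"
  have ak: "adj (fcalc h k) = fcalc h k" by (rule adj_fcalc[OF h k])
  have xx: "adj x * x = fcalc h (\<lambda>t. 1 - f t)"
  proof -
    have "adj x * x = (1/M) *\<^sub>R (fcalc h k * w * fcalc h k)"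
      using M by (simp add: x_def adj_mult ak w_def mult.assoc)
    also have "\<dots> = fcalc h k * h * fcalc h k" using M by (simp add: wh)
    also have "\<dots> = fcalc h (\<lambda>t. k t * t * k t)"
      by (subst (2) fcalc_ident[OF h, symmetric]) (simp add: fcalc_mult[OF h] continuous_on_mult k continuous_on_id)
    also have "\<dots> = fcalc h (\<lambda>t. 1 - f t)"
    proof (rule fcalc_cong)
      fix t :: real assume t: "t \<in> {0..1}"
      have "k t * t * k t = t / max t d" using d by (simp add: k_def field_simps)
      also have "\<dots> = 1 - f t" using d t by (auto simp: f_def max_def field_simps)
      finally show "k t * t * k t = 1 - f t" .
    qed
    finally show ?thesis .
  qed
  have c1f: "continuous_on {0..1} (\<lambda>t. 1 - f t)" by (intro continuous_intros f)
  have xp: "x * p N = x"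
  proof -
    have "W' * fcalc h k * p N = W' * (p N * fcalc h k)"
      using fcalc_commute[OF h k com] by (simp add: mult.assoc)
    also have "\<dots> = W' * fcalc h k" by (simp add: mult.assoc[symmetric] W'p)
    finally show ?thesis by (simp add: x_def)
  qed
  have px: "p R * x = x" using W'p by (simp add: x_def mult.assoc[symmetric])
  \<comment> \<open>\<open>x\<close> is rectangular, with rows in \<open>P R\<close> and columns in
    \<open>P N\<close>; the quasitrace sees it inside one square size containing both.\<close>
  define m where "m = max N R"
  have pm: "p m * p R = p R" "p N * p m = p N" 
    by (simp_all add: emb_mult[symmetric] P_mult_le m_def)
  have "p m * x = x" "x * p m = x" using px xp pm by (metis mult.assoc)+
  then obtain x0 where x0: "x0 \<in> Mat m" "\<Psi> x0 = x" by (rule Psi_ex)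
  have "(norm x)\<^sup>2 \<le> 1"
    unfolding cstar_identity[symmetric] xx
  proof (rule norm_fcalc_le[OF h c1f])
    fix t :: real assume "t \<in> {0..1}"
    then show "\<bar>1 - f t\<bar> \<le> 1" using f01[of t] by auto
  qed
  then have nx: "norm x \<le> 1" by (simp add: power2_le_imp_le)
  have "emb (P R * \<psi> x0) = emb (\<psi> x0)"
    using px x0(2) by (simp only: emb_mult \<Psi>_def)
  moreover have "norm (\<psi> x0) = norm (\<Psi> x0)" by (simp add: \<Psi>_def)
  ultimately have x0x: "norm (\<psi> x0) \<le> 1" "P R * \<psi> x0 = \<psi> x0"
    using x0(2) nx by simp_all
  have px2: "p N * fcalc h (\<lambda>t. 1 - f t) = fcalc h (\<lambda>t. 1 - f t)"
  proof -
    have "adj (x * p N) = adj x" by (simp add: xp)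
    then have "p N * adj x = adj x" by (simp add: adj_mult)
    then show ?thesis unfolding xx[symmetric] by (simp add: mult.assoc[symmetric])
  qed
  have bx: "b + adj x0 * x0 = one_mat N"
  proof -
    have "\<Psi> (b + adj x0 * x0) = p N * fcalc h f + p N * fcalc h (\<lambda>t. 1 - f t)"
      by (simp add: star_hom.add[OF star_hom_Psi] star_hom.mult[OF star_hom_Psi] star_hom.adj[OF star_hom_Psi]
          b x0 xx px2)
    also have "\<dots> = p N * fcalc h (\<lambda>t. 1)"
      by (simp add: distrib_left[symmetric] fcalc_add[OF h f c1f, symmetric])
    finally show ?thesis using fcalc_const[OF h, of 1] by (simp add: Psi_one_mat[symmetric] Psi_inject)
  qed
  have gap: "dim_gap r (one_mat K) b"
    unfolding dim_gap_def
  proof (intro ballI allI impI)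
    fix \<tau> :: "'d \<Rightarrow> complex" and T
    assume tau: "\<tau> \<in> QT21" and ext: "matrix_extension \<tau> T"
    have T: "quasitrace_on (Mat n) T" for n using ext by (simp add: matrix_extension_def)
    have one: "T (matrix_unit 0 0 1) = 1" using ext tau by (simp add: matrix_extension_def extends_def QT21_def)
    have xM: "\<Psi> (adj x0 * x0) = p N * fcalc h (\<lambda>t. 1 - f t)"
      by (simp add: star_hom.mult[OF star_hom_Psi] star_hom.adj[OF star_hom_Psi] x0 xx px2)
    obtain z where z: "z \<in> Mat N" "\<Psi> z = p N * fcalc h (\<lambda>t. 1 - f t)" by (rule mfc_ex[OF h com c1f])
    have zx: "z = adj x0 * x0" using z xM by (simp flip: Psi_inject)
    have "T (b + z) = T b + T z"
      by (rule quasitrace_add[OF T b(1) z(1) badj mfc_adj[OF h com c1f z(2)] mfc_commute[OF h com f b(2) c1f z(2)]])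
    then have "T b + T (adj x0 * x0) = of_nat N" by (simp add: zx bx quasitrace_one_mat[OF T one])
    then have "Re (T b + T (adj x0 * x0)) = Re (of_nat N)" by (rule arg_cong)
    then have "real N = Re (T b) + Re (T (adj x0 * x0))" by simp
    moreover have "Re (T (adj x0 * x0)) \<le> real R"
      by (rule quasitrace_le_rank[OF T one x0(1) _ x0x(2,1)]) (simp add: m_def)
    moreover have "Re (T b) \<le> dim_fun T b" by (rule dim_fun_mfc_ge[OF h com T one f f01 b])
    ultimately show "dim_fun T (one_mat K) + r < dim_fun T b"
      using size by (simp add: dim_fun_one_mat[OF T one])
  qed
  obtain b' where "adj b' * b' = b" by (rule mfc_positive[OF h com f _ b(2)]) (use f01 in auto)
  then have "positive b" by (metis positiveI)
  then have "cuntz_le (one_mat K) b" using comp projection_one_mat gap by blast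
  then obtain y where y: "adj y * \<Psi> b * y = p K" using cuntz_le_one_mat badj by blast
  have sf: "continuous_on {0..1} (\<lambda>t. sqrt (f t))" by (intro continuous_intros f)
  define s where "s = p N * fcalc h (\<lambda>t. sqrt (f t))"
  have sa: "adj s = s" using p_fcalc_commute[OF h com sf] adj_fcalc[OF h sf] by (simp add: s_def adj_mult)
  have ss: "s * s = \<Psi> b"
  proof -
    have "s * s = p N * fcalc h (\<lambda>t. sqrt (f t) * sqrt (f t))" unfolding s_def by (rule p_fcalc_mult[OF h com sf sf])
    also have "fcalc h (\<lambda>t. sqrt (f t) * sqrt (f t)) = fcalc h f" by (rule fcalc_cong) (use f01 in auto)
    finally show ?thesis by (simp add: b)
  qed
  \<comment> \<open>As \<open>s\<close> is the root of \<open>b\<close>, the equation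
    \<open>adj y * \<Psi> b * y = p K\<close> says precisely that this is a partial isometry with
    initial projection \<open>p K\<close>; the factor \<open>s\<close> confines its range to the
    spectral part where \<open>h\<close> is at most \<open>d\<close>.\<close>
  define t where "t = s * y * p K"
  have tt: "adj t * t = p K"
  proof -
    have "adj t * t = p K * (adj y * (s * s) * y) * p K" by (simp add: t_def adj_mult sa mult.assoc)
    then show ?thesis by (simp add: ss y)
  qed
  have pt: "p N * t = t" by (simp add: t_def s_def mult.assoc)
  have tp: "t * p K = t" by (simp add: t_def mult.assoc)
  have Wt: "(norm (W' * t))\<^sup>2 \<le> e\<^sup>2"
  proof -
    have shs: "s * h * s = p N * fcalc h (\<lambda>t. t * f t)"
    proof -
      have "s * h = p N * fcalc h (\<lambda>t. sqrt (f t)) * (p N * fcalc h (\<lambda>t. t))" by (simp add: s_def fcalc_ident[OF h] ph)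
      also have "\<dots> = p N * fcalc h (\<lambda>t. sqrt (f t) * t)" by (rule p_fcalc_mult[OF h com sf continuous_on_id])
      finally have "s * h * s = p N * fcalc h (\<lambda>t. sqrt (f t) * t) * (p N * fcalc h (\<lambda>t. sqrt (f t)))" by (simp add: s_def)
      also have "\<dots> = p N * fcalc h (\<lambda>t. sqrt (f t) * t * sqrt (f t))"
        by (rule p_fcalc_mult[OF h com _ sf]) (intro continuous_intros f)
      also have "fcalc h (\<lambda>t. sqrt (f t) * t * sqrt (f t)) = fcalc h (\<lambda>t. t * f t)"
        by (rule fcalc_cong) (use f01 in auto)
      finally show ?thesis .
    qed
    have "nonneg (p N * fcalc h (\<lambda>t. d * f t - t * f t))"
    proof (rule nonneg_mult_commute[OF nonneg_p])
      show "nonneg (fcalc h (\<lambda>t. d * f t - t * f t))"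
      proof (rule nonneg_fcalc[OF h])
        show "continuous_on {0..1} (\<lambda>t. d * f t - t * f t)" by (intro continuous_intros f)
        fix t :: real
        show "0 \<le> d * f t - t * f t" 
          using d by (cases "t \<le> d") (auto simp: f_def max_def mult_right_mono divide_le_eq)
      qed
      show "p N * fcalc h (\<lambda>t. d * f t - t * f t) = fcalc h (\<lambda>t. d * f t - t * f t) * p N"
        by (rule p_fcalc_commute[OF h com]) (intro continuous_intros f)
    qed
    moreover have "p N * fcalc h (\<lambda>t. d * f t - t * f t) = d *\<^sub>R \<Psi> b - s * h * s"
    proof -
      have "fcalc h (\<lambda>t. d * f t - t * f t) = d *\<^sub>R fcalc h f - fcalc h (\<lambda>t. t * f t)"
        by (subst fcalc_diff[OF h]) (auto intro!: continuous_intros f simp: fcalc_cmult[OF h f])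
      then show ?thesis by (simp add: shs b right_diff_distrib)
    qed
    ultimately have "nonneg (M *\<^sub>R (adj (y * p K) * (d *\<^sub>R \<Psi> b - s * h * s) * (y * p K)))"
      using M by (intro nonneg_scaleR nonneg_conj) auto
    also have "M *\<^sub>R (adj (y * p K) * (d *\<^sub>R \<Psi> b - s * h * s) * (y * p K)) = e\<^sup>2 *\<^sub>R p K - adj (W' * t) * (W' * t)"
    proof -
      have "adj (y * p K) * \<Psi> b * (y * p K) = p K * (adj y * \<Psi> b * y) * p K" by (simp add: adj_mult mult.assoc)
      then have 1: "adj (y * p K) * \<Psi> b * (y * p K) = p K" by (simp add: y)
      have "adj (W' * t) * (W' * t) = adj (y * p K) * (s * w * s) * (y * p K)"
        by (simp add: t_def w_def adj_mult sa mult.assoc)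
      then have 2: "adj (W' * t) * (W' * t) = M *\<^sub>R (adj (y * p K) * (s * h * s) * (y * p K))"
        by (simp add: wh)
      have "M * d = e\<^sup>2" using M by (simp add: d_def)
      moreover have "adj (y * p K) * (d *\<^sub>R \<Psi> b - s * h * s) * (y * p K)
          = d *\<^sub>R (adj (y * p K) * \<Psi> b * (y * p K)) - adj (y * p K) * (s * h * s) * (y * p K)"
        by (simp only: right_diff_distrib left_diff_distrib mult_scaleR_left mult_scaleR_right)
      ultimately show ?thesis unfolding 2 by (simp only: 1 scaleR_diff_right scaleR_scaleR)
    qed
    finally have "norm (adj (W' * t) * (W' * t)) \<le> norm (e\<^sup>2 *\<^sub>R p K)"
      by (rule nonneg_norm_mono[OF nonneg_adj_mult])
    also have "\<dots> \<le> e\<^sup>2" using norm_P[of K] by (simp add: mult_left_le)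
    finally show ?thesis by (simp add: cstar_identity)
  qed
  have "t \<in> range emb" using emb_ideal(1)[of "P N" t] pt by simp
  then obtain t' where t': "t = emb t'" by blast
  show ?thesis
  proof (rule that[of t'])
    show "P N * t' = t'" "t' * P K = t'" "adj t' * t' = P K"
      using pt tp tt by (simp_all add: t' flip: emb_mult emb_adj)
    have "norm (W' * t) = norm (W * t')" by (simp add: t' W'_def flip: emb_mult)
    moreover have "norm (W' * t) \<le> e" by (rule power2_le_imp_le[OF Wt]) (use e in simp)
    ultimately show "norm (W * t') \<le> e" by simp
  qed
qed

end

section \<open>Ideals of the stabilisation\<close>

lemma geometric_series:
  fixes f :: "nat \<Rightarrow> 'b::banach"
  assumes "\<And>i. norm (f i) \<le> M" "0 \<le> c" "c < 1"
  shows "summable (\<lambda>i. c ^ i *\<^sub>R f i)" "norm (\<Sum>i. c ^ i *\<^sub>R f i) \<le> M / (1 - c)"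
proof -
  have s: "summable (\<lambda>i. c ^ i * M)" using assms by (intro summable_mult2 summable_geometric) auto
  have le: "norm (c ^ i *\<^sub>R f i) \<le> c ^ i * M" for i using assms by (simp add: mult_left_mono)
  show "summable (\<lambda>i. c ^ i *\<^sub>R f i)" by (rule summable_comparison_test'[OF s le])
  have "norm (\<Sum>i. c ^ i *\<^sub>R f i) \<le> (\<Sum>i. c ^ i * M)" by (rule norm_suminf_le[OF le s])
  also have "\<dots> = M / (1 - c)"
    using assms suminf_mult2[OF summable_geometric[of c], of M] by (simp add: suminf_geometric)
  finally show "norm (\<Sum>i. c ^ i *\<^sub>R f i) \<le> M / (1 - c)" .
qed

lemma two_sided_idealD:
  assumes "two_sided_ideal I"
  shows "0 \<in> I" "x \<in> I \<Longrightarrow> y \<in> I \<Longrightarrow> x + y \<in> I" "x \<in> I \<Longrightarrow> c *\<^sub>C x \<in> I" "x \<in> I \<Longrightarrow> a * x \<in> I" "x \<in> I \<Longrightarrow> x * a \<in> I"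
  using assms by (auto simp: two_sided_ideal_def)

lemma two_sided_ideal_scaleR: "two_sided_ideal I \<Longrightarrow> x \<in> I \<Longrightarrow> r *\<^sub>R x \<in> I"
  by (metis scaleC_of_real two_sided_idealD(3))

lemma two_sided_ideal_diff: "two_sided_ideal I \<Longrightarrow> x \<in> I \<Longrightarrow> y \<in> I \<Longrightarrow> x - y \<in> I"
  using two_sided_idealD(2)[of I x "- y"] two_sided_idealD(3)[of I y "-1"] by simp

lemma two_sided_ideal_sum: "two_sided_ideal I \<Longrightarrow> (\<And>i. i \<in> A \<Longrightarrow> f i \<in> I) \<Longrightarrow> sum f A \<in> I"
  by (induction A rule: infinite_finite_induct) (auto simp: two_sided_idealD)

lemma two_sided_ideal_closure:
  fixes I :: "'a::cstar_algebra set"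
  assumes I: "two_sided_ideal I"
  shows "two_sided_ideal (closure I)"
proof -
  have map: "f x \<in> closure I" if "bounded_linear f" "\<And>z. z \<in> I \<Longrightarrow> f z \<in> I" "x \<in> closure I" for f :: "'a \<Rightarrow> 'a" and x
  proof -
    have "f ` closure I \<subseteq> closure I"
    proof (rule image_closure_subset)
      show "continuous_on (closure I) f" using that(1) by (rule linear_continuous_on)
      show "f ` I \<subseteq> closure I" using that(2) closure_subset by blast
    qed simp
    then show ?thesis using that(3) by blast
  qed
  show ?thesis
    unfolding two_sided_ideal_def
  proof (intro conjI ballI allI)
    show "0 \<in> closure I" using two_sided_idealD(1)[OF I] closure_subset by blast
  next
    fix x y assume "x \<in> closure I" "y \<in> closure I"
    then obtain u v where uv: "\<And>n. u n \<in> I" "u \<longlonglongrightarrow> x" "\<And>n. v n \<in> I" "v \<longlonglongrightarrow> y"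
      by (auto simp: closure_sequential)
    have "(\<lambda>n. u n + v n) \<longlonglongrightarrow> x + y" "\<And>n. u n + v n \<in> I"
      using uv two_sided_idealD(2)[OF I] by (auto intro: tendsto_add)
    then show "x + y \<in> closure I" unfolding closure_sequential by (intro exI[of _ "\<lambda>n. u n + v n"]) simp
  next
    fix c and x assume "x \<in> closure I"
    then show "c *\<^sub>C x \<in> closure I"
      by (rule map[OF bounded_linear_scaleC, rotated]) (rule two_sided_idealD(3)[OF I])
  next
    fix x a assume x: "x \<in> closure I"
    show "a * x \<in> closure I"
      by (rule map[OF bounded_linear_mult_right two_sided_idealD(4)[OF I] x])
    show "x * a \<in> closure I"
      by (rule map[OF bounded_linear_mult_left two_sided_idealD(5)[OF I] x])
  qed
qed

text \<open>Every term has a factor on both sides of \<open>l\<close>; in an algebra without unit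
  \<open>l\<close> itself need not belong, but \<open>l * l * l\<close> does.\<close>

definition ideal_gen :: "'a::star_algebra \<Rightarrow> 'a set" where
  "ideal_gen l = {s. \<exists>xs. s = (\<Sum>(x, y)\<leftarrow>xs. x * l * y)}"

lemma ideal_gen_memI: "x * l * y \<in> ideal_gen l"
  unfolding ideal_gen_def by (rule CollectI, rule exI[of _ "[(x, y)]"]) simp

lemma ideal_gen_expand:
  assumes "s \<in> ideal_gen l"
  obtains x y and m :: nat where "s = (\<Sum>i<m. x i * l * y i)"
proof -
  obtain xs where "s = (\<Sum>(x, y)\<leftarrow>xs. x * l * y)" using assms by (auto simp: ideal_gen_def)
  also have "\<dots> = (\<Sum>i<length xs. fst (xs ! i) * l * snd (xs ! i))"
    by (simp add: sum_list_sum_nth atLeast0LessThan case_prod_beta)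
  finally show ?thesis by (rule that[of "\<lambda>i. fst (xs ! i)" "\<lambda>i. snd (xs ! i)" "length xs"])
qed

lemma two_sided_ideal_ideal_gen: "two_sided_ideal (ideal_gen l)"
  unfolding two_sided_ideal_def
proof (intro conjI ballI allI)
  show "0 \<in> ideal_gen l" unfolding ideal_gen_def by (rule CollectI, rule exI[of _ "[]"]) simp
next
  fix s t assume "s \<in> ideal_gen l" "t \<in> ideal_gen l"
  then obtain xs ys where "s = (\<Sum>(x, y)\<leftarrow>xs. x * l * y)" "t = (\<Sum>(x, y)\<leftarrow>ys. x * l * y)" by (auto simp: ideal_gen_def)
  then show "s + t \<in> ideal_gen l" unfolding ideal_gen_def by (intro CollectI exI[of _ "xs @ ys"]) simp
next
  fix c s assume "s \<in> ideal_gen l"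
  then obtain xs where s: "s = (\<Sum>(x, y)\<leftarrow>xs. x * l * y)" by (auto simp: ideal_gen_def)
  have "c *\<^sub>C (\<Sum>(x, y)\<leftarrow>xs. x * l * y) = (\<Sum>(x, y)\<leftarrow>map (\<lambda>(x, y). (c *\<^sub>C x, y)) xs. x * l * y)"
    by (induction xs) (auto simp: scaleC_add_right mult_scaleC_left)
  then show "c *\<^sub>C s \<in> ideal_gen l" unfolding ideal_gen_def s by blast
next
  fix s a assume "s \<in> ideal_gen l"
  then obtain xs where s: "s = (\<Sum>(x, y)\<leftarrow>xs. x * l * y)" by (auto simp: ideal_gen_def)
  have "a * (\<Sum>(x, y)\<leftarrow>xs. x * l * y) = (\<Sum>(x, y)\<leftarrow>map (\<lambda>(x, y). (a * x, y)) xs. x * l * y)"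
    by (induction xs) (auto simp: distrib_left mult.assoc)
  then show "a * s \<in> ideal_gen l" unfolding ideal_gen_def s by blast
  have "(\<Sum>(x, y)\<leftarrow>xs. x * l * y) * a = (\<Sum>(x, y)\<leftarrow>map (\<lambda>(x, y). (x, y * a)) xs. x * l * y)"
    by (induction xs) (auto simp: distrib_right mult.assoc)
  then show "s * a \<in> ideal_gen l" unfolding ideal_gen_def s by blast
qed

lemma two_sided_ideal_plus:
  assumes "two_sided_ideal I" "two_sided_ideal J"
  shows "two_sided_ideal {x + y | x y. x \<in> I \<and> y \<in> J}"
  unfolding two_sided_ideal_def
proof (intro conjI ballI allI)
  show "0 \<in> {x + y | x y. x \<in> I \<and> y \<in> J}"
    using two_sided_idealD(1)[OF assms(1)] two_sided_idealD(1)[OF assms(2)] by force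
next
  fix u v assume "u \<in> {x + y | x y. x \<in> I \<and> y \<in> J}" "v \<in> {x + y | x y. x \<in> I \<and> y \<in> J}"
  then obtain x y x' y' where "u = x + y" "x \<in> I" "y \<in> J" "v = x' + y'" "x' \<in> I" "y' \<in> J" by blast
  moreover have "x + y + (x' + y') = (x + x') + (y + y')" by simp
  ultimately show "u + v \<in> {x + y | x y. x \<in> I \<and> y \<in> J}"
    using two_sided_idealD(2)[OF assms(1)] two_sided_idealD(2)[OF assms(2)] by blast
next
  fix c u assume "u \<in> {x + y | x y. x \<in> I \<and> y \<in> J}"
  then show "c *\<^sub>C u \<in> {x + y | x y. x \<in> I \<and> y \<in> J}"
    using two_sided_idealD(3)[OF assms(1)] two_sided_idealD(3)[OF assms(2)] 
    by clarsimp (metis scaleC_add_right)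
next
  fix u a assume "u \<in> {x + y | x y. x \<in> I \<and> y \<in> J}"
  then obtain x y where u: "u = x + y" "x \<in> I" "y \<in> J" by blast
  show "a * u \<in> {x + y | x y. x \<in> I \<and> y \<in> J}"
    unfolding u distrib_left using u two_sided_idealD(4)[OF assms(1)] two_sided_idealD(4)[OF assms(2)] by blast
  show "u * a \<in> {x + y | x y. x \<in> I \<and> y \<in> J}"
    unfolding u distrib_right using u two_sided_idealD(5)[OF assms(1)] two_sided_idealD(5)[OF assms(2)] by blast
qed

context matrix_dense
begin

lemma P_sum: "P n = (\<Sum>i<n. E i i)"
  by (simp add: P_def one_mat_def E_def sum)

lemma P_E: "P n * E i j = (if i < n then E i j else 0)"
proof -
  have "P n * E i j = (\<Sum>k<n. if k = i then E i j else 0)"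
    unfolding P_sum sum_distrib_right by (rule sum.cong) (auto simp: E_mult)
  then show ?thesis by simp
qed

lemma P_0 [simp]: "P 0 = 0" by (simp add: P_sum)

lemma norm_P_mult_le: "norm (P n * x) \<le> norm x"
  using order_trans[OF norm_mult_ineq mult_right_mono[OF norm_P norm_ge_zero]] by simp

text \<open>The elements \<open>z i\<close> are stacked into a single \<open>W\<close>: the partial
  isometries \<open>V i\<close> move \<open>P R\<close> to disjoint blocks of
  \<open>P (m * R)\<close>, and \<open>adj (V i)\<close> reads \<open>z i * P N\<close> off again.
  Hence \<open>m * R\<close> enters as the rank.\<close>

lemma almost_annihilated_isometries:
  assumes comp: "\<And>q b :: 'd minf. projection q \<Longrightarrow> positive b \<Longrightarrow> dim_gap r q b \<Longrightarrow> cuntz_le q b"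
    and z: "\<And>i. i < m \<Longrightarrow> P R * z i = z i" and size: "real K + r + real (m * R) < real N" and e: "0 < e"
  obtains t where "P N * t = t" "t * P K = t" "adj t * t = P K" "\<And>i. i < m \<Longrightarrow> norm (z i * t) \<le> e"
proof -
  define V where "V i = (\<Sum>k<R. E (i * R + k) k)" for i
  have VV: "adj (V i) * V j = (if i = j then P R else 0)" for i j
  proof -
    have idx: "i * R + k = j * R + l \<longleftrightarrow> i = j \<and> k = l" if "k < R" "l < R" for k l
    proof
      assume eq: "i * R + k = j * R + l"
      have "(i * R + k) div R = i" "(j * R + l) div R = j" using that by auto
      then show "i = j \<and> k = l" using eq by auto
    qed simp
    have "adj (V i) * V j = (\<Sum>k<R. \<Sum>l<R. E k (i * R + k) * E (j * R + l) l)"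
      by (simp add: V_def adj_sum adj_E sum_product)
    also have "\<dots> = (\<Sum>k<R. \<Sum>l<R. if l = k then (if i = j then E k k else 0) else 0)"
      by (intro sum.cong refl) (auto simp: E_mult idx)
    also have "\<dots> = (if i = j then P R else 0)" by (simp add: P_sum)
    finally show ?thesis .
  qed
  have PV: "P (m * R) * V i = V i" if "i < m" for i
  proof -
    have "i * R + k < m * R" if "k < R" for k
    proof -
      have "i * R + k < Suc i * R" using that by simp
      also have "\<dots> \<le> m * R" using \<open>i < m\<close> by (intro mult_le_mono1) auto
      finally show ?thesis .
    qed
    then show ?thesis by (simp add: V_def sum_distrib_left P_E)
  qed
  have nV: "norm (adj (V i)) \<le> 1" for i
  proof -
    have "(norm (V i))\<^sup>2 \<le> 1" using norm_P[of R] by (simp add: cstar_identity[symmetric] VV)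
    then show ?thesis by (simp add: power2_le_imp_le)
  qed
  define W where "W = (\<Sum>i<m. V i * z i * P N)"
  have VW: "adj (V j) * W = z j * P N" if "j < m" for j
  proof -
    have "adj (V j) * W = (\<Sum>i<m. (adj (V j) * V i) * (z i * P N))"
      by (simp add: W_def sum_distrib_left mult.assoc)
    also have "\<dots> = (\<Sum>i<m. if i = j then P R * (z j * P N) else 0)"
      by (rule sum.cong) (auto simp: VV)
    also have "\<dots> = z j * P N" using that z[OF that] by (simp add: mult.assoc[symmetric])
    finally show ?thesis .
  qed
  have W1: "P (m * R) * W = W" by (simp add: W_def sum_distrib_left mult.assoc[symmetric] PV)
  have W2: "W * P N = W" by (simp add: W_def sum_distrib_right mult.assoc)
  obtain t where t: "P N * t = t" "t * P K = t" "adj t * t = P K" "norm (W * t) \<le> e"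
    by (rule almost_annihilated_isometry[OF _ W1 W2 size e]) (erule (2) comp)
  show ?thesis
  proof (rule that[OF t(1-3)])
    fix i assume i: "i < m"
    have "z i * t = z i * P N * t" by (simp add: mult.assoc t(1))
    also have "\<dots> = adj (V i) * (W * t)" by (simp add: VW[OF i, symmetric] mult.assoc)
    finally have "norm (z i * t) \<le> norm (adj (V i)) * norm (W * t)" by (metis norm_mult_ineq)
    also have "\<dots> \<le> 1 * e" using nV t(4) by (intro mult_mono) auto
    finally show "norm (z i * t) \<le> e" by simp
  qed
qed

text \<open>Some entry of \<open>x\<close> is nonzero, so the elements of \<open>'d\<close> whose
  corner image lies in \<open>J\<close> form a nonzero ideal. By simplicity it is dense; being dense
  in a unital algebra it contains an invertible element near 1, hence 1. Matrix units move this to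
  every diagonal place.\<close>

lemma nonzero_ideal_contains_P:
  assumes simp: "simple_cstar_algebra TYPE('d)" and J: "two_sided_ideal J" and x: "x \<in> J" "x \<noteq> 0"
  shows "P n \<in> J"
proof -
  have "\<exists>i k. E 0 i * x * E k 0 \<noteq> 0"
  proof (rule ccontr)
    assume no: "\<not> ?thesis"
    have "P n * x * P m = 0" for n m
    proof -
      have "P n * x * P m = (\<Sum>i<n. \<Sum>k<m. E i i * x * E k k)"
        by (simp add: P_sum sum_distrib_left sum_distrib_right mult.assoc) (rule sum.swap)
      also have "\<dots> = (\<Sum>i<n. \<Sum>k<m. E i 0 * (E 0 i * x * E k 0) * E 0 k)"
        by (intro sum.cong refl) (simp add: mult.assoc[symmetric] E_mult, simp add: mult.assoc E_mult)
      also have "\<dots> = 0" using no by simp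
      finally show ?thesis .
    qed
    moreover obtain n where n: "norm (x - P n * x) < norm x / 2" "norm (x - x * P n) < norm x / 2"
      using dense_approx[of "norm x / 2" x] x by auto
    moreover have "x - P n * x * P n = (x - P n * x) + P n * (x - x * P n)" for n by (simp add: algebra_simps)
    ultimately have "x = (x - P n * x) + P n * (x - x * P n)" by (metis diff_zero)
    then have "norm x \<le> norm (x - P n * x) + norm (P n * (x - x * P n))" by (metis norm_triangle_ineq)
    also have "\<dots> < norm x / 2 + norm x / 2" using n norm_P_mult_le[of n "x - x * P n"] by linarith
    finally show False by simp
  qed
  then obtain i k where ik: "E 0 i * x * E k 0 \<noteq> 0" by blast
  define z where "z = E 0 i * x * E k 0"
  have zJ: "z \<in> J" using x J by (simp add: z_def two_sided_idealD)
  have P1: "P 1 = E 0 0" by (simp add: P_sum)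
  have "P 1 * z = z" "z * P 1 = z"
    unfolding P1 z_def by (simp_all add: mult.assoc[symmetric] E_mult) (simp add: mult.assoc E_mult)
  then obtain y where y: "y \<in> Mat 1" "\<psi> y = z" by (rule corner_ex)
  have "y = matrix_unit 0 0 (entry y 0 0)" using Mat_expand[OF y(1)] by simp
  then have zc: "z = corner (entry y 0 0)" using y(2) by (simp add: corner_def)
  interpret C: star_hom corner by (rule star_hom_corner)
  define JD where "JD = {d. corner d \<in> J}"
  have JD: "two_sided_ideal JD"
    unfolding two_sided_ideal_def JD_def by (auto simp: C.add C.scaleC C.mult two_sided_idealD[OF J])
  have d: "entry y 0 0 \<in> JD" "entry y 0 0 \<noteq> 0" using zJ zc ik by (auto simp: JD_def z_def)
  have "{0} \<subset> closure JD" using d closure_subset[of JD] two_sided_idealD(1)[OF JD] by blast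
  then have "closure JD = UNIV"
    using simp two_sided_ideal_closure[OF JD] unfolding simple_cstar_algebra_def proper_ideal_def by blast
  then obtain e where e: "e \<in> JD" "norm (1 - e) < 1"
    using closure_approachable[of 1 JD] by (auto simp: dist_norm norm_minus_commute dest: spec[of _ 1])
  obtain w where "w * (1 - (1 - e)) = 1" using neumann[OF e(2)] by metis
  then have "1 \<in> JD" using two_sided_idealD(4)[OF JD e(1), of w] by simp
  then have "E 0 0 \<in> J" by (simp add: JD_def corner_def E_def)
  then have "E i 0 * E 0 0 * E 0 i \<in> J" for i using J by (simp only: two_sided_idealD)
  then have "E i i \<in> J" for i by (simp add: E_mult)
  then show ?thesis unfolding P_sum by (intro two_sided_ideal_sum[OF J])
qed

section \<open>Diagonal elements along an increasing sequence of corners\<close>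

definition Q :: "(nat \<Rightarrow> nat) \<Rightarrow> nat \<Rightarrow> 'a" where "Q n i = P (n (Suc i)) - P (n i)"

text \<open>For monotone \<open>n\<close> the \<open>Q n i\<close> are orthogonal projections and
  \<open>c ^ i\<close> is the eigenvalue on the i-th of them. Nothing acts on
  \<open>P (n 0)\<close>, so the sequences used for factoring start at 0.\<close>

definition Dg :: "(nat \<Rightarrow> nat) \<Rightarrow> real \<Rightarrow> 'a" where "Dg n c = (\<Sum>i. c ^ i *\<^sub>R Q n i)"

context
  fixes n :: "nat \<Rightarrow> nat" assumes mono: "mono n"
begin

lemma nle: "i \<le> j \<Longrightarrow> n i \<le> n j" using mono by (rule monoD)

lemma adj_Q [simp]: "adj (Q n i) = Q n i" by (simp add: Q_def adj_diff)

lemma Q_P: "Q n i * P (n j) = (if i < j then Q n i else 0)" "P (n j) * Q n i = (if i < j then Q n i else 0)"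
  using nle[of "Suc i" j] nle[of i j] nle[of j i] nle[of j "Suc i"] nle[of i "Suc i"]
  by (auto simp: Q_def left_diff_distrib right_diff_distrib P_mult_le not_less)

lemma Q_mult: "Q n i * Q n j = (if i = j then Q n i else 0)"
proof -
  have "Q n i * Q n j = Q n i * P (n (Suc j)) - Q n i * P (n j)" by (simp add: Q_def[of n j] right_diff_distrib)
  then show ?thesis by (auto simp: Q_P less_Suc_eq)
qed

lemma norm_Q: "norm (Q n i) \<le> 1" by (rule norm_projection_le_1) (simp_all add: Q_mult)

lemma sum_Q: "(\<Sum>i<k. Q n i) = P (n k) - P (n 0)"
  by (induction k) (simp_all add: Q_def)

context
  fixes c :: real assumes c: "0 \<le> c" "c < 1"
begin

lemma summable_Dg: "summable (\<lambda>i. c ^ i *\<^sub>R Q n i)"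
  by (rule geometric_series[OF norm_Q c])

lemma Dg_Q: "Dg n c * Q n j = c ^ j *\<^sub>R Q n j" "Q n j * Dg n c = c ^ j *\<^sub>R Q n j"
proof -
  have "Dg n c * Q n j = (\<Sum>i. c ^ i *\<^sub>R Q n i * Q n j)"
    unfolding Dg_def by (rule suminf_mult2[OF summable_Dg])
  also have "\<dots> = (\<Sum>i. if i = j then c ^ j *\<^sub>R Q n j else 0)"
    by (rule suminf_cong) (simp add: Q_mult)
  also have "\<dots> = c ^ j *\<^sub>R Q n j" using sums_single[of j "\<lambda>_. c ^ j *\<^sub>R Q n j"] by (simp add: sums_iff eq_commute)
  finally show "Dg n c * Q n j = c ^ j *\<^sub>R Q n j" .
  have "Q n j * Dg n c = (\<Sum>i. Q n j * c ^ i *\<^sub>R Q n i)"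
    unfolding Dg_def by (rule suminf_mult[OF summable_Dg, symmetric])
  also have "\<dots> = (\<Sum>i. if i = j then c ^ j *\<^sub>R Q n j else 0)"
    by (rule suminf_cong) (simp add: Q_mult)
  also have "\<dots> = c ^ j *\<^sub>R Q n j" using sums_single[of j "\<lambda>_. c ^ j *\<^sub>R Q n j"] by (simp add: sums_iff eq_commute)
  finally show "Q n j * Dg n c = c ^ j *\<^sub>R Q n j" .
qed

lemma adj_Dg: "adj (Dg n c) = Dg n c"
  unfolding Dg_def using bounded_linear.suminf[OF bounded_linear_adj summable_Dg] by simp

lemma Dg_P:
  "Dg n c * P (n j) = (\<Sum>i<j. c ^ i *\<^sub>R Q n i)" "P (n j) * Dg n c = (\<Sum>i<j. c ^ i *\<^sub>R Q n i)"
proof -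
  have fin: "(\<Sum>i. if i < j then c ^ i *\<^sub>R Q n i else 0) = (\<Sum>i<j. c ^ i *\<^sub>R Q n i)"
    by (subst suminf_finite[of "{..<j}"]) auto
  have "Dg n c * P (n j) = (\<Sum>i. c ^ i *\<^sub>R Q n i * P (n j))"
    unfolding Dg_def by (rule suminf_mult2[OF summable_Dg])
  also have "\<dots> = (\<Sum>i. if i < j then c ^ i *\<^sub>R Q n i else 0)" by (rule suminf_cong) (simp add: Q_P)
  finally show "Dg n c * P (n j) = (\<Sum>i<j. c ^ i *\<^sub>R Q n i)" by (simp only: fin)
  have "P (n j) * Dg n c = (\<Sum>i. P (n j) * c ^ i *\<^sub>R Q n i)"
    unfolding Dg_def by (rule suminf_mult[OF summable_Dg, symmetric])
  also have "\<dots> = (\<Sum>i. if i < j then c ^ i *\<^sub>R Q n i else 0)" by (rule suminf_cong) (simp add: Q_P)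
  finally show "P (n j) * Dg n c = (\<Sum>i<j. c ^ i *\<^sub>R Q n i)" by (simp only: fin)
qed

lemma norm_Dg_tail: "norm (Dg n c - P (n j) * Dg n c) \<le> c ^ j / (1 - c)"
proof -
  have "Dg n c - P (n j) * Dg n c = Dg n c - (\<Sum>i<j. c ^ i *\<^sub>R Q n i)" by (simp only: Dg_P)
  also have "\<dots> = (\<Sum>i. c ^ (i + j) *\<^sub>R Q n (i + j))"
    using suminf_split_initial_segment[OF summable_Dg, of j] by (simp add: Dg_def)
  also have "\<dots> = (\<Sum>i. c ^ i *\<^sub>R (c ^ j *\<^sub>R Q n (i + j)))" by (simp add: power_add)
  also have "norm \<dots> \<le> c ^ j / (1 - c)"
    by (rule geometric_series(2)[OF _ c]) (use c norm_Q in \<open>simp add: mult_left_le\<close>)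
  finally show ?thesis .
qed

text \<open>\<open>t\<close> has its range in \<open>P (n (Suc j))\<close>; what it has outside
  \<open>P (n j)\<close> lies in the single block \<open>Q n j\<close>, where the diagonal element
  is the scalar \<open>c ^ j\<close>. Only the part in \<open>P (n j)\<close> causes an
  error.\<close>

lemma norm_Dg_minus_scalar:
  assumes "P (n (Suc j)) * t = t"
  shows "norm (Dg n c * t - c ^ j *\<^sub>R t) \<le> (norm (Dg n c) + 1) * norm (P (n j) * t)"
proof -
  have "Dg n c * t = Dg n c * P (n (Suc j)) * t" by (simp add: mult.assoc assms)
  also have "\<dots> = Dg n c * P (n j) * t + c ^ j *\<^sub>R (Q n j * t)" by (simp add: Dg_P distrib_right)
  also have "Q n j * t = t - P (n j) * t" by (simp add: Q_def left_diff_distrib assms)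
  finally have "Dg n c * t - c ^ j *\<^sub>R t = Dg n c * (P (n j) * t) - c ^ j *\<^sub>R (P (n j) * t)"
    by (simp add: algebra_simps)
  also have "norm \<dots> \<le> norm (Dg n c * (P (n j) * t)) + norm (c ^ j *\<^sub>R (P (n j) * t))"
    by (rule norm_triangle_ineq4)
  also have "\<dots> \<le> norm (Dg n c) * norm (P (n j) * t) + 1 * norm (P (n j) * t)"
    using c by (intro add_mono norm_mult_ineq) (auto simp: power_le_one mult_left_le_one_le)
  finally show ?thesis by (simp add: distrib_right)
qed

end

lemma Dg_mult:
  assumes "0 \<le> c" "c < 1" "0 \<le> d" "d < 1"
  shows "Dg n c * Dg n d = Dg n (c * d)"
proof -
  have "Dg n c * Dg n d = (\<Sum>i. Dg n c * d ^ i *\<^sub>R Q n i)"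
    unfolding Dg_def[of n d] by (rule suminf_mult[OF summable_Dg[OF assms(3,4)], symmetric])
  also have "\<dots> = Dg n (c * d)"
    unfolding Dg_def[of n "c * d"]
    by (rule suminf_cong) (simp add: Dg_Q[OF assms(1,2)] power_mult_distrib mult.commute)
  finally show ?thesis .
qed

end

text \<open>With \<open>n\<close> growing so fast that the remainder of \<open>a\<close> outside
  \<open>P (n i)\<close> is of order (c/2)^i, the blocks of \<open>a\<close> can be divided by
  \<open>c ^ i\<close>, and the spare factor 2^-i lets the quotient converge.\<close>

lemma factor_Dg:
  assumes c: "0 < c" "c < 1"
  obtains n y where "mono n" "n 0 = 0" "a = Dg n c * y"
proof -
  have "\<forall>i. \<exists>k. norm (a - P k * a) < (c / 2) ^ i"
  proof
    fix i
    obtain k where "norm (a - P k * a) < (c / 2) ^ i" by (rule dense_approx[of "(c/2)^i" a]) (use c in auto)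
    then show "\<exists>k. norm (a - P k * a) < (c / 2) ^ i" ..
  qed
  then obtain k where k: "\<And>i. norm (a - P (k i) * a) < (c / 2) ^ i" by metis
  \<comment> \<open>Cumulative sums force monotonicity and \<open>n 0 = 0\<close> while keeping
    \<open>n i\<close> above the required \<open>k i\<close> for positive i; the index 0 is paid for
    by the term \<open>norm a\<close> in the constant below.\<close>
  define n where "n i = (\<Sum>j<i. k (Suc j))" for i
  have mono: "mono n" by (rule monoI) (auto simp: n_def intro!: sum_mono2)
  have kn: "k (Suc i) \<le> n (Suc i)" for i by (simp add: n_def)
  have na: "norm (a - P (n i) * a) \<le> 2 * (norm a + 1) * (c / 2) ^ i" for i
  proof (cases i)
    case 0
    then show ?thesis by (simp add: n_def)
  next
    case (Suc j)
    have "a - P (n i) * a = (a - P (k i) * a) - P (n i) * (a - P (k i) * a)"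
      using kn[of j] Suc by (simp add: right_diff_distrib mult.assoc[symmetric] P_mult_le)
    then have "norm (a - P (n i) * a) \<le> norm (a - P (k i) * a) + norm (P (n i) * (a - P (k i) * a))"
      by (metis norm_triangle_ineq4)
    also have "\<dots> \<le> 2 * (c / 2) ^ i" using norm_P_mult_le[of "n i" "a - P (k i) * a"] k[of i] by linarith
    also have "\<dots> \<le> 2 * (norm a + 1) * (c / 2) ^ i" using c by (simp add: distrib_right mult_right_mono)
    finally show ?thesis .
  qed
  \<comment> \<open>Division by \<open>c ^ i\<close>, with the factor 2^-i set aside as the weight
    of the geometric series.\<close>
  define f where "f i = (2 ^ i / c ^ i) *\<^sub>R (Q n i * a)" for i
  have "norm (f i) \<le> 2 * (norm a + 1)" for i
  proof -
    have "Q n i * a = P (n (Suc i)) * (a - P (n i) * a)"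
      using monoD[OF mono, of i "Suc i"] by (simp add: Q_def left_diff_distrib right_diff_distrib mult.assoc[symmetric] P_mult_le)
    then have "norm (Q n i * a) \<le> 2 * (norm a + 1) * (c / 2) ^ i"
      using norm_P_mult_le na order_trans by metis
    then have "(2 ^ i / c ^ i) * norm (Q n i * a) \<le> (2 ^ i / c ^ i) * (2 * (norm a + 1) * (c / 2) ^ i)"
      using c by (intro mult_left_mono) auto
    also have "\<dots> = 2 * (norm a + 1)" using c by (simp add: power_divide field_simps)
    finally show ?thesis using c by (simp add: f_def)
  qed
  from geometric_series(1)[OF this, of "1/2"] have s: "summable (\<lambda>i. (1 / 2) ^ i *\<^sub>R f i)" by simp
  define y where "y = (\<Sum>i. (1 / 2) ^ i *\<^sub>R f i)"
  have trm: "Dg n c * (1 / 2) ^ i *\<^sub>R f i = Q n i * a" for i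
  proof -
    have "Dg n c * (1 / 2) ^ i *\<^sub>R f i = ((1 / 2) ^ i * (2 ^ i / c ^ i)) *\<^sub>R (Dg n c * Q n i * a)"
      by (simp add: f_def mult.assoc)
    also have "\<dots> = Q n i * a" using c by (simp add: Dg_Q[OF mono] power_divide)
    finally show ?thesis .
  qed
  have "(\<lambda>i. Q n i * a) sums (Dg n c * y)"
    using sums_mult[OF summable_sums[OF s], of "Dg n c"] unfolding trm y_def .
  moreover have "(\<lambda>i. Q n i * a) sums a"
    unfolding sums_def
  proof (rule LIM_zero_cancel)
    have "(\<Sum>i<m. Q n i * a) - a = - (a - P (n m) * a)" for m
      by (simp add: sum_distrib_right[symmetric] sum_Q[OF mono] left_diff_distrib) (simp add: n_def)
    then have "norm ((\<Sum>i<m. Q n i * a) - a) \<le> 2 * (norm a + 1) * (c / 2) ^ m" for m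
      using na[of m] by (simp only: norm_minus_cancel)
    then have le: "\<forall>\<^sub>F m in sequentially. norm ((\<Sum>i<m. Q n i * a) - a) \<le> 2 * (norm a + 1) * (c / 2) ^ m"
      by (intro always_eventually allI)
    have "(\<lambda>m. 2 * (norm a + 1) * (c / 2) ^ m) \<longlonglongrightarrow> 2 * (norm a + 1) * 0"
      using c by (intro tendsto_intros LIMSEQ_power_zero) auto
    then have "(\<lambda>m. 2 * (norm a + 1) * (c / 2) ^ m) \<longlonglongrightarrow> 0" by (simp only: mult_zero_right)
    then show "(\<lambda>m. (\<Sum>i<m. Q n i * a) - a) \<longlonglongrightarrow> 0" by (rule Lim_null_comparison[OF le])
  qed
  ultimately have "a = Dg n c * y" by (rule sums_unique2[symmetric])
  moreover have "n 0 = 0" by (simp add: n_def)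
  ultimately show ?thesis using that mono by blast
qed

section \<open>The Pedersen ideal\<close>

theorem Ped_proper:
  assumes simp: "simple_cstar_algebra TYPE('d)"
    and comp: "\<And>q b :: 'd minf. projection q \<Longrightarrow> positive b \<Longrightarrow> dim_gap r q b \<Longrightarrow> cuntz_le q b"
  shows "(Ped :: 'a set) \<noteq> UNIV"
proof -
  have "norm (corner 1) = norm (1::'d)" by (rule norm_corner)
  then have nE: "norm (E 0 0) = 1" by (simp add: corner_def E_def)
  have "Ped = ideal_gen (E 0 0)"
    unfolding Ped_def
  proof (rule Least_equality)
    have "range \<psi> \<subseteq> ideal_gen (E 0 0)"
    proof
      fix z assume "z \<in> range \<psi>"
      then obtain x where z: "z = \<psi> x" by blast
      obtain n where n: "x \<in> Mat n" using ex_Mat by blast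
      have "E i i \<in> ideal_gen (E 0 0)" for i using ideal_gen_memI[of "E i 0" "E 0 0" "E 0 i"] by (simp add: E_mult)
      then have "P n \<in> ideal_gen (E 0 0)" unfolding P_sum by (intro two_sided_ideal_sum two_sided_ideal_ideal_gen)
      then have "P n * \<psi> x \<in> ideal_gen (E 0 0)" by (rule two_sided_idealD(5)[OF two_sided_ideal_ideal_gen])
      then show "z \<in> ideal_gen (E 0 0)" by (simp add: P_psi[OF n] z)
    qed
    then have "closure (ideal_gen (E 0 0)) = UNIV" using dense closure_mono by blast
    then show "two_sided_ideal (ideal_gen (E 0 0)) \<and> closure (ideal_gen (E 0 0)) = UNIV"
      using two_sided_ideal_ideal_gen by blast
  next
    fix I :: "'a set" assume I: "two_sided_ideal I \<and> closure I = UNIV"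
    have "\<not> I \<subseteq> {0}"
    proof
      assume "I \<subseteq> {0}"
      then have "closure I \<subseteq> {0}" by (rule closure_minimal) simp
      then have "E 0 0 = 0" using I by blast
      then show False using nE by simp
    qed
    then obtain x where "x \<in> I" "x \<noteq> 0" by blast
    then have "P 1 \<in> I" using nonzero_ideal_contains_P[OF simp] I by blast
    then have E: "E 0 0 \<in> I" by (simp add: P_sum)
    show "ideal_gen (E 0 0) \<le> I"
    proof
      fix s assume "s \<in> ideal_gen (E 0 0)"
      then obtain x y and m :: nat where "s = (\<Sum>i<m. x i * E 0 0 * y i)" by (rule ideal_gen_expand)
      moreover have "x i * E 0 0 * y i \<in> I" for i using I E two_sided_idealD(4,5) by blast
      ultimately show "s \<in> I" using I by (simp add: two_sided_ideal_sum)
    qed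
  qed
  moreover have "Dg (\<lambda>i. i) (1/2) \<notin> ideal_gen (E 0 0)"
  proof
    have mono: "mono (\<lambda>i::nat. i)" by (rule monoI)
    define a where "a = Dg (\<lambda>i. i) (1/2)"
    assume "Dg (\<lambda>i. i) (1/2) \<in> ideal_gen (E 0 0)"
    then obtain x y and m :: nat where a: "a = (\<Sum>i<m. x i * E 0 0 * y i)" unfolding a_def by (rule ideal_gen_expand)
    obtain N :: nat where N: "1 + r + real m < real N" using reals_Archimedean2 by blast
    \<comment> \<open>A left inverse of \<open>a\<close> up to \<open>P N\<close>: it undoes the
      eigenvalues 2^-k on the first \<open>N\<close> blocks, and so bounds \<open>a * t\<close> from
      below.\<close>
    define g where "g = (\<Sum>k<N. 2 ^ k *\<^sub>R Q (\<lambda>i. i) k)"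
    have ga: "g * a = P N"
    proof -
      have "g * a = (\<Sum>k<N. Q (\<lambda>i. i) k)"
        unfolding g_def a_def sum_distrib_right
        by (rule sum.cong) (simp_all add: Dg_Q[OF mono] power_one_over)
      then show ?thesis by (simp add: sum_Q[OF mono])
    qed
    define C where "C = (\<Sum>i<m. norm (x i))"
    have C: "0 \<le> C" by (simp add: C_def sum_nonneg)
    \<comment> \<open>Small enough that \<open>norm g * (C * e) < 1\<close>, whereas
      \<open>t\<close> has norm 1.\<close>
    define e where "e = 1 / (2 * (norm g * C + 1))"
    have pos: "0 < norm g * C + 1" using C by (simp add: add_nonneg_pos)
    have e: "0 < e" using pos by (simp add: e_def)
    have PE: "P 1 * (E 0 0 * y i) = E 0 0 * y i" for i by (simp add: mult.assoc[symmetric] P_E)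
    have size: "real 1 + r + real (m * 1) < real N" using N by simp
    obtain t where t: "P N * t = t" "t * P 1 = t" "adj t * t = P 1" "\<And>i. i < m \<Longrightarrow> norm (E 0 0 * y i * t) \<le> e"
      by (rule almost_annihilated_isometries[where z = "\<lambda>i. E 0 0 * y i", OF _ PE size e]) (erule (2) comp, blast)
    have "norm (a * t) \<le> (\<Sum>i<m. norm (x i) * e)"
      unfolding a sum_distrib_right
    proof (rule order_trans[OF norm_sum sum_mono])
      fix i assume "i \<in> {..<m}"
      then have "norm (x i) * norm (E 0 0 * y i * t) \<le> norm (x i) * e" using t(4) by (intro mult_left_mono) auto
      then show "norm (x i * E 0 0 * y i * t) \<le> norm (x i) * e"
        using norm_mult_ineq[of "x i" "E 0 0 * y i * t"] by (simp add: mult.assoc)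
    qed
    then have at: "norm (a * t) \<le> C * e" by (simp add: C_def sum_distrib_right)
    have "t = g * (a * t)" using t(1) ga by (simp add: mult.assoc[symmetric])
    then have "norm t \<le> norm g * norm (a * t)" by (metis norm_mult_ineq)
    also have "\<dots> \<le> norm g * (C * e)" using at by (rule mult_left_mono) simp
    also have "\<dots> = (norm g * C) / (2 * (norm g * C + 1))" by (simp add: e_def)
    also have "\<dots> < 1"
    proof -
      have lt1: "v / (2 * (v + 1)) < 1" if "0 \<le> v" for v :: real
        using that by (simp add: field_simps)
      show ?thesis by (rule lt1) (use C in simp)
    qed
    finally have "norm t < 1" .
    moreover have "(norm t)\<^sup>2 = 1" using nE t(3) by (simp add: cstar_identity[symmetric] P_sum)
    ultimately show False by (metis abs_norm_cancel abs_square_eq_1 less_irrefl)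
  qed
  ultimately show ?thesis by blast
qed

end

section \<open>Maximal ideals\<close>

context matrix_dense
begin

text \<open>As 256 is the square of 16 and i + j is at most twice the maximum, decay in the larger
  index alone splits into decay in both.\<close>

lemma power_max_le: "(1/256::real) ^ max i j \<le> (1/16) ^ i * (1/16) ^ j"
proof -
  have "(1/256::real) ^ max i j = (1/16) ^ (2 * max i j)" by (simp add: power_mult power2_eq_square)
  also have "\<dots> \<le> (1/16) ^ (i + j)" by (rule power_decreasing) auto
  finally show ?thesis by (simp add: power_add)
qed

text \<open>\<open>l\<close> may have infinite rank, so \<open>t\<close> can almost annihilate only
  the part \<open>P k * l\<close>; the remaining tail of \<open>l\<close> is small in norm by
  itself.\<close>

lemma sum_mult_bound:
  fixes l :: 'a
  assumes tail: "norm (l - P k * l) \<le> e" and t: "norm t \<le> 1"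
    and xy: "\<And>i. i < m \<Longrightarrow> norm (P k * l * y i * t) \<le> d" "\<And>i. i < m \<Longrightarrow> norm (x i) \<le> C" "\<And>i. i < m \<Longrightarrow> norm (y i) \<le> C"
    and e: "0 \<le> e"
  shows "norm ((\<Sum>i<m. x i * l * y i) * t) \<le> real m * (C * (d + e * C))"
proof -
  have "norm ((\<Sum>i<m. x i * l * y i) * t) \<le> (\<Sum>i<m. C * (d + e * C))"
    unfolding sum_distrib_right
  proof (rule order_trans[OF norm_sum sum_mono])
    fix i assume "i \<in> {..<m}"
    then have i: "i < m" by simp
    have C: "0 \<le> C" using xy(2)[OF i] norm_ge_zero order_trans by blast
    have "l * (y i * t) = P k * l * y i * t + (l - P k * l) * (y i * t)" by (simp add: algebra_simps)
    then have "norm (l * (y i * t)) \<le> norm (P k * l * y i * t) + norm ((l - P k * l) * (y i * t))"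
      by (metis norm_triangle_ineq)
    also have "\<dots> \<le> d + e * (C * 1)"
      using i xy tail t e C
      by (intro add_mono order_trans[OF norm_mult_ineq[of "l - P k * l"]] order_trans[OF norm_mult_ineq[of "y i"]] mult_mono) auto
    finally have "norm (x i) * norm (l * (y i * t)) \<le> C * (d + e * C)"
      using i xy(2)[OF i] by (intro mult_mono) (auto intro: order_trans[OF norm_ge_zero])
    then show "norm (x i * l * y i * t) \<le> C * (d + e * C)"
      using norm_mult_ineq[of "x i" "l * (y i * t)"] by (simp add: mult.assoc)
  qed
  then show ?thesis by simp
qed

text \<open>With \<open>L = \<Sum>i. 2\<^sup>-\<^sup>i Q\<^sub>i t\<^sub>i*\<close>, \<open>R = \<Sum>i. 2\<^sup>-\<^sup>i t\<^sub>i Q\<^sub>i\<close> and \<open>D = \<Sum>i. 8\<^sup>-\<^sup>i Q\<^sub>i\<close>, all sums starting late, \<open>L j R = D (1 + F)\<close>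
  with \<open>\<parallel>F\<parallel> < 1\<close>.  Putting the weights of \<open>R\<close> into \<open>F\<close> keeps \<open>F\<close> small although \<open>D\<close> has no bounded inverse.\<close>

lemma Dg_mem_of_diagonal_dominance:
  assumes J: "two_sided_ideal J" and PJ: "\<And>k. P k \<in> J" and n: "mono n"
    and j: "j \<in> J"
    and t: "\<And>i. m \<le> i \<Longrightarrow> adj (t i) * t i = P (n (Suc i))" "\<And>i. m \<le> i \<Longrightarrow> t i * P (n (Suc i)) = t i"
    and bound: "\<And>i k. m \<le> i \<Longrightarrow> m \<le> k \<Longrightarrow>
      norm (adj (t i) * j * t k - (if i = k then (1/2) ^ i *\<^sub>R P (n (Suc i)) else 0)) \<le> G * (1/256) ^ max i k"
  shows "Dg n (1/8) \<in> J"
proof -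
  have G: "0 \<le> G"
  proof -
    have "0 \<le> G * (1/256) ^ max m m" using bound[of m m] norm_ge_zero order_trans by blast
    moreover have "(0::real) < (1/256) ^ max m m" by simp
    ultimately show ?thesis by (meson mult_neg_pos not_le)
  qed
  obtain k where k: "(1/4::real) ^ k < 1 / (8 * G + 1)"
    using real_arch_pow_inv[of "1 / (8 * G + 1)" "1/4"] G by auto
  \<comment> \<open>Before \<open>m\<close> there are no isometries, and from \<open>k\<close> on
    the tail of the error sums to less than 1: it is at most (1/4)^k * 2G * 4/3.\<close>
  define M where "M = max k m"
  define q where "q i = (if M \<le> i then Q n i else 0)" for i
  define s where "s i = t i * q i" for i
  have qq: "q i * q k = (if i = k then q i else 0)" for i k by (simp add: q_def Q_mult[OF n])
  have aq: "adj (q i) = q i" for i by (simp add: q_def adj_Q[OF n])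
  have nq: "norm (q i) \<le> 1" for i by (simp add: q_def norm_Q[OF n])
  have Mm: "m \<le> M" by (simp add: M_def)
  have ns: "norm (s i) \<le> 1" for i
  proof (cases "M \<le> i")
    case True
    then have "(norm (t i))\<^sup>2 \<le> 1" using t(1)[of i] Mm norm_P[of "n (Suc i)"] by (simp add: cstar_identity[symmetric])
    then have "norm (t i) \<le> 1" by (simp add: power2_le_imp_le)
    then have "norm (t i) * norm (q i) \<le> 1 * 1" using nq by (intro mult_mono) auto
    then show ?thesis using norm_mult_ineq[of "t i" "q i"] by (simp add: s_def)
  qed (simp add: s_def q_def)
  define R where "R = (\<Sum>i. (1/2) ^ i *\<^sub>R s i)"
  have sR: "summable (\<lambda>i. (1/2) ^ i *\<^sub>R s i)" by (rule geometric_series(1)[OF ns]) auto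
  define L where "L = (\<Sum>i. (1/2) ^ i *\<^sub>R adj (s i))"
  have sL: "summable (\<lambda>i. (1/2) ^ i *\<^sub>R adj (s i))" by (rule geometric_series(1)[of _ 1]) (auto simp: ns)
  define f where "f i = adj (s i) * j * R - (1/4) ^ i *\<^sub>R q i" for i
  have qs: "q i * adj (s i) = adj (s i)" for i
  proof -
    have "q i * adj (s i) = (q i * q i) * adj (t i)" by (simp add: s_def adj_mult aq mult.assoc)
    then show ?thesis by (simp add: qq s_def adj_mult aq)
  qed
  have qf: "q i * f k = (if i = k then f k else 0)" for i k
  proof -
    have "q i * f k = q i * (q k * f k)" using qs[of k] by (simp add: f_def right_diff_distrib mult.assoc[symmetric] qq)
    also have "\<dots> = (if i = k then q k * f k else 0)" by (simp add: mult.assoc[symmetric] qq)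
    also have "q k * f k = f k" using qs[of k] by (simp add: f_def right_diff_distrib mult.assoc[symmetric] qq)
    finally show ?thesis .
  qed
  have ent: "norm (adj (s i) * j * s k - (if i = k then (1/2) ^ i *\<^sub>R q i else 0)) \<le> G * ((1/16) ^ i * (1/16) ^ k)" for i k
  proof (cases "M \<le> i \<and> M \<le> k")
    case True
    have qP: "q i * P (n (Suc i)) = q i" by (simp add: q_def Q_P[OF n])
    have "adj (s i) * j * s k - (if i = k then (1/2) ^ i *\<^sub>R q i else 0)
        = q i * (adj (t i) * j * t k - (if i = k then (1/2) ^ i *\<^sub>R P (n (Suc i)) else 0)) * q k"
      using qP by (auto simp: s_def adj_mult aq algebra_simps qq) (simp add: mult.assoc[symmetric] qq)
    also have "norm \<dots> \<le> norm (q i) * norm (adj (t i) * j * t k - (if i = k then (1/2) ^ i *\<^sub>R P (n (Suc i)) else 0)) * norm (q k)"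
      by (intro order_trans[OF norm_mult_ineq] mult_right_mono norm_mult_ineq norm_ge_zero)
    also have "\<dots> \<le> 1 * (G * (1/256) ^ max i k) * 1"
      using True Mm G nq by (intro mult_mono bound) auto
    also have "\<dots> \<le> G * ((1/16) ^ i * (1/16) ^ k)" using G power_max_le[of i k] by (simp add: mult_left_mono)
    finally show ?thesis .
  next
    case False
    then show ?thesis using G by (auto simp: s_def q_def)
  qed
  have nf: "norm (f i) \<le> 2 * G * (1/16) ^ i" for i
  proof -
    have d: "(\<lambda>k. if k = i then (1/4) ^ i *\<^sub>R q i else 0) sums ((1/4) ^ i *\<^sub>R q i)"
      using sums_single[of i "\<lambda>_. (1/4) ^ i *\<^sub>R q i"] by simp
    have "(\<lambda>k. adj (s i) * j * (1/2) ^ k *\<^sub>R s k) sums (adj (s i) * j * R)"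
      unfolding R_def by (rule sums_mult[OF summable_sums[OF sR]])
    from sums_diff[OF this d]
    have "(\<lambda>k. adj (s i) * j * (1/2) ^ k *\<^sub>R s k - (if k = i then (1/4) ^ i *\<^sub>R q i else 0)) sums f i"
      by (simp add: f_def)
    moreover have "adj (s i) * j * (1/2) ^ k *\<^sub>R s k - (if k = i then (1/4) ^ i *\<^sub>R q i else 0)
        = (1/2) ^ k *\<^sub>R (adj (s i) * j * s k - (if i = k then (1/2) ^ i *\<^sub>R q i else 0))" for k
      by (auto simp: scaleR_diff_right power_mult_distrib[symmetric])
    ultimately have "f i = (\<Sum>k. (1/2) ^ k *\<^sub>R (adj (s i) * j * s k - (if i = k then (1/2) ^ i *\<^sub>R q i else 0)))"
      by (simp add: sums_iff)
    also have "norm \<dots> \<le> (G * (1/16) ^ i) / (1 - 1/2)"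
    proof (rule geometric_series(2))
      fix k
      have "G * ((1/16) ^ i * (1/16) ^ k) \<le> G * ((1/16) ^ i * 1)"
        using G by (intro mult_left_mono power_le_one) auto
      then show "norm (adj (s i) * j * s k - (if i = k then (1/2) ^ i *\<^sub>R q i else 0)) \<le> G * (1/16) ^ i"
        using ent[of i k] by linarith
    qed auto
    finally show ?thesis by simp
  qed
  have f0: "f i = 0" if "i < M" for i using that by (simp add: f_def s_def q_def)
  \<comment> \<open>Row i of \<open>L * j * R\<close> is 2^-i (4^-i \<open>q i\<close> +
    \<open>f i\<close>), which is 8^-i times \<open>q i\<close> + 4^i \<open>f i\<close>. The factor
    4^i is harmless since \<open>f i\<close> is of order 16^-i.\<close>
  define F where "F = (\<Sum>i. 4 ^ i *\<^sub>R f i)"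
  have nf4: "norm (16 ^ i *\<^sub>R f i) \<le> 2 * G" for i
  proof -
    have "16 ^ i * norm (f i) \<le> 16 ^ i * (2 * G * (1/16) ^ i)" by (intro mult_left_mono nf) auto
    also have "\<dots> = 2 * G" by (simp add: power_divide)
    finally show ?thesis by simp
  qed
  have eq4: "4 ^ i *\<^sub>R f i = (1/4) ^ i *\<^sub>R (16 ^ i *\<^sub>R f i)" for i
  proof -
    have "(1/4::real) ^ i * 16 ^ i = 4 ^ i" by (simp flip: power_mult_distrib)
    then show ?thesis by simp
  qed
  have sF: "summable (\<lambda>i. 4 ^ i *\<^sub>R f i)" unfolding eq4 by (rule geometric_series(1)[OF nf4]) auto
  have nF: "norm F < 1"
  proof -
    have "F = (\<Sum>i. 4 ^ (i + M) *\<^sub>R f (i + M))"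
      using suminf_split_initial_segment[OF sF, of M] by (simp add: F_def f0)
    also have "\<dots> = (\<Sum>i. (1/4) ^ i *\<^sub>R ((1/4) ^ M *\<^sub>R (16 ^ (i + M) *\<^sub>R f (i + M))))"
      unfolding eq4 by (simp add: power_add mult.assoc)
    also have "norm \<dots> \<le> ((1/4) ^ M * (2 * G)) / (1 - 1/4)"
      by (rule geometric_series(2)) (use nf4 in \<open>auto simp: mult_left_mono simp del: scaleR_scaleR\<close>)
    also have "\<dots> \<le> (1/4) ^ k * (2 * G) / (1 - 1/4)"
      using G by (intro divide_right_mono mult_right_mono power_decreasing) (auto simp: M_def)
    also have "\<dots> \<le> 1 / (8 * G + 1) * (2 * G) / (1 - 1/4)"
      using G k by (intro divide_right_mono mult_right_mono) auto
    also have "\<dots> < 1" using G by (simp add: divide_simps)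
    finally show ?thesis .
  qed
  define D where "D = (\<Sum>i. (1/8) ^ i *\<^sub>R q i)"
  have sD: "summable (\<lambda>i. (1/8) ^ i *\<^sub>R q i)" by (rule geometric_series(1)[OF nq]) auto
  have qF: "q i * F = 4 ^ i *\<^sub>R f i" for i
  proof -
    have "(\<lambda>k. q i * 4 ^ k *\<^sub>R f k) sums (q i * F)"
      unfolding F_def by (rule sums_mult[OF summable_sums[OF sF]])
    moreover have "q i * 4 ^ k *\<^sub>R f k = (if k = i then 4 ^ i *\<^sub>R f i else 0)" for k by (simp add: qf)
    ultimately show ?thesis using sums_single[of i "\<lambda>_. 4 ^ i *\<^sub>R f i"] by (simp add: sums_iff)
  qed
  have "L * j * R = D + D * F"
  proof -
    have "(\<lambda>i. (1/2) ^ i *\<^sub>R adj (s i) * (j * R)) sums (L * (j * R))"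
      unfolding L_def by (rule sums_mult2[OF summable_sums[OF sL]])
    moreover have "(1/2) ^ i *\<^sub>R adj (s i) * (j * R) = (1/8) ^ i *\<^sub>R q i + (1/8) ^ i *\<^sub>R q i * F" for i
    proof -
      have 1: "(1/2::real) ^ i * (1/4) ^ i = (1/8) ^ i" "(1/8::real) ^ i * 4 ^ i = (1/2) ^ i"
        by (simp_all flip: power_mult_distrib)
      have "adj (s i) * (j * R) = f i + (1/4) ^ i *\<^sub>R q i" by (simp add: f_def mult.assoc)
      then have "(1/2) ^ i *\<^sub>R adj (s i) * (j * R) = (1/2) ^ i *\<^sub>R f i + ((1/2) ^ i * (1/4) ^ i) *\<^sub>R q i"
        by (simp add: scaleR_add_right)
      also have "\<dots> = (1/8) ^ i *\<^sub>R q i + ((1/8) ^ i * 4 ^ i) *\<^sub>R f i" unfolding 1 by simp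
      finally show ?thesis by (simp add: qF)
    qed
    moreover have "(\<lambda>i. (1/8) ^ i *\<^sub>R q i + (1/8) ^ i *\<^sub>R q i * F) sums (D + D * F)"
      unfolding D_def by (intro sums_add sums_mult2 summable_sums sD)
    ultimately show ?thesis by (simp add: mult.assoc sums_iff)
  qed
  moreover have "L * j * R \<in> J" using J j by (simp add: two_sided_idealD)
  ultimately have DF: "D + D * F \<in> J" by simp
  have "D \<in> J"
  proof -
    \<comment> \<open>The inverse \<open>w\<close> of 1 + F exists only in the unitization. Still
      \<open>(D + D * F) * w\<close> lies in \<open>J\<close>, because multiplication by
      \<open>w\<close> amounts to a scalar multiple plus a product inside the algebra.\<close>
    have "norm (- emb F) < 1" using nF by simp
    then obtain w where w: "(1 - (- emb F)) * w = 1" using neumann by blast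
    have "emb D = emb D * ((1 - (- emb F)) * w)" by (simp only: w mult_1_right)
    also have "\<dots> = emb (D + D * F) * w" by (simp add: emb_add emb_mult algebra_simps)
    also have "\<dots> = emb (uc w *\<^sub>C (D + D * F) + (D + D * F) * ua w)"
      by (simp add: emb_def times_unitz_def)
    finally have "D = uc w *\<^sub>C (D + D * F) + (D + D * F) * ua w" by (simp only: emb_inject)
    then show ?thesis using DF J two_sided_idealD(2,3,5) by metis
  qed
  \<comment> \<open>The omitted rows are finitely many multiples of differences of the projections
    \<open>P k\<close>, which belong to \<open>J\<close>.\<close>
  have "Dg n (1/8) - D = (\<Sum>i. (1/8) ^ i *\<^sub>R Q n i - (1/8) ^ i *\<^sub>R q i)"
    unfolding Dg_def D_def by (rule suminf_diff[OF summable_Dg[OF n] sD]) auto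
  also have "\<dots> = (\<Sum>i<M. (1/8) ^ i *\<^sub>R Q n i - (1/8) ^ i *\<^sub>R q i)"
    by (rule suminf_finite) (auto simp: q_def)
  also have "\<dots> \<in> J"
  proof (rule two_sided_ideal_sum[OF J])
    fix i assume "i \<in> {..<M}"
    then have "(1/8) ^ i *\<^sub>R Q n i - (1/8) ^ i *\<^sub>R q i = (1/8) ^ i *\<^sub>R (P (n (Suc i)) - P (n i))" by (simp add: q_def Q_def)
    then show "(1/8) ^ i *\<^sub>R Q n i - (1/8) ^ i *\<^sub>R q i \<in> J"
      using PJ by (simp only:) (intro two_sided_ideal_scaleR two_sided_ideal_diff J)
  qed
  finally have "(Dg n (1/8) - D) + D \<in> J" using \<open>D \<in> J\<close> two_sided_idealD(2)[OF J] by blast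
  then show ?thesis by simp
qed

theorem no_maximal_ideal:
  assumes simp: "simple_cstar_algebra TYPE('d)"
    and comp: "\<And>q b :: 'd minf. projection q \<Longrightarrow> positive b \<Longrightarrow> dim_gap r q b \<Longrightarrow> cuntz_le q b"
    and r: "0 \<le> r"
  shows "\<not> maximal_ideal (J :: 'a set)"
proof
  assume "maximal_ideal J"
  then have J: "two_sided_ideal J" and J0: "{0} \<subset> J" and J1: "J \<subset> UNIV"
    and max: "\<And>I. proper_ideal I \<Longrightarrow> J \<subseteq> I \<Longrightarrow> I = J"
    by (auto simp: maximal_ideal_def proper_ideal_def)
  obtain x0 where "x0 \<in> J" "x0 \<noteq> 0" using J0 by blast
  then have PJ: "P k \<in> J" for k using nonzero_ideal_contains_P[OF simp J] by blast
  define c :: real where "c = 1/256"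
  have c: "0 \<le> c" "c < 1" by (auto simp: c_def)
  obtain a where "a \<notin> J" using J1 by blast
  have c3: "0 < c * c * c" "c * c * c < 1" by (simp_all add: c_def)
  \<comment> \<open>Factoring with the cube of \<open>c\<close> makes the diagonal element outside
    \<open>J\<close> the third power of \<open>l\<close>, since eigenvalues multiply.\<close>
  obtain n y0 where n: "mono n" "n 0 = 0" "a = Dg n (c * c * c) * y0" by (rule factor_Dg[OF c3])
  have c2: "0 \<le> c * c" "c * c < 1" by (simp_all add: c_def)
  have notJ: "Dg n (c * c * c) \<notin> J" using \<open>a \<notin> J\<close> n(3) two_sided_idealD(5)[OF J] by blast
  define l where "l = Dg n c"
  have lll: "l * l * l = Dg n (c * c * c)" by (simp add: l_def Dg_mult[OF n(1)] c c2)
  define I where "I = {x + y | x y. x \<in> J \<and> y \<in> ideal_gen l}"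
  have I: "two_sided_ideal I" unfolding I_def by (rule two_sided_ideal_plus[OF J two_sided_ideal_ideal_gen])
  have JI: "J \<subseteq> I" unfolding I_def using two_sided_idealD(1)[OF two_sided_ideal_ideal_gen] by force
  have "l * l * l \<in> I" unfolding I_def using ideal_gen_memI[of l l l] two_sided_idealD(1)[OF J] by force
  then have "I \<noteq> J" using notJ lll by auto
  then have "\<not> proper_ideal I" using max JI by blast
  then have IU: "I = UNIV" using I J0 JI unfolding proper_ideal_def by blast
  define rr where "rr = nat \<lceil>r\<rceil>"
  have rr: "r \<le> real rr" by (simp add: rr_def real_nat_ceiling_ge)
  \<comment> \<open>At stage j there will be 2m + 1 elements of rank at most
    \<open>n j + N j\<close>, but \<open>m\<close> comes from the decomposition of \<open>b\<close>
    and thus depends on \<open>N\<close>. The coefficient 2j + 1 covers every \<open>m\<close> as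
    soon as j reaches it; \<open>+ 1\<close> gives the strict inequality and the last
    \<open>N j\<close> monotonicity.\<close>
  define N where "N = rec_nat 0 (\<lambda>j Nj. n (Suc j) + rr + 1 + (2 * j + 1) * (n j + Nj) + Nj)"
  have NS: "N (Suc j) = n (Suc j) + rr + 1 + (2 * j + 1) * (n j + N j) + N j" for j by (simp add: N_def)
  have N: "mono N" by (rule mono_iff_le_Suc[THEN iffD2]) (simp add: NS)
  define b where "b = Dg N (1/2)"
  have half: "(0::real) \<le> 1/2" "(1/2::real) < 1" by auto
  have bI: "b \<in> I" using IU by simp
  then obtain jj s where js: "b = jj + s" "jj \<in> J" "s \<in> ideal_gen l" unfolding I_def by blast
  obtain x y and m :: nat where s: "s = (\<Sum>i<m. x i * l * y i)" using ideal_gen_expand[OF js(3)] by blast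
  define C where "C = (\<Sum>i<m. norm (x i)) + (\<Sum>i<m. norm (y i))"
  have Cx: "norm (x i) \<le> C" "norm (y i) \<le> C" if "i < m" for i
  proof -
    have "norm (x i) \<le> (\<Sum>i<m. norm (x i))" "norm (y i) \<le> (\<Sum>i<m. norm (y i))"
      using that by (auto intro!: member_le_sum)
    moreover have "0 \<le> (\<Sum>i<m. norm (x i))" "0 \<le> (\<Sum>i<m. norm (y i))" by (auto intro: sum_nonneg)
    ultimately show "norm (x i) \<le> C" "norm (y i) \<le> C" by (auto simp: C_def)
  qed
  have C0: "0 \<le> C" by (simp add: C_def sum_nonneg)
  have al: "adj l = l" unfolding l_def by (rule adj_Dg[OF n(1) c])
  have ab: "adj b = b" unfolding b_def by (rule adj_Dg[OF N half])
  have as: "adj s = (\<Sum>i<m. adj (y i) * l * adj (x i))"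
    by (simp add: s adj_sum adj_mult al mult.assoc)
  \<comment> \<open>One family controls \<open>s\<close>, the second its adjoint, which is needed
    for the entries below the diagonal, and the last element makes \<open>t j\<close> almost
    orthogonal to the earlier corner. All of them have range in
    \<open>P (n j + N j)\<close>.\<close>
  define z where "z j i = (if i < m then P (n j) * l * y i else if i < 2 * m then P (n j) * l * adj (x (i - m)) else P (N j))" for j i
  have "\<exists>t. P (N (Suc j)) * t = t \<and> t * P (n (Suc j)) = t \<and> adj t * t = P (n (Suc j)) \<and>
      (\<forall>i<2 * m + 1. norm (z j i * t) \<le> c ^ j)" if j: "m \<le> j" for j
  proof -
    have z: "P (n j + N j) * z j i = z j i" for i
      by (auto simp: z_def mult.assoc[symmetric] P_mult_le)
    have "(2 * m + 1) * (n j + N j) \<le> (2 * j + 1) * (n j + N j)" using j by (intro mult_le_mono1) simp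
    moreover define X Y where "X = (2 * m + 1) * (n j + N j)" and "Y = (2 * j + 1) * (n j + N j)"
    ultimately have "n (Suc j) + rr + (2 * m + 1) * (n j + N j) < N (Suc j)"
      unfolding NS X_def[symmetric] Y_def[symmetric] by linarith
    then have "real (n (Suc j) + rr + (2 * m + 1) * (n j + N j)) < real (N (Suc j))" by (simp only: of_nat_less_iff)
    then have size: "real (n (Suc j)) + r + real ((2 * m + 1) * (n j + N j)) < real (N (Suc j))" using rr by simp
    have e: "0 < c ^ j" by (simp add: c_def)
    obtain t where "P (N (Suc j)) * t = t" "t * P (n (Suc j)) = t" "adj t * t = P (n (Suc j))"
      "\<And>i. i < 2 * m + 1 \<Longrightarrow> norm (z j i * t) \<le> c ^ j"
      by (rule almost_annihilated_isometries[where z = "z j", OF _ z size e]) (erule (2) comp, blast)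
    then show ?thesis by blast
  qed
  then obtain t where t: "\<And>j. m \<le> j \<Longrightarrow> P (N (Suc j)) * t j = t j" "\<And>j. m \<le> j \<Longrightarrow> t j * P (n (Suc j)) = t j"
    "\<And>j. m \<le> j \<Longrightarrow> adj (t j) * t j = P (n (Suc j))"
    and tz: "\<And>j i. m \<le> j \<Longrightarrow> i < 2 * m + 1 \<Longrightarrow> norm (z j i * t j) \<le> c ^ j"
    by metis
  have nt: "norm (t j) \<le> 1" if "m \<le> j" for j
  proof -
    have "(norm (t j))\<^sup>2 \<le> 1" using t(3)[OF that] norm_P[of "n (Suc j)"] by (simp add: cstar_identity[symmetric])
    then show ?thesis by (simp add: power2_le_imp_le)
  qed
  define A where "A = real m * (C * (1 + 2 * C))"
  have tail: "norm (l - P (n j) * l) \<le> 2 * c ^ j" for j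
  proof -
    have "c ^ j / (1 - c) \<le> 2 * c ^ j" by (simp add: c_def)
    then show ?thesis using norm_Dg_tail[OF n(1) c, of j] unfolding l_def by linarith
  qed
  have A: "real m * (C * (c ^ j + 2 * c ^ j * C)) = A * c ^ j" for j by (simp add: A_def algebra_simps)
  have st: "norm (s * t j) \<le> A * c ^ j" if j: "m \<le> j" for j
    unfolding s A[symmetric]
  proof (rule sum_mult_bound[OF tail nt[OF j]])
    show "norm (P (n j) * l * y i * t j) \<le> c ^ j" if "i < m" for i
      using tz[OF j, of i] that by (simp add: z_def)
  qed (use Cx c in auto)
  have ast: "norm (adj s * t j) \<le> A * c ^ j" if j: "m \<le> j" for j
    unfolding as A[symmetric]
  proof (rule sum_mult_bound[OF tail nt[OF j]])
    show "norm (P (n j) * l * adj (x i) * t j) \<le> c ^ j" if "i < m" for i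
      using tz[OF j, of "i + m"] that by (simp add: z_def)
  qed (use Cx c in auto)
  have Nt: "norm (P (N j) * t j) \<le> c ^ j" if j: "m \<le> j" for j
    using tz[OF j, of "2 * m"] by (simp add: z_def split: if_splits)
  define B where "B = norm b + 1"
  have bt: "norm (b * t j - (1/2) ^ j *\<^sub>R t j) \<le> B * c ^ j" if j: "m \<le> j" for j
  proof -
    have "norm (b * t j - (1/2) ^ j *\<^sub>R t j) \<le> B * norm (P (N j) * t j)"
      unfolding b_def B_def by (rule norm_Dg_minus_scalar[OF N half t(1)[OF j]])
    also have "\<dots> \<le> B * c ^ j" using Nt[OF j] by (intro mult_left_mono) (auto simp: B_def)
    finally show ?thesis .
  qed
  have jt: "norm (jj * t j - (1/2) ^ j *\<^sub>R t j) \<le> (A + B) * c ^ j" "norm (adj jj * t j - (1/2) ^ j *\<^sub>R t j) \<le> (A + B) * c ^ j"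
    if j: "m \<le> j" for j
  proof -
    have jjs: "jj = b - s" using js(1) by simp
    have e1: "jj * t j - (1/2) ^ j *\<^sub>R t j = (b * t j - (1/2) ^ j *\<^sub>R t j) - s * t j"
      and e2: "adj jj * t j - (1/2) ^ j *\<^sub>R t j = (b * t j - (1/2) ^ j *\<^sub>R t j) - adj s * t j"
      by (simp_all add: jjs adj_diff ab algebra_simps)
    show "norm (jj * t j - (1/2) ^ j *\<^sub>R t j) \<le> (A + B) * c ^ j"
      using norm_triangle_ineq4[of "b * t j - (1/2) ^ j *\<^sub>R t j" "s * t j"] bt[OF j] st[OF j]
      unfolding e1 distrib_right by linarith
    show "norm (adj jj * t j - (1/2) ^ j *\<^sub>R t j) \<le> (A + B) * c ^ j"
      using norm_triangle_ineq4[of "b * t j - (1/2) ^ j *\<^sub>R t j" "adj s * t j"] bt[OF j] ast[OF j]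
      unfolding e2 distrib_right by linarith
  qed
  \<comment> \<open>The range of \<open>t i\<close> lies in \<open>P (N (Suc i))\<close>, which is
    below \<open>P (N k)\<close>, and \<open>P (N k)\<close> almost annihilates
    \<open>t k\<close>.\<close>
  have orth: "norm (adj (t i) * t k) \<le> c ^ k" if "m \<le> i" "i < k" for i k
  proof -
    have "P (N (Suc i)) * P (N k) = P (N (Suc i))" using that monoD[OF N, of "Suc i" k] by (simp add: P_mult_le)
    moreover have "adj (t i) * P (N (Suc i)) = adj (t i)" using t(1)[OF that(1)] by (metis adj_mult adj_P)
    ultimately have "adj (t i) * t k = adj (t i) * (P (N k) * t k)" by (metis mult.assoc)
    then have "norm (adj (t i) * t k) \<le> norm (adj (t i)) * norm (P (N k) * t k)" by (metis norm_mult_ineq)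
    also have "\<dots> \<le> 1 * c ^ k" using that nt[of i] Nt[of k] by (intro mult_mono) auto
    finally show ?thesis by simp
  qed
  have main: "norm (adj (t i) * j * t k) \<le> (A + B + 1) * c ^ k"
    if "m \<le> i" "i < k" "norm (j * t k - (1/2) ^ k *\<^sub>R t k) \<le> (A + B) * c ^ k" for i k j
  proof -
    have "adj (t i) * j * t k = adj (t i) * (j * t k - (1/2) ^ k *\<^sub>R t k) + (1/2) ^ k *\<^sub>R (adj (t i) * t k)"
      by (simp add: right_diff_distrib mult.assoc)
    then have "norm (adj (t i) * j * t k) \<le> norm (adj (t i) * (j * t k - (1/2) ^ k *\<^sub>R t k)) + norm ((1/2) ^ k *\<^sub>R (adj (t i) * t k))"
      by (metis norm_triangle_ineq)
    also have "norm (adj (t i) * (j * t k - (1/2) ^ k *\<^sub>R t k)) \<le> 1 * ((A + B) * c ^ k)"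
      using nt[OF that(1)] that(3) by (intro order_trans[OF norm_mult_ineq] mult_mono) auto
    also have "norm ((1/2) ^ k *\<^sub>R (adj (t i) * t k)) \<le> 1 * c ^ k"
      unfolding norm_scaleR using orth[OF that(1,2)] by (intro mult_mono) (auto simp: power_le_one)
    finally show ?thesis by (simp add: algebra_simps)
  qed
  have "Dg n (1/8) \<in> J"
  proof (rule Dg_mem_of_diagonal_dominance[OF J PJ n(1) js(2) t(3) t(2)])
    fix i k assume ik: "m \<le> i" "m \<le> k"
    consider "i = k" | "i < k" | "k < i" by linarith
    then show "norm (adj (t i) * jj * t k - (if i = k then (1/2) ^ i *\<^sub>R P (n (Suc i)) else 0))
        \<le> (A + B + 1) * (1/256) ^ max i k"
    proof cases
      case 1
      have "adj (t i) * jj * t i - (1/2) ^ i *\<^sub>R P (n (Suc i)) = adj (t i) * (jj * t i - (1/2) ^ i *\<^sub>R t i)"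
        using t(3)[OF ik(1)] by (simp add: right_diff_distrib mult.assoc)
      then have "norm (adj (t i) * jj * t i - (1/2) ^ i *\<^sub>R P (n (Suc i))) \<le> norm (adj (t i)) * norm (jj * t i - (1/2) ^ i *\<^sub>R t i)"
        by (metis norm_mult_ineq)
      also have "\<dots> \<le> 1 * ((A + B) * c ^ i)"
        using nt[OF ik(1)] jt(1)[OF ik(1)] by (intro mult_mono) auto
      also have "\<dots> \<le> (A + B + 1) * c ^ i" using c by (simp add: distrib_right)
      finally show ?thesis using 1 by (simp add: c_def)
    next
      case 2
      then show ?thesis using main[OF ik(1) 2 jt(1)[OF ik(2)]] by (simp add: c_def max_def)
    next
      case 3
      \<comment> \<open>An entry of \<open>jj\<close> below the diagonal is the adjoint of an entry
        of \<open>adj jj\<close> above it; this puts the decay into the larger index in both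
        cases.\<close>
      have "adj (adj (t k) * adj jj * t i) = adj (t i) * jj * t k" by (simp add: adj_mult adj_adj mult.assoc)
      then have "norm (adj (t i) * jj * t k) = norm (adj (t k) * adj jj * t i)" by (metis norm_adj)
      then show ?thesis using 3 main[OF ik(2) 3 jt(2)[OF ik(1)]] by (simp add: c_def max_def)
    qed
  qed
  then have "Dg n (1/8) * Dg n (8 * (c * c * c)) \<in> J" by (rule two_sided_idealD(5)[OF J])
  moreover have "Dg n (1/8) * Dg n (8 * (c * c * c)) = Dg n (c * c * c)"
    by (subst Dg_mult[OF n(1)]) (auto simp: c_def)
  ultimately show False using notJ by simp
qed

end

section \<open>Orthonormal bases and compact operators\<close>

lemma cinner_add_left: "cinner (x + y) z = cinner x z + cinner (y::'h::complex_hilbert_space) z"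
  by (metis cinner_add_right cinner_commute complex_cnj_add)

lemma cinner_scaleC_left: "cinner (c *\<^sub>C x) y = cnj c * cinner (x::'h::complex_hilbert_space) y"
  by (metis cinner_scaleC_right cinner_commute complex_cnj_mult)

lemma cinner_scaleR_right: "cinner x (r *\<^sub>R y) = r *\<^sub>R cinner (x::'h::complex_hilbert_space) y"
  by (simp add: scaleC_of_real[symmetric] cinner_scaleC_right scaleR_conv_of_real)

lemma cinner_scaleR_left: "cinner (r *\<^sub>R x) y = r *\<^sub>R cinner (x::'h::complex_hilbert_space) y"
  by (simp add: scaleC_of_real[symmetric] cinner_scaleC_left scaleR_conv_of_real)

lemma cinner_0_right [simp]: "cinner x 0 = 0"
  using cinner_scaleR_right[of x 0 0] by simp

lemma cinner_0_left [simp]: "cinner 0 x = 0"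
  using cinner_scaleR_left[of 0 0 x] by simp

lemma cinner_diff_right: "cinner x (y - z) = cinner x y - cinner (x::'h::complex_hilbert_space) z"
  using cinner_add_right[of x "y - z" z] by simp

lemma cinner_diff_left: "cinner (y - z) x = cinner y x - cinner z (x::'h::complex_hilbert_space)"
  using cinner_add_left[of "y - z" z x] by simp

lemma cinner_sum_right: "cinner x (sum f A) = (\<Sum>i\<in>A. cinner (x::'h::complex_hilbert_space) (f i))"
  by (induction A rule: infinite_finite_induct) (auto simp: cinner_add_right)

lemma cinner_sum_left: "cinner (sum f A) x = (\<Sum>i\<in>A. cinner (f i) (x::'h::complex_hilbert_space))"
  by (induction A rule: infinite_finite_induct) (auto simp: cinner_add_left)

lemma norm_hilbert_scaleC: "norm (c *\<^sub>C (x::'h::complex_hilbert_space)) = cmod c * norm x"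
proof -
  have "complex_of_real ((norm (c *\<^sub>C x))\<^sup>2) = complex_of_real ((cmod c * norm x)\<^sup>2)"
  proof -
    have "cinner (c *\<^sub>C x) (c *\<^sub>C x) = (c * cnj c) * cinner x x"
      by (simp add: cinner_scaleC_left cinner_scaleC_right)
    then show ?thesis
      by (simp only: complex_norm_square[symmetric] cinner_norm of_real_mult[symmetric] power_mult_distrib)
  qed
  then have "(norm (c *\<^sub>C x))\<^sup>2 = (cmod c * norm x)\<^sup>2" by (simp only: of_real_eq_iff)
  then show ?thesis by (simp add: power2_eq_iff_nonneg)
qed

lemma norm_sq_cinner: "(norm (x::'h::complex_hilbert_space))\<^sup>2 = Re (cinner x x)"
  by (simp add: cinner_norm)

lemma norm_diff_orth:
  fixes x y :: "'h::complex_hilbert_space"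
  assumes "cinner y x = cinner y y"
  shows "(norm (x - y))\<^sup>2 = (norm x)\<^sup>2 - (norm y)\<^sup>2"
proof -
  have "cinner x y = cinner y y" using assms cinner_commute[of x y] cinner_commute[of y y] by simp
  then show ?thesis using assms by (simp add: norm_sq_cinner cinner_diff_left cinner_diff_right)
qed

lemma cauchy_schwarz: "cmod (cinner x y) \<le> norm x * norm (y::'h::complex_hilbert_space)"
proof (cases "x = 0")
  case False
  define c where "c = cinner x y / (norm x)\<^sup>2"
  have "cinner x y = c * cinner x x" using False by (simp add: cinner_norm c_def)
  then have "cinner (c *\<^sub>C x) y = cinner (c *\<^sub>C x) (c *\<^sub>C x)"
    by (simp add: cinner_scaleC_left cinner_scaleC_right)
  then have "(norm (y - c *\<^sub>C x))\<^sup>2 = (norm y)\<^sup>2 - (cmod c * norm x)\<^sup>2"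
    by (simp add: norm_diff_orth norm_hilbert_scaleC)
  then have "(cmod c * norm x)\<^sup>2 \<le> (norm y)\<^sup>2" by (metis diff_ge_0_iff_ge zero_le_power2)
  then have "cmod c * norm x \<le> norm y" by (rule power2_le_imp_le) simp
  moreover have "cmod (cinner x y) = cmod c * norm x * norm x"
    using False by (simp add: c_def norm_divide norm_mult power2_eq_square)
  ultimately show ?thesis by (simp add: mult_left_mono mult.commute[of _ "norm x"])
qed simp

lemma bounded_linear_cinner: "bounded_linear (cinner (x::'h::complex_hilbert_space))"
  by (rule bounded_linear_intro[of _ "norm x"])
    (auto simp: cinner_add_right cinner_scaleR_right mult.commute[of _ "norm x"] cauchy_schwarz)

lemma bounded_linear_cinner_left: "bounded_linear (\<lambda>x. cinner x (y::'h::complex_hilbert_space))"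
  by (rule bounded_linear_intro[of _ "norm y"])
    (auto simp: cinner_add_left cinner_scaleR_left cauchy_schwarz)

lemma bounded_linear_scaleC_hilbert: "bounded_linear (\<lambda>c. c *\<^sub>C (x::'h::complex_hilbert_space))"
  by (rule bounded_linear_intro[of _ "norm x"])
    (auto simp: scaleC_add_left norm_hilbert_scaleC scaleC_of_real[symmetric] scaleC_scaleC scaleR_conv_of_real)

lemma bounded_linear_scaleC_right_hilbert: "bounded_linear (\<lambda>x. c *\<^sub>C (x::'h::complex_hilbert_space))"
  by (rule bounded_linear_intro[of _ "cmod c"])
    (auto simp: scaleC_add_right norm_hilbert_scaleC scaleC_scaleR mult.commute)

section \<open>Gram-Schmidt orthonormalisation\<close>

definition pr :: "(nat \<Rightarrow> 'h::complex_hilbert_space) \<Rightarrow> nat \<Rightarrow> 'h \<Rightarrow> 'h" where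
  "pr b n x = (\<Sum>i<n. cinner (b i) x *\<^sub>C b i)"

definition orthonormal_upto :: "nat \<Rightarrow> (nat \<Rightarrow> 'h::complex_hilbert_space) \<Rightarrow> bool" where
  "orthonormal_upto n b \<longleftrightarrow> (\<forall>i<n. \<forall>j<n. cinner (b i) (b j) = (if i = j then 1 else 0))"

lemma orthonormal_uptoD:
  "orthonormal_upto n b \<Longrightarrow> i < n \<Longrightarrow> j < n \<Longrightarrow> cinner (b i) (b j) = (if i = j then 1 else 0)"
  by (simp add: orthonormal_upto_def)

lemma cinner_pr:
  assumes "orthonormal_upto n b" "i < n"
  shows "cinner (b i) (pr b n x) = cinner (b i) x"
proof -
  have "cinner (b i) (pr b n x) = (\<Sum>j<n. if j = i then cinner (b i) x else 0)"
    unfolding pr_def cinner_sum_right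
    by (rule sum.cong) (use assms in \<open>auto simp: cinner_scaleC_right orthonormal_upto_def\<close>)
  then show ?thesis using assms by simp
qed

lemma norm_pr_residual:
  assumes "orthonormal_upto n b"
  shows "norm (x - pr b n x) \<le> norm x"
proof -
  have "cinner (pr b n x) x = (\<Sum>i<n. cnj (cinner (b i) x) * cinner (b i) x)"
    by (simp add: pr_def cinner_sum_left cinner_scaleC_left)
  also have "\<dots> = (\<Sum>i<n. cnj (cinner (b i) x) * cinner (b i) (pr b n x))"
    by (rule sum.cong) (use cinner_pr[OF assms] in auto)
  also have "\<dots> = cinner (pr b n x) (pr b n x)"
    unfolding pr_def[of b n x] cinner_sum_left[of _ "{..<n}"] cinner_scaleC_left ..
  finally have "(norm (x - pr b n x))\<^sup>2 = (norm x)\<^sup>2 - (norm (pr b n x))\<^sup>2" by (rule norm_diff_orth)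
  then have "(norm (x - pr b n x))\<^sup>2 \<le> (norm x)\<^sup>2" by simp
  then show ?thesis by (rule power2_le_imp_le) simp
qed

lemma bounded_linear_pr: "bounded_linear (pr b n)"
  unfolding pr_def[abs_def]
  by (intro bounded_linear_sum bounded_linear_compose[OF bounded_linear_scaleC_hilbert] bounded_linear_cinner)

lemma pr_diff: "pr b n (x - y) = pr b n x - pr b n y"
  by (rule linear_diff[OF bounded_linear.linear[OF bounded_linear_pr]])

lemma pr_scaleC: "pr b n (c *\<^sub>C x) = c *\<^sub>C pr b n x"
  by (simp add: pr_def cinner_scaleC_right scaleC_sum scaleC_scaleC)

lemma pr_cong: "(\<And>i. i < n \<Longrightarrow> b i = b' i) \<Longrightarrow> pr b n x = pr b' n x"
  by (simp add: pr_def)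

lemma gram_schmidt_step:
  fixes b :: "nat \<Rightarrow> 'h::complex_hilbert_space"
  assumes b: "orthonormal_upto n b" and x: "pr b n x \<noteq> x"
  obtains v where "orthonormal_upto (Suc n) (b(n := v))" "pr (b(n := v)) (Suc n) x = x"
proof -
  define w where "w = x - pr b n x"
  have w: "w \<noteq> 0" using x by (simp add: w_def)
  define v where "v = (1 / norm w) *\<^sub>R w"
  have orth: "cinner (b i) w = 0" if "i < n" for i
    using cinner_pr[OF b that] by (simp add: w_def cinner_diff_right)
  have orth': "cinner w (b i) = 0" if "i < n" for i
    using orth[OF that] cinner_commute[of w "b i"] by simp
  have vv: "cinner v v = 1"
    using w by (simp add: v_def cinner_scaleR_left cinner_scaleR_right cinner_norm power2_eq_square scaleR_conv_of_real)
  have wp: "cinner w (pr b n x) = 0" by (simp add: pr_def cinner_sum_right cinner_scaleC_right orth')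
  then have "cinner w x = cinner w w" by (simp add: w_def cinner_diff_right)
  then have "cinner w x = complex_of_real ((norm w)\<^sup>2)" by (simp add: cinner_norm)
  then have "cinner v x = complex_of_real (norm w)"
    using w by (simp add: v_def cinner_scaleR_left scaleR_conv_of_real power2_eq_square)
  then have "cinner v x *\<^sub>C v = w" using w by (simp add: scaleC_of_real v_def)
  moreover have "pr (b(n := v)) n x = pr b n x" by (rule pr_cong) simp
  ultimately have "pr (b(n := v)) (Suc n) x = x" by (simp add: pr_def w_def)
  moreover have "orthonormal_upto (Suc n) (b(n := v))"
    using b vv orth orth' unfolding orthonormal_upto_def
    by (auto simp: less_Suc_eq v_def cinner_scaleR_left cinner_scaleR_right)
  ultimately show ?thesis using that by blast
qed

text \<open>If \<open>x\<close> is not yet in the span, its normalised residual is added; otherwise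
  infinite dimension provides some other vector. Each step thus adds exactly one vector, so the
  family never stops growing.\<close>

lemma orthonormal_extend:
  fixes b :: "nat \<Rightarrow> 'h::complex_hilbert_space"
  assumes b: "orthonormal_upto n b" and inf: "\<not> (\<exists>B::'h set. finite B \<and> span B = UNIV)"
  obtains v where "orthonormal_upto (Suc n) (b(n := v))" "pr (b(n := v)) (Suc n) x = x"
proof (cases "pr b n x = x")
  case False
  then show ?thesis using gram_schmidt_step[OF b] that by blast
next
  case True
  have "\<exists>y. pr b n y \<noteq> y"
  proof (rule ccontr)
    assume "\<not> ?thesis"
    then have all: "pr b n y = y" for y by blast
    \<comment> \<open>\<open>span\<close> is the real span, so the multiples by the imaginary unit
      are adjoined.\<close>
    define B where "B = b ` {..<n} \<union> (\<lambda>i. \<i> *\<^sub>C b i) ` {..<n}"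
    have "y \<in> span B" for y
    proof -
      have "c *\<^sub>C b i \<in> span B" if "i < n" for c i
      proof -
        have "c *\<^sub>C b i = Re c *\<^sub>R b i + Im c *\<^sub>R (\<i> *\<^sub>C b i)"
          by (subst complex_eq[of c]) (simp add: scaleC_add_left scaleC_of_real[symmetric] scaleC_scaleC mult.commute)
        also have "\<dots> \<in> span B"
          using that by (intro span_add span_scale span_base) (auto simp: B_def)
        finally show ?thesis .
      qed
      then have "pr b n y \<in> span B" unfolding pr_def by (intro span_sum) auto
      then show ?thesis by (simp add: all)
    qed
    then have "span B = UNIV" by blast
    moreover have "finite B" by (simp add: B_def)
    ultimately show False using inf by blast
  qed
  then obtain y where "pr b n y \<noteq> y" by blast
  then obtain v where v: "orthonormal_upto (Suc n) (b(n := v))" using gram_schmidt_step[OF b] by blast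
  have "cinner (b i) v = 0" if "i < n" for i
    using orthonormal_uptoD[OF v, of i n] that by simp
  then have "cinner v (b i) = 0" if "i < n" for i using that cinner_commute[of v "b i"] by simp
  then have "cinner v (pr b n x) = 0" by (simp add: pr_def cinner_sum_right cinner_scaleC_right)
  then have "cinner v x = 0" by (simp add: True)
  moreover have "pr (b(n := v)) n x = pr b n x" by (rule pr_cong) simp
  ultimately have "pr (b(n := v)) (Suc n) x = x" using True by (simp add: pr_def)
  then show ?thesis using that v by blast
qed

text \<open>Stage \<open>Suc n\<close> takes the n-th point of a dense sequence into the span and
  keeps the vectors already chosen. As the residual map is a contraction, convergence on the dense
  sequence gives convergence everywhere.\<close>

lemma ex_orthonormal_basis:
  assumes "separable_infinite_dim TYPE('h::complex_hilbert_space)"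
  obtains b :: "nat \<Rightarrow> 'h::complex_hilbert_space" where "\<And>n. orthonormal_upto n b" "\<And>x. (\<lambda>n. pr b n x) \<longlonglongrightarrow> x"
proof -
  obtain S :: "'h set" where S: "countable S" "closure S = UNIV"
    and inf: "\<not> (\<exists>B::'h set. finite B \<and> span B = UNIV)"
    using assms by (auto simp: separable_infinite_dim_def)
  have "S \<noteq> {}" using S(2) by auto
  define s where "s = from_nat_into S"
  have ranges: "range s = S" unfolding s_def using S(1) \<open>S \<noteq> {}\<close> by (rule range_from_nat_into[rotated])
  define I where "I n b \<longleftrightarrow> orthonormal_upto n b \<and> (\<forall>k<n. pr b n (s k) = s k)" for n and b :: "nat \<Rightarrow> 'h"
  have "\<exists>B. \<forall>n. I n (B n) \<and> (\<forall>i<n. B (Suc n) i = B n i)"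
  proof (rule dependent_nat_choice)
    show "\<exists>b. I 0 b" by (simp add: I_def orthonormal_upto_def)
    fix b n assume b: "I n b"
    then have o: "orthonormal_upto n b" by (simp add: I_def)
    obtain v where v: "orthonormal_upto (Suc n) (b(n := v))" "pr (b(n := v)) (Suc n) (s n) = s n"
      by (rule orthonormal_extend[OF o inf])
    have "pr (b(n := v)) (Suc n) (s k) = s k" if "k < n" for k
    proof -
      have "cinner v (b i) = 0" if "i < n" for i
        using orthonormal_uptoD[OF v(1), of n i] that by simp
      then have "cinner v (pr b n (s k)) = 0" by (simp add: pr_def cinner_sum_right cinner_scaleC_right)
      moreover have "pr b n (s k) = s k" using b that by (simp add: I_def)
      moreover have "pr (b(n := v)) n (s k) = pr b n (s k)" by (rule pr_cong) simp
      ultimately show ?thesis by (simp add: pr_def)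
    qed
    then have "I (Suc n) (b(n := v))" using v by (auto simp: I_def less_Suc_eq)
    then show "\<exists>b'. I (Suc n) b' \<and> (\<forall>i<n. b' i = b i)" by (intro exI[of _ "b(n := v)"]) auto
  qed
  then obtain B where B: "\<And>n. I n (B n)" "\<And>n i. i < n \<Longrightarrow> B (Suc n) i = B n i" by blast
  \<comment> \<open>Entry i is final from stage \<open>Suc i\<close> on, so the diagonal of the
    stages is the basis.\<close>
  define b where "b i = B (Suc i) i" for i
  have bB: "B n i = b i" if "i < n" for n i
    using that
  proof (induction n)
    case (Suc n)
    then show ?case by (cases "i = n") (auto simp: b_def B(2))
  qed simp
  have o: "orthonormal_upto n b" for n using B(1)[of n] bB[of _ n] by (simp add: I_def orthonormal_upto_def)
  have ps: "pr b n (s k) = s k" if "k < n" for n k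
    using B(1)[of n] that pr_cong[of n "B n" b "s k"] bB by (simp add: I_def)
  have "(\<lambda>n. pr b n x) \<longlonglongrightarrow> x" for x
  proof (rule LIMSEQ_I)
    fix e :: real assume e: "0 < e"
    have "x \<in> closure S" by (simp add: S)
    then obtain y where "y \<in> S" "dist y x < e" using e closure_approachable by blast
    then obtain k where k: "norm (x - s k) < e"
      using ranges by (metis dist_norm norm_minus_commute rangeE)
    have "norm (pr b n x - x) < e" if "Suc k \<le> n" for n
    proof -
      have "pr b n x - x = - ((x - s k) - pr b n (x - s k))" using that by (simp add: pr_diff ps)
      then have "norm (pr b n x - x) \<le> norm (x - s k)" using norm_pr_residual[OF o] by (metis norm_minus_cancel)
      then show ?thesis using k by simp
    qed
    then show "\<exists>no. \<forall>n\<ge>no. norm (pr b n x - x) < e" by blast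
  qed
  then show ?thesis using that o by blast
qed

section \<open>Compact operators\<close>

lemma image_in_closure: "x \<in> A \<Longrightarrow> f x \<in> closure (f ` A)"
  by (rule subsetD[OF closure_subset], rule imageI)

lemma compact_closure_subset:
  fixes X K :: "'b::metric_space set"
  assumes "X \<subseteq> K" "compact K" shows "compact (closure X)"
proof -
  have "closure X \<subseteq> K" using assms by (simp add: closure_minimal compact_imp_closed)
  then have "closure X = K \<inter> closure X" by blast
  then show ?thesis using compact_Int_closed[OF assms(2) closed_closure] by metis
qed

lemma compact_operatorsI:
  assumes "\<And>x y. f (x + y) = f x + f y" "\<And>c x. f (c *\<^sub>C x) = c *\<^sub>C f x"
    and "f ` cball 0 1 \<subseteq> K" "compact K"
  shows "f \<in> compact_operators"
  using assms compact_closure_subset[OF assms(3,4)] by (simp add: compact_operators_def)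

lemma compact_operatorsD:
  assumes "f \<in> compact_operators"
  shows "f (x + y) = f x + f y" "f (c *\<^sub>C x) = c *\<^sub>C f x" "compact (closure (f ` cball 0 1))"
  using assms by (simp_all add: compact_operators_def)

lemma compact_operators_add:
  assumes "f \<in> compact_operators" "g \<in> compact_operators"
  shows "(\<lambda>x. f x + g x) \<in> compact_operators"
proof (rule compact_operatorsI)
  show "(\<lambda>x. f x + g x) ` cball 0 1 \<subseteq> (\<lambda>(u, v). u + v) ` (closure (f ` cball 0 1) \<times> closure (g ` cball 0 1))"
  proof clarify
    fix x assume "x \<in> cball (0::'a) 1"
    then have "(f x, g x) \<in> closure (f ` cball 0 1) \<times> closure (g ` cball 0 1)"
      by (intro SigmaI image_in_closure)
    then show "f x + g x \<in> (\<lambda>(u, v). u + v) ` (closure (f ` cball 0 1) \<times> closure (g ` cball 0 1))"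
      by (rule rev_image_eqI) simp
  qed
  show "compact ((\<lambda>(u, v). u + v) ` (closure (f ` cball 0 1) \<times> closure (g ` cball 0 1)))"
    unfolding case_prod_beta
    by (intro compact_continuous_image continuous_intros compact_Times compact_operatorsD(3) assms)
qed (simp_all add: compact_operatorsD[OF assms(1)] compact_operatorsD[OF assms(2)] scaleC_add_right)

lemma compact_operators_compose:
  assumes f: "f \<in> compact_operators" and g: "bounded_linear g" "\<And>c x. g (c *\<^sub>C x) = c *\<^sub>C g x"
  shows "(\<lambda>x. g (f x)) \<in> compact_operators"
proof (rule compact_operatorsI)
  show "(\<lambda>x. g (f x)) ` cball 0 1 \<subseteq> g ` closure (f ` cball 0 1)"
    by (auto intro: image_in_closure)
  show "compact (g ` closure (f ` cball 0 1))"
    by (intro compact_continuous_image linear_continuous_on g compact_operatorsD(3) f)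
qed (simp_all add: compact_operatorsD[OF f] g(2) linear_add[OF bounded_linear.linear[OF g(1)]])

lemma compact_operators_zero: "(\<lambda>x. 0) \<in> compact_operators"
  by (rule compact_operatorsI[of _ "{0}"]) auto

lemma compact_operators_sum:
  "(\<And>i. i \<in> A \<Longrightarrow> f i \<in> compact_operators) \<Longrightarrow> (\<lambda>x. \<Sum>i\<in>A. f i x) \<in> compact_operators"
  by (induction A rule: infinite_finite_induct) (auto intro: compact_operators_zero compact_operators_add)

lemma compact_operators_scaleR:
  "f \<in> compact_operators \<Longrightarrow> (\<lambda>x. r *\<^sub>R f x) \<in> compact_operators"
  by (rule compact_operators_compose) (auto intro: bounded_linear_scaleR_right simp: scaleC_scaleR)

lemma rank_one_compact: "(\<lambda>x. cinner v x *\<^sub>C u) \<in> (compact_operators :: ('h::complex_hilbert_space \<Rightarrow> 'h) set)"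
proof (rule compact_operatorsI)
  show "(\<lambda>x. cinner v x *\<^sub>C u) ` cball 0 1 \<subseteq> (\<lambda>c. c *\<^sub>C u) ` cball 0 (norm v)"
  proof clarify
    fix x :: 'h assume "x \<in> cball 0 1"
    then have "norm v * norm x \<le> norm v" by (simp add: mult_left_le)
    then have "cinner v x \<in> cball 0 (norm v)" using cauchy_schwarz[of v x] by simp
    then show "cinner v x *\<^sub>C u \<in> (\<lambda>c. c *\<^sub>C u) ` cball 0 (norm v)" by blast
  qed
  show "compact ((\<lambda>c. c *\<^sub>C u) ` cball 0 (norm v))"
    by (intro compact_continuous_image linear_continuous_on bounded_linear_scaleC_hilbert compact_cball)
qed (simp_all add: cinner_add_right cinner_scaleC_right scaleC_add_left scaleC_scaleC)

text \<open>A finite net for the image under an approximating \<open>g\<close> is a net for the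
  image under \<open>f\<close>. Closed balls of radius e/2 are used so that the cover survives
  taking the closure.\<close>

lemma compact_operators_limit:
  fixes f :: "'h::complex_hilbert_space \<Rightarrow> 'h"
  assumes lin: "\<And>x y. f (x + y) = f x + f y" "\<And>c x. f (c *\<^sub>C x) = c *\<^sub>C f x"
    and app: "\<And>e. 0 < e \<Longrightarrow> \<exists>g\<in>compact_operators. \<forall>x\<in>cball 0 1. norm (f x - g x) \<le> e"
  shows "f \<in> compact_operators"
proof -
  have "\<exists>k. finite k \<and> closure (f ` cball 0 1) \<subseteq> (\<Union>x\<in>k. ball x e)" if e: "0 < e" for e
  proof -
    obtain g where g: "g \<in> compact_operators" "\<And>x. x \<in> cball 0 1 \<Longrightarrow> norm (f x - g x) \<le> e / 4"
      using app[of "e / 4"] e by auto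
    obtain k where k: "finite k" "closure (g ` cball 0 1) \<subseteq> (\<Union>x\<in>k. ball x (e / 4))"
      using compact_operatorsD(3)[OF g(1)] e unfolding compact_eq_totally_bounded by (meson zero_less_divide_iff zero_less_numeral)
    have "f ` cball 0 1 \<subseteq> (\<Union>x\<in>k. cball x (e / 2))"
    proof clarify
      fix x :: 'h assume x: "x \<in> cball 0 1"
      then have "g x \<in> closure (g ` cball 0 1)" by (rule image_in_closure)
      then obtain y where y: "y \<in> k" "dist y (g x) < e / 4" using k(2) by auto
      have "dist y (f x) \<le> dist y (g x) + dist (g x) (f x)" by (rule dist_triangle)
      also have "dist (g x) (f x) \<le> e / 4" using g(2)[OF x] by (simp add: dist_norm norm_minus_commute)
      finally have "dist y (f x) \<le> e / 2" using y(2) by linarith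
      then show "f x \<in> (\<Union>x\<in>k. cball x (e / 2))" using y(1) by auto
    qed
    moreover have "closed (\<Union>x\<in>k. cball x (e / 2))" using k(1) by (intro closed_UN) auto
    ultimately have "closure (f ` cball 0 1) \<subseteq> (\<Union>x\<in>k. cball x (e / 2))" by (rule closure_minimal)
    also have "\<dots> \<subseteq> (\<Union>x\<in>k. ball x e)" using e by auto
    finally show ?thesis using k(1) by blast
  qed
  then have "compact (closure (f ` cball 0 1))"
    unfolding compact_eq_totally_bounded by (auto simp: complete_eq_closed)
  then show ?thesis using lin by (simp add: compact_operators_def)
qed

lemma compact_operator_bounded_linear:
  fixes f :: "'h::complex_hilbert_space \<Rightarrow> 'h"
  assumes f: "f \<in> compact_operators"
  shows "bounded_linear f"
proof -
  have "bounded (f ` cball 0 1)"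
    using compact_imp_bounded[OF compact_operatorsD(3)[OF f]] closure_subset bounded_subset by blast
  then obtain M where "\<forall>y\<in>f ` cball 0 1. norm y \<le> M" unfolding bounded_iff by blast
  then have M: "norm (f x) \<le> M" if "norm x \<le> 1" for x using that by simp
  have scale: "f (r *\<^sub>R x) = r *\<^sub>R f x" for r x
    using compact_operatorsD(2)[OF f, of "complex_of_real r" x] by (simp add: scaleC_of_real)
  have "norm (f x) \<le> norm x * M" for x
  proof (cases "x = 0")
    case True
    then show ?thesis using scale[of 0 0] by simp
  next
    case False
    have "f x = norm x *\<^sub>R f ((1 / norm x) *\<^sub>R x)" using False by (simp add: scale)
    moreover have "norm (f ((1 / norm x) *\<^sub>R x)) \<le> M" using False by (intro M) simp
    ultimately show ?thesis by (metis abs_norm_cancel mult_left_mono norm_ge_zero norm_scaleR)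
  qed
  then show ?thesis by (intro bounded_linear_intro[of f M]) (auto simp: compact_operatorsD(1)[OF f] scale)
qed

section \<open>Expansions in an orthonormal basis\<close>

locale orthonormal_basis =
  fixes b :: "nat \<Rightarrow> 'h::complex_hilbert_space"
  assumes orthonormal: "orthonormal_upto n b"
    and complete: "(\<lambda>n. pr b n x) \<longlonglongrightarrow> x"
begin

lemma cinner_basis: "cinner (b i) (b j) = (if i = j then 1 else 0)"
  using orthonormal[of "Suc (max i j)"] by (simp add: orthonormal_upto_def less_Suc_eq_le)

text \<open>The vector is the sum of the \<open>cnj (f (b i)) *\<^sub>C b i\<close>. Testing
  \<open>f\<close> on a partial sum \<open>v m\<close> gives the square of its norm, so boundedness
  of \<open>f\<close> bounds the squares of the coefficients and the partial sums are
  Cauchy.\<close>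

lemma riesz:
  fixes f :: "'h \<Rightarrow> complex"
  assumes f: "bounded_linear f" "\<And>c x. f (c *\<^sub>C x) = c * f x"
  obtains v where "\<And>x. f x = cinner v x"
proof -
  obtain M where M: "0 < M" "\<And>x. norm (f x) \<le> norm x * M" using bounded_linear.pos_bounded[OF f(1)] by blast
  define v where "v m = (\<Sum>i<m. cnj (f (b i)) *\<^sub>C b i)" for m
  have norm2: "(norm (\<Sum>i\<in>A. cnj (f (b i)) *\<^sub>C b i))\<^sup>2 = (\<Sum>i\<in>A. (cmod (f (b i)))\<^sup>2)" if "finite A" for A
  proof -
    have "cinner (\<Sum>i\<in>A. cnj (f (b i)) *\<^sub>C b i) (\<Sum>i\<in>A. cnj (f (b i)) *\<^sub>C b i)
        = (\<Sum>i\<in>A. \<Sum>j\<in>A. if j = i then f (b i) * cnj (f (b i)) else 0)"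
      unfolding cinner_sum_left cinner_sum_right cinner_scaleC_left cinner_scaleC_right
      by (intro sum.cong refl) (auto simp: cinner_basis sum_distrib_left intro!: sum.cong)
    also have "\<dots> = (\<Sum>i\<in>A. f (b i) * cnj (f (b i)))" using that by simp
    also have "\<dots> = complex_of_real (\<Sum>i\<in>A. (cmod (f (b i)))\<^sup>2)"
      by (simp only: of_real_sum complex_norm_square)
    finally show ?thesis by (simp add: norm_sq_cinner)
  qed
  have bd: "(\<Sum>i<m. (cmod (f (b i)))\<^sup>2) \<le> M\<^sup>2" for m
  proof -
    have "f (v m) = (\<Sum>i<m. cnj (f (b i)) * f (b i))"
      by (simp add: v_def linear_sum[OF bounded_linear.linear[OF f(1)]] f(2))
    also have "\<dots> = complex_of_real (\<Sum>i<m. (cmod (f (b i)))\<^sup>2)"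
      by (simp only: of_real_sum complex_norm_square mult.commute)
    finally have "cmod (f (v m)) = \<bar>\<Sum>i<m. (cmod (f (b i)))\<^sup>2\<bar>" by (simp only: norm_of_real)
    then have "cmod (f (v m)) = (norm (v m))\<^sup>2" by (simp add: norm2 v_def sum_nonneg)
    then have "norm (v m) * norm (v m) \<le> norm (v m) * M" using M(2)[of "v m"] by (simp add: power2_eq_square)
    then have "norm (v m) \<le> M" using M(1) by (cases "norm (v m) = 0") auto
    then have "(norm (v m))\<^sup>2 \<le> M\<^sup>2" by (simp add: power_mono)
    then show ?thesis by (simp add: v_def norm2)
  qed
  have sm: "summable (\<lambda>i. (cmod (f (b i)))\<^sup>2)"
    by (rule summableI_nonneg_bounded[OF _ bd]) simp
  have "Cauchy v"
  proof (rule CauchyI)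
    fix e :: real assume e: "0 < e"
    then obtain N where N: "\<And>m n. N \<le> m \<Longrightarrow> norm (\<Sum>i=m..<n. (cmod (f (b i)))\<^sup>2) < e\<^sup>2"
      using sm unfolding summable_Cauchy by (metis zero_less_power)
    have *: "norm (v n - v m) < e" if "N \<le> m" "m \<le> n" for m n
    proof -
      have "v n - v m = (\<Sum>i=m..<n. cnj (f (b i)) *\<^sub>C b i)"
        using sum_diff_nat_ivl[of 0 m n "\<lambda>i. cnj (f (b i)) *\<^sub>C b i"] that
        by (simp add: v_def atLeast0LessThan)
      then have "(norm (v n - v m))\<^sup>2 < e\<^sup>2" using N[OF that(1), of n] by (simp add: norm2)
      then show ?thesis using e by (simp add: power2_less_imp_less)
    qed
    have "norm (v m - v n) < e" if "N \<le> m" "N \<le> n" for m n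
      using that *[of m n] *[of n m] by (cases "m \<le> n") (auto simp: norm_minus_commute)
    then show "\<exists>M. \<forall>m\<ge>M. \<forall>n\<ge>M. norm (v m - v n) < e" by blast
  qed
  then obtain w where w: "v \<longlonglongrightarrow> w" using Cauchy_convergent convergent_def by blast
  have "f x = cinner w x" for x
  proof (rule LIMSEQ_unique)
    show "(\<lambda>m. f (pr b m x)) \<longlonglongrightarrow> f x" by (rule bounded_linear.tendsto[OF f(1) complete])
    have "f (pr b m x) = cinner (v m) x" for m
      by (simp add: pr_def v_def linear_sum[OF bounded_linear.linear[OF f(1)]] f(2) cinner_sum_left
          cinner_scaleC_left mult.commute)
    then show "(\<lambda>m. f (pr b m x)) \<longlonglongrightarrow> cinner w x"
      by (simp only:) (rule bounded_linear.tendsto[OF bounded_linear_cinner_left w])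
  qed
  then show ?thesis using that by blast
qed

lemma norm_residual: "norm (x - pr b n x) \<le> norm x"
  by (rule norm_pr_residual[OF orthonormal])

lemma pr_pr: "pr b m (pr b n x) = pr b (min m n) x"
proof -
  have "cinner (b i) (pr b n x) = (if i < n then cinner (b i) x else 0)" for i
  proof -
    have "cinner (b i) (pr b n x) = (\<Sum>j<n. if j = i then cinner (b i) x else 0)"
      unfolding pr_def cinner_sum_right by (rule sum.cong) (auto simp: cinner_scaleC_right cinner_basis)
    then show ?thesis by simp
  qed
  then have "pr b m (pr b n x) = (\<Sum>i<m. if i < n then cinner (b i) x *\<^sub>C b i else 0)"
    unfolding pr_def[of b m] by (intro sum.cong) auto
  also have "\<dots> = (\<Sum>i<min m n. cinner (b i) x *\<^sub>C b i)"
    by (simp add: sum.If_cases) (rule sum.cong, auto)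
  finally show ?thesis by (simp add: pr_def)
qed

lemma residual_mono:
  assumes "m \<le> n" shows "norm (x - pr b n x) \<le> norm (x - pr b m x)"
proof -
  have "x - pr b n x = (x - pr b m x) - pr b n (x - pr b m x)" using assms by (simp add: pr_diff pr_pr)
  then show ?thesis using norm_residual by metis
qed

lemma cinner_pr_symmetric: "cinner (pr b n x) y = cinner x (pr b n y)"
proof -
  have "cnj (cinner (b i) x) = cinner x (b i)" for i by (metis cinner_commute)
  then show ?thesis by (simp add: pr_def cinner_sum_left cinner_sum_right cinner_scaleC_left cinner_scaleC_right mult.commute)
qed

text \<open>The residuals tend to 0 pointwise and are contractions decreasing in \<open>n\<close>,
  hence uniformly small on the totally bounded image of the unit ball; homogeneity extends the
  estimate to all \<open>x\<close>.\<close>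

lemma compact_operator_residual:
  assumes k: "k \<in> compact_operators" and e: "0 < e"
  shows "\<exists>n. \<forall>x. norm (k x - pr b n (k x)) \<le> e * norm x"
proof -
  obtain A where A: "finite A" "closure (k ` cball 0 1) \<subseteq> (\<Union>y\<in>A. ball y (e / 4))"
    using compact_operatorsD(3)[OF k] e unfolding compact_eq_totally_bounded by (meson zero_less_divide_iff zero_less_numeral)
  have "\<exists>n. norm (y - pr b n y) < e / 4" for y
    using LIMSEQ_D[OF complete[of y], of "e / 4"] e by (metis norm_minus_commute order_refl zero_less_divide_iff zero_less_numeral)
  then obtain n where n: "\<And>y. norm (y - pr b (n y) y) < e / 4" by metis
  define N where "N = Max (insert 0 (n ` A))"
  have unit: "norm (k x - pr b N (k x)) \<le> e" if x: "norm x \<le> 1" for x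
  proof -
    have "k x \<in> closure (k ` cball 0 1)" using x by (intro image_in_closure) simp
    then obtain y where y: "y \<in> A" "norm (k x - y) < e / 4"
      using A(2) by (auto simp: dist_norm norm_minus_commute)
    have "n y \<le> N" using y(1) A(1) by (simp add: N_def)
    then have "norm (y - pr b N y) < e / 4" using residual_mono n order_le_less_trans by blast
    moreover have "k x - pr b N (k x) = ((k x - y) - pr b N (k x - y)) + (y - pr b N y)" by (simp add: pr_diff)
    then have "norm (k x - pr b N (k x)) \<le> norm ((k x - y) - pr b N (k x - y)) + norm (y - pr b N y)"
      by (metis norm_triangle_ineq)
    ultimately show ?thesis using norm_residual[of "k x - y" N] y(2) e by linarith
  qed
  have bl: "bounded_linear (\<lambda>x. k x - pr b N (k x))"
    by (intro bounded_linear_sub compact_operator_bounded_linear k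
        bounded_linear_compose[OF bounded_linear_pr compact_operator_bounded_linear[OF k]])
  have "norm (k x - pr b N (k x)) \<le> e * norm x" for x
  proof (cases "x = 0")
    case True
    then show ?thesis using linear_0[OF bounded_linear.linear[OF bl]] by simp
  next
    case False
    have "k x - pr b N (k x) = norm x *\<^sub>R (k ((1 / norm x) *\<^sub>R x) - pr b N (k ((1 / norm x) *\<^sub>R x)))"
      using False linear_scale[OF bounded_linear.linear[OF bl], of "1 / norm x" x] by simp
    then have "norm (k x - pr b N (k x)) = norm x * norm (k ((1 / norm x) *\<^sub>R x) - pr b N (k ((1 / norm x) *\<^sub>R x)))"
      by (metis abs_norm_cancel norm_scaleR)
    also have "\<dots> \<le> norm x * e" using False by (intro mult_left_mono unit) auto
    finally show ?thesis by (simp add: mult.commute)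
  qed
  then show ?thesis by blast
qed

end

section \<open>Matrix units in the stabilisation\<close>

locale stabilised = orthonormal_basis b for b :: "nat \<Rightarrow> 'h::complex_hilbert_space" +
  fixes \<phi> :: "'d::unital_cstar_algebra \<Rightarrow> ('h \<Rightarrow> 'h) \<Rightarrow> 'a::cstar_algebra"
  assumes stabilisation: "stabilisation \<phi>"
begin

abbreviation "K \<equiv> (compact_operators :: ('h \<Rightarrow> 'h) set)"

lemmas stab_conjs = stabilisation[unfolded stabilisation_def]

lemma add_left: "k \<in> K \<Longrightarrow> \<phi> (d + e) k = \<phi> d k + \<phi> e k"
  by (rule stab_conjs[THEN conjunct1, rule_format])

lemma scaleC_left: "k \<in> K \<Longrightarrow> \<phi> (c *\<^sub>C d) k = c *\<^sub>C \<phi> d k"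
  by (rule stab_conjs[THEN conjunct2, THEN conjunct1, rule_format])

lemma add_right: "k \<in> K \<Longrightarrow> l \<in> K \<Longrightarrow> \<phi> d (\<lambda>x. k x + l x) = \<phi> d k + \<phi> d l"
  by (rule stab_conjs[THEN conjunct2, THEN conjunct2, THEN conjunct1, rule_format])

lemma scaleC_right: "k \<in> K \<Longrightarrow> \<phi> d (\<lambda>x. c *\<^sub>C k x) = c *\<^sub>C \<phi> d k"
  by (rule stab_conjs[THEN conjunct2, THEN conjunct2, THEN conjunct2, THEN conjunct1, rule_format])

lemma mult: "k \<in> K \<Longrightarrow> l \<in> K \<Longrightarrow> \<phi> (d * e) (k \<circ> l) = \<phi> d k * \<phi> e l"
  by (rule stab_conjs[THEN conjunct2, THEN conjunct2, THEN conjunct2, THEN conjunct2, THEN conjunct1, rule_format])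

lemma adj: "k \<in> K \<Longrightarrow> l \<in> K \<Longrightarrow> (\<And>x y. cinner (k x) y = cinner x (l y)) \<Longrightarrow> \<phi> (adj d) l = adj (\<phi> d k)"
  by (rule stab_conjs[THEN conjunct2, THEN conjunct2, THEN conjunct2, THEN conjunct2, THEN conjunct2,
    THEN conjunct1, rule_format])

lemma independent:
  assumes "finite F" "F \<subseteq> K" "\<And>c. (\<And>x. (\<Sum>k\<in>F. c k *\<^sub>C k x) = 0) \<Longrightarrow> \<forall>k\<in>F. c k = 0"
    and "(\<Sum>k\<in>F. \<phi> (D k) k) = 0" "k \<in> F"
  shows "D k = 0"
  by (rule stab_conjs[THEN conjunct2, THEN conjunct2, THEN conjunct2, THEN conjunct2, THEN conjunct2,
    THEN conjunct2, THEN conjunct1, rule_format, OF _ assms(5)]) (use assms(1-4) in auto)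

lemma dense: "closure (span {\<phi> d k | d k. k \<in> K}) = UNIV"
  by (rule stab_conjs[THEN conjunct2, THEN conjunct2, THEN conjunct2, THEN conjunct2, THEN conjunct2,
    THEN conjunct2, THEN conjunct2])

lemma zero_left: "k \<in> K \<Longrightarrow> \<phi> 0 k = 0"
  using scaleC_left[of k 0 0] by simp

lemma zero_right: "\<phi> d (\<lambda>x. 0) = 0"
  using scaleC_right[OF compact_operators_zero, of d 0] by simp

lemma scaleR_right: "k \<in> K \<Longrightarrow> \<phi> d (\<lambda>x. r *\<^sub>R k x) = r *\<^sub>R \<phi> d k"
  using scaleC_right[of k d "complex_of_real r"] by (simp add: scaleC_of_real)

lemma sum_right: "(\<And>i. i \<in> A \<Longrightarrow> f i \<in> K) \<Longrightarrow> \<phi> d (\<lambda>x. \<Sum>i\<in>A. f i x) = (\<Sum>i\<in>A. \<phi> d (f i))"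
proof (induction A rule: infinite_finite_induct)
  case (insert a A)
  have "f a \<in> K" "(\<lambda>x. \<Sum>i\<in>A. f i x) \<in> K"
    using insert.prems by (auto intro!: compact_operators_sum)
  then have "\<phi> d (\<lambda>x. f a x + (\<Sum>i\<in>A. f i x)) = \<phi> d (f a) + \<phi> d (\<lambda>x. \<Sum>i\<in>A. f i x)"
    by (rule add_right)
  also have "\<phi> d (\<lambda>x. \<Sum>i\<in>A. f i x) = (\<Sum>i\<in>A. \<phi> d (f i))"
    by (rule insert.IH) (simp add: insert.prems)
  finally show ?case by (simp add: insert.hyps)
qed (simp_all add: zero_right)

lemma pr_compact: "pr b n \<in> K"
  unfolding pr_def[abs_def] by (intro compact_operators_sum rank_one_compact)

section \<open>Diagonal operators on blocks of the basis\<close>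

context
  fixes n :: "nat \<Rightarrow> nat"
  assumes n: "mono n" "n 0 = 0"
begin

definition dp :: "nat \<Rightarrow> 'h \<Rightarrow> 'h" where "dp i y = pr b (n (Suc i)) y - pr b (n i) y"

lemma dp_bounded_linear: "bounded_linear (dp i)"
  unfolding dp_def[abs_def] by (intro bounded_linear_sub bounded_linear_pr)

lemma dp_scaleR: "dp i (r *\<^sub>R x) = r *\<^sub>R dp i x"
  by (rule linear_scale[OF bounded_linear.linear[OF dp_bounded_linear]])

lemma dp_scaleC: "dp i (c *\<^sub>C x) = c *\<^sub>C dp i x"
  by (simp add: dp_def pr_scaleC scaleC_diff_right)

lemma dp_dp: "dp j (dp i x) = (if i = j then dp i x else 0)"
proof -
  have m: "n (Suc i) \<le> n j" if "i < j" for i j using that n(1) by (auto intro: monoD)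
  have s: "n i \<le> n (Suc i)" for i using n(1) by (auto intro: monoD)
  consider "i = j" | "i < j" | "j < i" by linarith
  then show ?thesis
  proof cases
    case 1
    then show ?thesis using s[of i] by (simp add: dp_def pr_diff pr_pr min_def)
  next
    case 2
    then show ?thesis using m[OF 2] s[of i] s[of j] by (simp add: dp_def pr_diff pr_pr min_absorb2)
  next
    case 3
    then show ?thesis using m[OF 3] s[of i] s[of j] by (simp add: dp_def pr_diff pr_pr min_absorb1)
  qed
qed

lemma dp_residual: "norm (dp i y) \<le> 2 * norm (y - pr b (n i) y)"
proof -
  have "dp i y = (y - pr b (n i) y) - (y - pr b (n (Suc i)) y)" by (simp add: dp_def)
  then have "norm (dp i y) \<le> norm (y - pr b (n i) y) + norm (y - pr b (n (Suc i)) y)" by (metis norm_triangle_ineq4)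
  also have "norm (y - pr b (n (Suc i)) y) \<le> norm (y - pr b (n i) y)"
    by (rule residual_mono) (use n(1) in \<open>auto intro: monoD\<close>)
  finally show ?thesis by simp
qed

lemma norm_dp: "norm (dp i y) \<le> 2 * norm y"
  using dp_residual[of i y] norm_residual[of y "n i"] by simp

lemma dp_symmetric: "cinner (dp i x) y = cinner x (dp i y)"
  by (simp add: dp_def cinner_diff_left cinner_diff_right cinner_pr_symmetric)

lemma dp_compact: "dp i \<in> K"
proof -
  have "(\<lambda>x. pr b (n (Suc i)) x + (-1) *\<^sub>R pr b (n i) x) \<in> K"
    by (intro compact_operators_add compact_operators_scaleR pr_compact)
  then show ?thesis by (simp add: dp_def[abs_def])
qed

lemma sum_dp: "(\<Sum>i<m. dp i y) = pr b (n m) y"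
  by (induction m) (simp_all add: dp_def n(2) pr_def)

definition Dh :: "(nat \<Rightarrow> real) \<Rightarrow> 'h \<Rightarrow> 'h" where "Dh a y = (\<Sum>i. a i *\<^sub>R dp i y)"

text \<open>Geometric decay makes all series of blocks converge absolutely, with partial sums
  converging uniformly on the unit ball, so compactness is immediate.\<close>

definition decays :: "(nat \<Rightarrow> real) \<Rightarrow> bool" where "decays a \<longleftrightarrow> (\<exists>C. \<forall>i. \<bar>a i\<bar> \<le> C * (1/2) ^ i)"

lemma tail_bound:
  assumes C: "\<And>i. \<bar>a i\<bar> * norm (f i) \<le> C * (1/2) ^ i"
  shows "summable (\<lambda>i. a i *\<^sub>R (f i :: 'h))"
    and "norm ((\<Sum>i. a i *\<^sub>R f i) - (\<Sum>i<m. a i *\<^sub>R f i)) \<le> 2 * C * (1/2) ^ m"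
proof -
  have eq: "a i *\<^sub>R f i = (1/2) ^ i *\<^sub>R ((2 ^ i * a i) *\<^sub>R f i)" for i
    by (simp add: power_divide)
  have le: "norm ((2 ^ i * a i) *\<^sub>R f i) \<le> C" for i
  proof -
    have "2 ^ i * (\<bar>a i\<bar> * norm (f i)) \<le> 2 ^ i * (C * (1/2) ^ i)" using C by (intro mult_left_mono) auto
    also have "\<dots> = C" by (simp add: power_divide)
    finally show ?thesis by (simp add: abs_mult mult.assoc)
  qed
  have half: "(0::real) \<le> 1/2" "(1/2::real) < 1" by auto
  show s: "summable (\<lambda>i. a i *\<^sub>R f i)" unfolding eq by (rule geometric_series(1)[OF le half])
  have "(\<Sum>i. a i *\<^sub>R f i) - (\<Sum>i<m. a i *\<^sub>R f i) = (\<Sum>i. a (i + m) *\<^sub>R f (i + m))"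
    using suminf_split_initial_segment[OF s, of m] by simp
  also have "\<dots> = (\<Sum>i. (1/2) ^ i *\<^sub>R ((1/2) ^ m *\<^sub>R ((2 ^ (i + m) * a (i + m)) *\<^sub>R f (i + m))))"
    by (subst eq) (simp add: power_add mult.assoc)
  also have "norm \<dots> \<le> ((1/2) ^ m * C) / (1 - 1/2)"
  proof (rule geometric_series(2)[OF _ half])
    fix i
    have pos: "\<bar>(1/2::real) ^ m\<bar> = (1/2) ^ m" by simp
    have "(1/2) ^ m * norm ((2 ^ (i + m) * a (i + m)) *\<^sub>R f (i + m)) \<le> (1/2) ^ m * C"
      by (intro mult_left_mono le) simp
    then show "norm ((1/2) ^ m *\<^sub>R ((2 ^ (i + m) * a (i + m)) *\<^sub>R f (i + m))) \<le> (1/2) ^ m * C"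
      by (simp only: norm_scaleR[of "(1/2) ^ m"] pos)
  qed
  finally show "norm ((\<Sum>i. a i *\<^sub>R f i) - (\<Sum>i<m. a i *\<^sub>R f i)) \<le> 2 * C * (1/2) ^ m" by (simp add: mult_ac)
qed

lemma limit_compact:
  fixes F :: "nat \<Rightarrow> 'h \<Rightarrow> 'h"
  assumes F: "\<And>i. F i \<in> K" and C: "\<And>i x. \<bar>a i\<bar> * norm (F i x) \<le> C * norm x * (1/2) ^ i"
  shows "(\<lambda>x. \<Sum>i. a i *\<^sub>R F i x) \<in> K"
proof (rule compact_operators_limit)
  note s = tail_bound(1)[OF C]
  fix x y
  show "(\<Sum>i. a i *\<^sub>R F i (x + y)) = (\<Sum>i. a i *\<^sub>R F i x) + (\<Sum>i. a i *\<^sub>R F i y)"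
    by (simp add: suminf_add[OF s s] compact_operatorsD(1)[OF F] scaleR_add_right)
  show "(\<Sum>i. a i *\<^sub>R F i (c *\<^sub>C x)) = c *\<^sub>C (\<Sum>i. a i *\<^sub>R F i x)" for c
    by (simp add: bounded_linear.suminf[OF bounded_linear_scaleC_right_hilbert s] compact_operatorsD(2)[OF F] scaleC_scaleR)
next
  fix e :: real assume e: "0 < e"
  have "(\<lambda>m. 2 * C * (1/2) ^ m) \<longlonglongrightarrow> 2 * C * 0"
    by (intro tendsto_intros LIMSEQ_power_zero) auto
  then have "\<forall>\<^sub>F m in sequentially. 2 * C * (1/2) ^ m < e" by (rule order_tendstoD(2)) (use e in simp)
  then obtain m where m: "2 * C * (1/2) ^ m < e" using eventually_happens' sequentially_bot by blast
  show "\<exists>g\<in>K. \<forall>x\<in>cball 0 1. norm ((\<Sum>i. a i *\<^sub>R F i x) - g x) \<le> e"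
  proof (intro bexI ballI)
    show "(\<lambda>x. \<Sum>i<m. a i *\<^sub>R F i x) \<in> K" by (intro compact_operators_sum compact_operators_scaleR F)
    fix x :: 'h assume x: "x \<in> cball 0 1"
    have "norm ((\<Sum>i. a i *\<^sub>R F i x) - (\<Sum>i<m. a i *\<^sub>R F i x)) \<le> (2 * C * (1/2) ^ m) * norm x"
      using tail_bound(2)[OF C, of x m] by (simp add: mult_ac)
    also have "\<dots> \<le> e * 1" using m e x by (intro mult_mono) auto
    finally show "norm ((\<Sum>i. a i *\<^sub>R F i x) - (\<Sum>i<m. a i *\<^sub>R F i x)) \<le> e" by simp
  qed
qed

lemma decays_bound:
  assumes "decays a"
  obtains C where "\<And>i y. \<bar>a i\<bar> * norm (dp i y) \<le> C * norm y * (1/2) ^ i"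
proof -
  obtain C where C: "\<And>i. \<bar>a i\<bar> \<le> C * (1/2) ^ i" using assms by (auto simp: decays_def)
  show ?thesis
  proof (rule that[of "2 * C"])
    fix i y
    have "\<bar>a i\<bar> * norm (dp i y) \<le> (C * (1/2) ^ i) * (2 * norm y)"
      by (rule mult_mono[OF C norm_dp]) (use C[of i] in \<open>auto intro: order_trans[OF abs_ge_zero]\<close>)
    then show "\<bar>a i\<bar> * norm (dp i y) \<le> 2 * C * norm y * (1/2) ^ i" by (simp add: algebra_simps)
  qed
qed

lemma Dh_summable: "decays a \<Longrightarrow> summable (\<lambda>i. a i *\<^sub>R dp i y)"
proof -
  assume "decays a"
  then obtain C where "\<And>i y. \<bar>a i\<bar> * norm (dp i y) \<le> C * norm y * (1/2) ^ i" using decays_bound by blast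
  then show ?thesis by (rule tail_bound(1))
qed

lemma Dh_compact: "decays a \<Longrightarrow> Dh a \<in> K"
proof -
  assume "decays a"
  then obtain C where "\<And>i y. \<bar>a i\<bar> * norm (dp i y) \<le> C * norm y * (1/2) ^ i" using decays_bound by blast
  then show ?thesis unfolding Dh_def[abs_def] by (rule limit_compact[OF dp_compact])
qed

lemma dp_suminf:
  assumes "summable (\<lambda>i. a i *\<^sub>R dp i (f i))"
  shows "dp j (\<Sum>i. a i *\<^sub>R dp i (f i)) = a j *\<^sub>R dp j (f j)"
proof -
  have "dp j (\<Sum>i. a i *\<^sub>R dp i (f i)) = (\<Sum>i. dp j (a i *\<^sub>R dp i (f i)))"
    by (rule bounded_linear.suminf[OF dp_bounded_linear assms])
  also have "\<dots> = (\<Sum>i. if i = j then a j *\<^sub>R dp j (f j) else 0)"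
    by (rule suminf_cong) (auto simp: dp_scaleR dp_dp)
  also have "\<dots> = a j *\<^sub>R dp j (f j)" using sums_single[of j "\<lambda>_. a j *\<^sub>R dp j (f j)"] by (simp add: sums_iff)
  finally show ?thesis .
qed

lemma Dh_Dh: "decays c \<Longrightarrow> Dh a \<circ> Dh c = Dh (\<lambda>i. a i * c i)"
proof
  fix y assume "decays c"
  from dp_suminf[OF Dh_summable[OF this, of y]] have "dp j (Dh c y) = c j *\<^sub>R dp j y" for j
    unfolding Dh_def .
  then show "(Dh a \<circ> Dh c) y = Dh (\<lambda>i. a i * c i) y" by (simp add: Dh_def[of a] Dh_def[of "\<lambda>i. a i * c i"])
qed

lemma Dh_symmetric:
  assumes "decays a" shows "cinner (Dh a x) y = cinner x (Dh a y)"
proof -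
  have "cinner (Dh a x) y = (\<Sum>i. cinner (a i *\<^sub>R dp i x) y)"
    unfolding Dh_def by (rule bounded_linear.suminf[OF bounded_linear_cinner_left Dh_summable[OF assms]])
  also have "\<dots> = (\<Sum>i. cinner x (a i *\<^sub>R dp i y))"
    by (simp add: cinner_scaleR_left cinner_scaleR_right dp_symmetric)
  also have "\<dots> = cinner x (Dh a y)"
    unfolding Dh_def by (rule bounded_linear.suminf[OF bounded_linear_cinner Dh_summable[OF assms], symmetric])
  finally show ?thesis .
qed

lemma decays_mono:
  assumes "decays a" "\<And>i. \<bar>c i\<bar> \<le> \<bar>a i\<bar>" shows "decays c"
proof -
  obtain C where "\<And>i. \<bar>a i\<bar> \<le> C * (1/2) ^ i" using assms(1) by (auto simp: decays_def)
  then have "\<bar>c i\<bar> \<le> C * (1/2) ^ i" for i using assms(2) order_trans by blast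
  then show ?thesis by (auto simp: decays_def)
qed

text \<open>A *-homomorphism of the compact operators is bounded on diagonal operators, because
  \<open>a + \<i> \<surd>(1 - a\<^sup>2)\<close> is unitary and \<open>1 - \<surd>(1 - a\<^sup>2)\<close> again a compact diagonal operator.\<close>

lemma norm_phi_Dh:
  assumes d: "decays a" and a: "\<And>i. 0 \<le> a i" "\<And>i. a i \<le> 1"
  shows "norm (\<phi> 1 (Dh a)) \<le> 1"
proof -
  define g where "g i = 1 - sqrt (1 - (a i)\<^sup>2)" for i
  have a2: "(a i)\<^sup>2 \<le> 1" for i using a by (simp add: power_le_one)
  have "\<bar>g i\<bar> \<le> \<bar>a i\<bar>" for i
  proof -
    have "1 - a i \<le> sqrt (1 - (a i)\<^sup>2)"
    proof (rule real_le_rsqrt)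
      have "(1 - a i)\<^sup>2 = 1 - (a i)\<^sup>2 - 2 * (a i * (1 - a i))" by (simp add: power2_eq_square algebra_simps)
      then show "(1 - a i)\<^sup>2 \<le> 1 - (a i)\<^sup>2" using a by simp
    qed
    moreover have "sqrt (1 - (a i)\<^sup>2) \<le> 1" using a2[of i] by simp
    ultimately show ?thesis using a(1)[of i] by (simp add: g_def)
  qed
  then have dg: "decays g" using decays_mono[OF d] by blast
  \<comment> \<open>This is a^2 + (1 - g)^2 = 1 rearranged without the unit, so that it is an
    identity between compact operators to which \<open>\<phi> 1\<close> applies.\<close>
  have sq: "a i * a i + g i * g i = g i + g i" for i
  proof -
    have "sqrt (1 - (a i)\<^sup>2) * sqrt (1 - (a i)\<^sup>2) = 1 - (a i)\<^sup>2" using a2[of i] by simp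
    then show ?thesis by (simp add: g_def algebra_simps power2_eq_square)
  qed
  note Ka = Dh_compact[OF d] and Kg = Dh_compact[OF dg]
  define X where "X = \<phi> 1 (Dh a)"
  define Y where "Y = \<phi> 1 (Dh g)"
  have XX: "X * X = \<phi> 1 (Dh a \<circ> Dh a)" "Y * Y = \<phi> 1 (Dh g \<circ> Dh g)"
    "X * Y = \<phi> 1 (Dh a \<circ> Dh g)" "Y * X = \<phi> 1 (Dh g \<circ> Dh a)"
    unfolding X_def Y_def using mult[OF Ka Ka, of 1 1] mult[OF Kg Kg, of 1 1] mult[OF Ka Kg, of 1 1] mult[OF Kg Ka, of 1 1]
    by simp_all
  have com: "X * Y = Y * X" unfolding XX by (simp add: Dh_Dh d dg mult.commute)
  have aX: "adj X = X" "adj Y = Y"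
    unfolding X_def Y_def using adj[OF Ka Ka Dh_symmetric[OF d], of 1] adj[OF Kg Kg Dh_symmetric[OF dg], of 1] by simp_all
  have aa: "Dh a \<circ> Dh a \<in> K" "Dh g \<circ> Dh g \<in> K"
  proof -
    have "\<bar>a i * a i\<bar> \<le> \<bar>a i\<bar>" for i using a[of i] by (simp add: abs_mult mult_left_le)
    then have "decays (\<lambda>i. a i * a i)" by (rule decays_mono[OF d])
    then show "Dh a \<circ> Dh a \<in> K" by (simp add: Dh_Dh d Dh_compact)
    have "g i \<le> 1" "0 \<le> g i" for i using a2[of i] by (simp_all add: g_def)
    then have "\<bar>g i * g i\<bar> \<le> \<bar>g i\<bar>" for i by (simp add: abs_mult mult_left_le)
    then have "decays (\<lambda>i. g i * g i)" by (rule decays_mono[OF dg])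
    then show "Dh g \<circ> Dh g \<in> K" by (simp add: Dh_Dh dg Dh_compact)
  qed
  have "(\<lambda>x. (Dh a \<circ> Dh a) x + (Dh g \<circ> Dh g) x) = (\<lambda>x. Dh g x + Dh g x)"
  proof
    fix x
    have s2: "summable (\<lambda>i. (a i * a i) *\<^sub>R dp i x)" "summable (\<lambda>i. (g i * g i) *\<^sub>R dp i x)"
    proof -
      have "\<bar>a i * a i\<bar> \<le> \<bar>a i\<bar>" for i using a[of i] by (simp add: abs_mult mult_left_le)
      then show "summable (\<lambda>i. (a i * a i) *\<^sub>R dp i x)" by (intro Dh_summable decays_mono[OF d])
      have "g i \<le> 1" "0 \<le> g i" for i using a2[of i] by (simp_all add: g_def)
      then have "\<bar>g i * g i\<bar> \<le> \<bar>g i\<bar>" for i by (simp add: abs_mult mult_left_le)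
      then show "summable (\<lambda>i. (g i * g i) *\<^sub>R dp i x)" by (intro Dh_summable decays_mono[OF dg])
    qed
    have "(Dh a \<circ> Dh a) x + (Dh g \<circ> Dh g) x = (\<Sum>i. (a i * a i) *\<^sub>R dp i x + (g i * g i) *\<^sub>R dp i x)"
      unfolding Dh_Dh[OF d] Dh_Dh[OF dg] Dh_def by (rule suminf_add[OF s2])
    also have "\<dots> = (\<Sum>i. g i *\<^sub>R dp i x + g i *\<^sub>R dp i x)"
      by (simp add: scaleR_add_left[symmetric] sq)
    also have "\<dots> = Dh g x + Dh g x"
      unfolding Dh_def by (rule suminf_add[OF Dh_summable[OF dg] Dh_summable[OF dg], symmetric])
    finally show "(Dh a \<circ> Dh a) x + (Dh g \<circ> Dh g) x = Dh g x + Dh g x" .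
  qed
  then have "X * X + Y * Y = Y + Y"
    unfolding XX add_right[OF aa, symmetric] unfolding Y_def add_right[OF Kg Kg, symmetric] by simp
  then have "emb X * emb X + emb Y * emb Y = emb Y + emb Y" by (simp flip: emb_mult emb_add)
  then have "emb X * emb X + (1 - emb Y) * (1 - emb Y) = of_real 1"
    by (simp add: algebra_simps)
  then have "(norm (emb X))\<^sup>2 \<le> 1"
    using aX com by (intro norm_le_of_sum_squares[of _ "1 - emb Y"])
      (simp_all add: adj_diff algebra_simps flip: emb_adj emb_mult)
  then show ?thesis by (simp add: X_def power2_le_imp_le)
qed

text \<open>Norm continuity of \<open>\<phi> d\<close> is not part of the notion of stabilisation
  and is replaced by a factorisation: the remainder of \<open>k\<close> is 2^-i times a diagonal
  contraction composed with one compact operator \<open>k'\<close>. Multiplicativity and the bound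
  for diagonal operators then give the estimate.\<close>

lemma phi_tail:
  assumes k: "k \<in> K" and C: "\<And>i x. norm (k x - pr b (n i) (k x)) \<le> C * (1/4) ^ i * norm x"
  shows "\<exists>M. \<forall>i. norm (\<phi> d k - \<phi> d (\<lambda>x. pr b (n i) (k x))) \<le> M * (1/2) ^ i"
proof -
  define k' where "k' x = (\<Sum>i. 2 ^ i *\<^sub>R dp i (k x))" for x
  have bd: "\<bar>2 ^ i\<bar> * norm (dp i (k x)) \<le> 2 * C * norm x * (1/2) ^ i" for i x
  proof -
    have "norm (dp i (k x)) \<le> 2 * (C * (1/4) ^ i * norm x)" using dp_residual[of i "k x"] C[of x i] by linarith
    then have "2 ^ i * norm (dp i (k x)) \<le> 2 ^ i * (2 * (C * (1/4) ^ i * norm x))" by (intro mult_left_mono) auto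
    also have "\<dots> = 2 * C * norm x * (2 ^ i * (1/4) ^ i)" by (simp add: algebra_simps)
    also have "(2::real) ^ i * (1/4) ^ i = (1/2) ^ i" by (simp flip: power_mult_distrib)
    finally show ?thesis by simp
  qed
  have dpk: "(\<lambda>x. dp i (k x)) \<in> K" for i
    by (rule compact_operators_compose[OF k dp_bounded_linear dp_scaleC])
  have k': "k' \<in> K" unfolding k'_def[abs_def] by (rule limit_compact[OF dpk bd])
  have dpk': "dp i (k' x) = 2 ^ i *\<^sub>R dp i (k x)" for i x
    unfolding k'_def by (rule dp_suminf[OF tail_bound(1)[OF bd]])
  have "norm (\<phi> d k - \<phi> d (\<lambda>x. pr b (n i) (k x))) \<le> norm (\<phi> d k') * (1/2) ^ i" for i
  proof -
    \<comment> \<open>On the blocks j from i on, 2^-i, this weight 2^-(j-i) and the factor 2^j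
      hidden in \<open>k'\<close> cancel; all weights stay within [0,1], as
      \<open>norm_phi_Dh\<close> requires.\<close>
    define a where "a j = (if j < i then 0 else (1/2::real) ^ (j - i))" for j
    have "\<bar>a j\<bar> \<le> 2 ^ i * (1/2) ^ j" for j
      by (auto simp: a_def power_diff power_divide)
    then have da: "decays a" by (auto simp: decays_def)
    have Ka: "Dh a \<in> K" by (rule Dh_compact[OF da])
    have na: "norm (\<phi> 1 (Dh a)) \<le> 1" by (rule norm_phi_Dh[OF da]) (auto simp: a_def power_le_one)
    have eq: "(1/2) ^ i *\<^sub>R Dh a (k' x) = k x - pr b (n i) (k x)" for x
    proof -
      have "(\<lambda>j. dp j (k x)) sums k x"
        unfolding sums_def sum_dp
      proof (rule LIM_zero_cancel, rule Lim_null_comparison)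
        show "\<forall>\<^sub>F m in sequentially. norm (pr b (n m) (k x) - k x) \<le> C * (1/4) ^ m * norm x"
          using C by (simp add: norm_minus_commute)
        have "(\<lambda>m. C * (1/4) ^ m * norm x) \<longlonglongrightarrow> C * 0 * norm x"
          by (intro tendsto_intros LIMSEQ_power_zero) auto
        then show "(\<lambda>m. C * (1/4) ^ m * norm x) \<longlonglongrightarrow> 0" by simp
      qed
      then have "(\<lambda>j. dp (j + i) (k x)) sums (k x - pr b (n i) (k x))"
        using sums_split_initial_segment[of "\<lambda>j. dp j (k x)" "k x" i] by (simp add: sum_dp)
      moreover have "(\<lambda>j. a (j + i) *\<^sub>R dp (j + i) (k' x)) sums (Dh a (k' x) - (\<Sum>j<i. a j *\<^sub>R dp j (k' x)))"
        unfolding Dh_def by (rule sums_split_initial_segment[OF summable_sums[OF Dh_summable[OF da]]])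
      then have "(\<lambda>j. a (j + i) *\<^sub>R dp (j + i) (k' x)) sums Dh a (k' x)" by (simp add: a_def)
      then have "(\<lambda>j. (1/2) ^ i *\<^sub>R (a (j + i) *\<^sub>R dp (j + i) (k' x))) sums ((1/2) ^ i *\<^sub>R Dh a (k' x))"
        by (rule sums_scaleR_right)
      moreover have "(1/2) ^ i *\<^sub>R (a (j + i) *\<^sub>R dp (j + i) (k' x)) = dp (j + i) (k x)" for j
      proof -
        have "(1/2) ^ i * ((1/2) ^ j * 2 ^ (j + i)) = (1::real)" by (simp add: power_add power_divide)
        then show ?thesis by (simp add: a_def dpk')
      qed
      ultimately show ?thesis using sums_unique2 by auto
    qed
    have Kp: "(\<lambda>x. pr b (n i) (k x)) \<in> K"
      by (rule compact_operators_compose[OF k bounded_linear_pr pr_scaleC])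
    have "k = (\<lambda>x. pr b (n i) (k x) + (1/2) ^ i *\<^sub>R (Dh a \<circ> k') x)" by (simp add: fun_eq_iff eq)
    moreover have Kc: "Dh a \<circ> k' \<in> K"
      using compact_operators_compose[OF k' compact_operator_bounded_linear[OF Ka] compact_operatorsD(2)[OF Ka]]
      by (simp add: comp_def)
    ultimately have "\<phi> d k = \<phi> d (\<lambda>x. pr b (n i) (k x)) + (1/2) ^ i *\<^sub>R \<phi> d (Dh a \<circ> k')"
      using add_right[OF Kp compact_operators_scaleR[OF Kc], of d "(1/2) ^ i"] scaleR_right[OF Kc] by metis
    also have "\<phi> d (Dh a \<circ> k') = \<phi> 1 (Dh a) * \<phi> d k'" using mult[OF Ka k', of 1 d] by simp
    finally have "norm (\<phi> d k - \<phi> d (\<lambda>x. pr b (n i) (k x))) = (1/2) ^ i * norm (\<phi> 1 (Dh a) * \<phi> d k')" by simp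
    also have "\<dots> \<le> (1/2) ^ i * (1 * norm (\<phi> d k'))"
      using na by (intro mult_left_mono order_trans[OF norm_mult_ineq] mult_right_mono) auto
    finally show ?thesis by (simp add: mult.commute)
  qed
  then show ?thesis by blast
qed

end

text \<open>Block boundaries are adapted to the given \<open>k\<close>: compactness makes the
  remainder at the i-th boundary of order 4^-i, half of which, in the exponent, is spent on the
  weights 2^i in \<open>phi_tail\<close>.\<close>

lemma phi_pr_approx:
  assumes k: "k \<in> K" and e: "0 < e"
  shows "\<exists>m. norm (\<phi> d k - \<phi> d (\<lambda>x. pr b m (k x))) < e"
proof -
  have "\<forall>i. \<exists>m. \<forall>x. norm (k x - pr b m (k x)) \<le> (1/4) ^ i * norm x"
    by (intro allI compact_operator_residual[OF k]) simp
  then obtain m where m: "\<And>i x. norm (k x - pr b (m i) (k x)) \<le> (1/4) ^ i * norm x" by metis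
  \<comment> \<open>Partial sums enforce monotonicity and \<open>n 0 = 0\<close>. At index 0 nothing
    is projected, and there the bound \<open>B\<close> of \<open>k\<close> itself is used.\<close>
  define n where "n i = (\<Sum>j<i. m (Suc j))" for i
  have n: "mono n" "n 0 = 0" by (auto simp: n_def intro!: monoI sum_mono2)
  obtain B where B: "0 < B" "\<And>x. norm (k x) \<le> norm x * B"
    using bounded_linear.pos_bounded[OF compact_operator_bounded_linear[OF k]] by blast
  have C: "norm (k x - pr b (n i) (k x)) \<le> (B + 1) * (1/4) ^ i * norm x" for i x
  proof (cases i)
    case 0
    have "norm (k x) \<le> norm x * B + norm x" using B(2)[of x] by (simp add: add_increasing2)
    then show ?thesis using 0 by (simp add: n_def pr_def algebra_simps)
  next
    case (Suc j)
    have "m i \<le> n i" using Suc by (simp add: n_def)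
    then have "norm (k x - pr b (n i) (k x)) \<le> (1/4) ^ i * norm x" using residual_mono m order_trans by blast
    also have "\<dots> \<le> (B + 1) * ((1/4) ^ i * norm x)" using B(1) by (simp add: distrib_right)
    finally show ?thesis by (simp add: mult.assoc)
  qed
  obtain M where M: "\<And>i. norm (\<phi> d k - \<phi> d (\<lambda>x. pr b (n i) (k x))) \<le> M * (1/2) ^ i"
    using phi_tail[OF n k C] by blast
  have "(\<lambda>i. M * (1/2) ^ i) \<longlonglongrightarrow> M * 0" by (intro tendsto_intros LIMSEQ_power_zero) auto
  then have "\<forall>\<^sub>F i in sequentially. M * (1/2) ^ i < e" by (rule order_tendstoD(2)) (use e in simp)
  then obtain i where "M * (1/2) ^ i < e" using eventually_happens' sequentially_bot by blast
  then have "norm (\<phi> d k - \<phi> d (\<lambda>x. pr b (n i) (k x))) < e" using M[of i] by linarith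
  then show ?thesis by blast
qed

section \<open>The matrix algebra inside the stabilisation\<close>

definition eu :: "nat \<Rightarrow> nat \<Rightarrow> 'h \<Rightarrow> 'h" where "eu i j x = cinner (b j) x *\<^sub>C b i"

lemma eu_compact: "eu i j \<in> K" unfolding eu_def[abs_def] by (rule rank_one_compact)

lemma eu_comp: "eu i j \<circ> eu k l = (if j = k then eu i l else (\<lambda>x. 0))"
  by (auto simp: fun_eq_iff eu_def cinner_scaleC_right cinner_basis)

lemma eu_adj: "cinner (eu i j x) y = cinner x (eu j i y)"
proof -
  have "cnj (cinner (b j) x) = cinner x (b j)" by (metis cinner_commute)
  then show ?thesis by (simp add: eu_def cinner_scaleC_left cinner_scaleC_right mult.commute)
qed

lemma cinner_eu: "cinner (b k) (eu i j (b l)) = (if k = i \<and> l = j then 1 else 0)"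
  by (auto simp: eu_def cinner_scaleC_right cinner_basis)

definition \<psi> :: "'d minf \<Rightarrow> 'a" where
  "\<psi> x = (\<Sum>(i, j) | entry x i j \<noteq> 0. \<phi> (entry x i j) (eu i j))"

lemma psi_Mat:
  assumes "x \<in> Mat n" shows "\<psi> x = (\<Sum>i<n. \<Sum>j<n. \<phi> (entry x i j) (eu i j))"
proof -
  have "\<psi> x = (\<Sum>(i, j)\<in>{..<n} \<times> {..<n}. \<phi> (entry x i j) (eu i j))"
    unfolding \<psi>_def
    by (rule sum.mono_neutral_left) (use assms in \<open>auto simp: Mat_def zero_left[OF eu_compact]\<close>)
  then show ?thesis by (simp add: sum.cartesian_product)
qed

lemma star_hom_psi: "star_hom \<psi>"
proof
  fix x y :: "'d minf" and c
  obtain n where n: "x \<in> Mat n" "y \<in> Mat n" using ex_Mat3 by blast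
  note Kc = eu_compact
  show "\<psi> (x + y) = \<psi> x + \<psi> y"
    by (simp add: psi_Mat[OF n(1)] psi_Mat[OF n(2)] psi_Mat[OF plus_Mat[OF n]] entry_add add_left[OF Kc] sum.distrib)
  show "\<psi> (c *\<^sub>C x) = c *\<^sub>C \<psi> x"
    by (simp add: psi_Mat[OF n(1)] psi_Mat[OF scaleC_Mat[OF n(1)]] scaleC_minf.rep_eq scaleC_left[OF Kc] scaleC_sum)
  show "\<psi> (adj x) = adj (\<psi> x)"
  proof -
    have "adj (\<psi> x) = (\<Sum>i<n. \<Sum>j<n. \<phi> (adj (entry x i j)) (eu j i))"
      by (simp add: psi_Mat[OF n(1)] adj_sum adj[OF Kc Kc eu_adj])
    also have "\<dots> = \<psi> (adj x)" by (subst sum.swap) (simp add: psi_Mat[OF adj_Mat[OF n(1)]] entry_adj)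
    finally show ?thesis ..
  qed
  show "\<psi> (x * y) = \<psi> x * \<psi> y"
  proof -
    have fin: "\<phi> (\<Sum>k\<in>A. f k) (eu i j) = (\<Sum>k\<in>A. \<phi> (f k) (eu i j))" for A :: "nat set" and f i j
      by (induction A rule: infinite_finite_induct) (auto simp: zero_left[OF Kc] add_left[OF Kc])
    have prod: "\<phi> d (eu i j) * \<phi> e (eu k l) = (if k = j then \<phi> (d * e) (eu i l) else 0)" for d e i j k l
      unfolding mult[OF Kc Kc, symmetric] by (simp add: eu_comp zero_right)
    have "\<psi> x * \<psi> y = (\<Sum>i<n. \<Sum>j<n. \<Sum>k<n. \<Sum>l<n. if k = j then \<phi> (entry x i j * entry y k l) (eu i l) else 0)"
    proof -
      have "\<phi> d (eu i j) * \<psi> y = (\<Sum>k<n. \<Sum>l<n. if k = j then \<phi> (d * entry y k l) (eu i l) else 0)" for d i j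
        unfolding psi_Mat[OF n(2)] sum_distrib_left prod ..
      then show ?thesis unfolding psi_Mat[OF n(1)] sum_distrib_right by (simp only:)
    qed
    also have "\<dots> = (\<Sum>i<n. \<Sum>j<n. \<Sum>k<n. if k = j then (\<Sum>l<n. \<phi> (entry x i j * entry y j l) (eu i l)) else 0)"
      by (intro sum.cong refl) auto
    also have "\<dots> = (\<Sum>i<n. \<Sum>j<n. \<Sum>l<n. \<phi> (entry x i j * entry y j l) (eu i l))" by simp
    also have "\<dots> = (\<Sum>i<n. \<Sum>l<n. \<Sum>j<n. \<phi> (entry x i j * entry y j l) (eu i l))"
      by (intro sum.cong refl sum.swap)
    also have "\<dots> = \<psi> (x * y)" by (simp add: psi_Mat[OF times_Mat[OF n]] entry_times[OF n(1)] fin)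
    finally show ?thesis ..
  qed
qed

text \<open>The matrix units \<open>eu i j\<close> are linearly independent, as pairing with basis
  vectors isolates each coefficient, so the injectivity on sums of elementary tensors
  applies.\<close>

lemma psi_injective:
  assumes "\<psi> x = 0" shows "x = 0"
proof -
  obtain n where n: "x \<in> Mat n" using ex_Mat by blast
  define I where "I = {..<n} \<times> {..<n}"
  define F where "F = (\<lambda>(i, j). eu i j) ` I"
  have inj: "inj_on (\<lambda>(i, j). eu i j) I"
  proof (rule inj_onI, clarify)
    fix i j k l assume "eu i j = eu k l"
    then have "cinner (b k) (eu i j (b l)) = cinner (b k) (eu k l (b l))" by simp
    then show "i = k \<and> j = l" by (simp add: cinner_eu split: if_splits)
  qed
  \<comment> \<open>Injectivity of the tensor product is phrased for coefficients indexed by the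
    operators themselves, so the entries are reindexed along the injective map from pairs to matrix
    units.\<close>
  define D where "D k = (case inv_into I (\<lambda>(i, j). eu i j) k of (i, j) \<Rightarrow> entry x i j)" for k
  have D: "D (eu i j) = entry x i j" if "(i, j) \<in> I" for i j
    using inv_into_f_f[OF inj that] by (simp add: D_def)
  have D0: "D k = 0" if "k \<in> F" for k
  proof (rule independent[OF _ _ _ _ that])
    show "finite F" "F \<subseteq> K" by (auto simp: F_def I_def eu_compact)
    have "(\<Sum>k\<in>F. \<phi> (D k) k) = (\<Sum>(i, j)\<in>I. \<phi> (entry x i j) (eu i j))"
      unfolding F_def sum.reindex[OF inj] by (rule sum.cong) (auto simp: D)
    also have "\<dots> = \<psi> x" by (simp add: psi_Mat[OF n] I_def sum.cartesian_product)
    finally show "(\<Sum>k\<in>F. \<phi> (D k) k) = 0" by (simp add: assms)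
    fix c assume c: "\<And>y. (\<Sum>k\<in>F. c k *\<^sub>C k y) = 0"
    have "c (eu i j) = 0" if ij: "(i, j) \<in> I" for i j
    proof -
      have "0 = cinner (b i) (\<Sum>k\<in>F. c k *\<^sub>C k (b j))" by (simp add: c)
      also have "\<dots> = (\<Sum>p\<in>I. c (eu (fst p) (snd p)) * cinner (b i) (eu (fst p) (snd p) (b j)))"
        unfolding F_def sum.reindex[OF inj] cinner_sum_right
        by (simp add: cinner_scaleC_right case_prod_beta)
      also have "\<dots> = (\<Sum>p\<in>I. if p = (i, j) then c (eu i j) else 0)"
        by (rule sum.cong) (auto simp: cinner_eu)
      also have "\<dots> = c (eu i j)" using ij by (simp add: I_def)
      finally show ?thesis by simp
    qed
    then show "\<forall>k\<in>F. c k = 0" by (auto simp: F_def)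
  qed
  then have "entry x i j = 0" if "i < n" "j < n" for i j
    using that D[of i j] D0[of "eu i j"] by (auto simp: F_def I_def)
  moreover have "i < n \<and> j < n" if "entry x i j \<noteq> 0" for i j using n that by (simp add: Mat_def)
  ultimately have "entry x i j = 0" for i j by blast
  then show ?thesis by (intro minf_eqI) simp
qed

lemma
  shows closure_psi_add: "x \<in> closure (range \<psi>) \<Longrightarrow> y \<in> closure (range \<psi>) \<Longrightarrow> x + y \<in> closure (range \<psi>)"
    and closure_psi_scaleR: "x \<in> closure (range \<psi>) \<Longrightarrow> r *\<^sub>R x \<in> closure (range \<psi>)"
    and closure_psi_adj: "x \<in> closure (range \<psi>) \<Longrightarrow> adj x \<in> closure (range \<psi>)"
proof -
  interpret psi: star_hom \<psi> by (rule star_hom_psi)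
  show "x + y \<in> closure (range \<psi>)" if xy: "x \<in> closure (range \<psi>)" "y \<in> closure (range \<psi>)"
  proof -
    obtain u v where uv: "\<And>n. u n \<in> range \<psi>" "u \<longlonglongrightarrow> x" "\<And>n. v n \<in> range \<psi>" "v \<longlonglongrightarrow> y"
      using xy by (auto simp: closure_sequential)
    have "u n + v n \<in> range \<psi>" for n
    proof -
      obtain z w where "u n = \<psi> z" "v n = \<psi> w" using uv(1)[of n] uv(3)[of n] by blast
      then show ?thesis by (simp add: psi.add[symmetric])
    qed
    then show ?thesis
      unfolding closure_sequential using tendsto_add[OF uv(2,4)] by (intro exI[of _ "\<lambda>n. u n + v n"]) simp
  qed
  have map: "f x \<in> closure (range \<psi>)" if "bounded_linear f" "\<And>z. f (\<psi> z) \<in> range \<psi>" "x \<in> closure (range \<psi>)" for f x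
  proof -
    have "f ` closure (range \<psi>) \<subseteq> closure (range \<psi>)"
    proof (rule image_closure_subset)
      show "continuous_on (closure (range \<psi>)) f" using that(1) by (rule linear_continuous_on)
      show "f ` range \<psi> \<subseteq> closure (range \<psi>)" using that(2) closure_subset by blast
    qed simp
    then show ?thesis using that(3) by blast
  qed
  show "x \<in> closure (range \<psi>) \<Longrightarrow> r *\<^sub>R x \<in> closure (range \<psi>)"
    by (rule map[OF bounded_linear_scaleR_right]) (simp add: psi.scaleR[symmetric])
  show "x \<in> closure (range \<psi>) \<Longrightarrow> adj x \<in> closure (range \<psi>)"
    by (rule map[OF bounded_linear_adj]) (simp add: psi.adj[symmetric])
qed

lemma closure_psi_sum: "(\<And>i. i \<in> A \<Longrightarrow> f i \<in> closure (range \<psi>)) \<Longrightarrow> sum f A \<in> closure (range \<psi>)"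
proof (induction A rule: infinite_finite_induct)
  case empty
  have "\<psi> 0 = 0" by (rule star_hom.zero[OF star_hom_psi])
  then show ?case using closure_subset[of "range \<psi>"] by (metis sum.empty rangeI subsetD)
next
  case (infinite A)
  have "\<psi> 0 = 0" by (rule star_hom.zero[OF star_hom_psi])
  then show ?case using closure_subset[of "range \<psi>"] infinite by (metis sum.infinite rangeI subsetD)
qed (auto intro: closure_psi_add)

lemma phi_eu_range: "\<phi> d (eu i j) \<in> range \<psi>"
proof -
  have "\<psi> (matrix_unit i j d) = (\<Sum>p | p = (i, j) \<and> d \<noteq> 0. \<phi> d (eu i j))"
    unfolding \<psi>_def by (rule sum.cong) (auto simp: entry_matrix_unit split: if_splits)
  also have "\<dots> = \<phi> d (eu i j)" by (cases "d = 0") (simp_all add: zero_left[OF eu_compact])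
  finally show ?thesis by (metis rangeI)
qed

text \<open>Cutting the range vector \<open>v\<close> by \<open>pr b m\<close> leaves a finite
  combination of matrix units. The case of \<open>v\<close> on the other side follows by taking
  adjoints.\<close>

lemma phi_rank_one: "\<phi> d (\<lambda>x. cinner (b i) x *\<^sub>C v) \<in> closure (range \<psi>)" "\<phi> d (\<lambda>x. cinner v x *\<^sub>C b i) \<in> closure (range \<psi>)"
proof -
  interpret psi: star_hom \<psi> by (rule star_hom_psi)
  show *: "\<phi> d (\<lambda>x. cinner (b i) x *\<^sub>C v) \<in> closure (range \<psi>)" for d
    unfolding closure_approachable
  proof (intro allI impI)
    fix e :: real assume e: "0 < e"
    obtain m where m: "norm (\<phi> d (\<lambda>x. cinner (b i) x *\<^sub>C v) - \<phi> d (\<lambda>x. pr b m (cinner (b i) x *\<^sub>C v))) < e"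
      using phi_pr_approx[OF rank_one_compact e] by blast
    have "(\<lambda>x. pr b m (cinner (b i) x *\<^sub>C v)) = (\<lambda>x. \<Sum>j<m. cinner (b j) v *\<^sub>C eu j i x)"
      by (simp add: fun_eq_iff pr_def eu_def cinner_scaleC_right scaleC_scaleC mult.commute)
    then have "\<phi> d (\<lambda>x. pr b m (cinner (b i) x *\<^sub>C v)) = (\<Sum>j<m. \<phi> d (\<lambda>x. cinner (b j) v *\<^sub>C eu j i x))"
      using sum_right[of "{..<m}" "\<lambda>j x. cinner (b j) v *\<^sub>C eu j i x" d]
        compact_operators_compose[OF eu_compact bounded_linear_scaleC_right_hilbert] 
      by (simp add: scaleC_scaleC mult.commute)
    also have "\<dots> = (\<Sum>j<m. cinner (b j) v *\<^sub>C \<phi> d (eu j i))" by (simp add: scaleC_right[OF eu_compact])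
    also have "\<dots> \<in> range \<psi>"
    proof -
      have "\<forall>j. \<exists>z. \<phi> d (eu j i) = \<psi> z" using phi_eu_range by blast
      then obtain z where "\<And>j. \<phi> d (eu j i) = \<psi> (z j)" by metis
      then show ?thesis by (simp add: psi.scaleC[symmetric] psi.sum[symmetric])
    qed
    finally show "\<exists>y\<in>range \<psi>. dist y (\<phi> d (\<lambda>x. cinner (b i) x *\<^sub>C v)) < e"
      using m by (metis dist_norm norm_minus_commute)
  qed
  have "cinner (cinner (b i) x *\<^sub>C v) y = cinner x (cinner v y *\<^sub>C b i)" for x y
  proof -
    have "cnj (cinner (b i) x) = cinner x (b i)" by (metis cinner_commute)
    then show ?thesis by (simp add: cinner_scaleC_left cinner_scaleC_right mult.commute)
  qed
  then have "\<phi> (adj (adj d)) (\<lambda>x. cinner v x *\<^sub>C b i) = adj (\<phi> (adj d) (\<lambda>x. cinner (b i) x *\<^sub>C v))"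
    by (intro adj rank_one_compact)
  then show "\<phi> d (\<lambda>x. cinner v x *\<^sub>C b i) \<in> closure (range \<psi>)"
    using closure_psi_adj[OF *[of "adj d"]] by (simp add: adj_adj)
qed

text \<open>\<open>pr b m\<close> composed with \<open>k\<close> is a finite sum of rank-one
  operators onto the basis vectors; the Riesz representation of the functionals
  \<open>cinner (b i) (k x)\<close> brings them into the form already treated.\<close>

lemma phi_closure_range:
  assumes k: "k \<in> K" shows "\<phi> d k \<in> closure (range \<psi>)"
proof -
  have "\<exists>y\<in>closure (range \<psi>). dist y (\<phi> d k) < e" if e: "0 < e" for e
  proof -
    obtain m where m: "norm (\<phi> d k - \<phi> d (\<lambda>x. pr b m (k x))) < e" using phi_pr_approx[OF k e] by blast
    have "\<exists>v. \<forall>x. cinner (b i) (k x) = cinner v x" for i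
    proof -
      have "bounded_linear (\<lambda>x. cinner (b i) (k x))"
        by (rule bounded_linear_compose[OF bounded_linear_cinner compact_operator_bounded_linear[OF k]])
      moreover have "cinner (b i) (k (c *\<^sub>C x)) = c * cinner (b i) (k x)" for c x
        by (simp add: compact_operatorsD(2)[OF k] cinner_scaleC_right)
      ultimately show ?thesis using riesz[of "\<lambda>x. cinner (b i) (k x)"] by metis
    qed
    then obtain v where v: "\<And>i x. cinner (b i) (k x) = cinner (v i) x" by metis
    have "\<phi> d (\<lambda>x. pr b m (k x)) = (\<Sum>i<m. \<phi> d (\<lambda>x. cinner (v i) x *\<^sub>C b i))"
      unfolding pr_def v by (rule sum_right) (rule rank_one_compact)
    also have "\<dots> \<in> closure (range \<psi>)" by (intro closure_psi_sum phi_rank_one(2))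
    finally show ?thesis using m by (metis dist_norm norm_minus_commute)
  qed
  then have "\<phi> d k \<in> closure (closure (range \<psi>))" unfolding closure_approachable[of _ "closure (range \<psi>)"] by blast
  then show ?thesis by simp
qed

lemma matrix_dense_psi: "matrix_dense \<psi>"
proof -
  have sub: "subspace (closure (range \<psi>))"
    using closure_psi_sum[of "{}" id] closure_psi_add closure_psi_scaleR by (auto simp: subspace_def)
  have "span {\<phi> d k | d k. k \<in> K} \<subseteq> closure (range \<psi>)"
    by (rule span_minimal[OF _ sub]) (use phi_closure_range in auto)
  then have "closure (span {\<phi> d k | d k. k \<in> K}) \<subseteq> closure (range \<psi>)" by (rule closure_minimal) simp
  then have "closure (range \<psi>) = UNIV" using dense by blast
  then show ?thesis
    by (intro matrix_dense.intro star_hom_psi matrix_dense_axioms.intro psi_injective)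
qed

end

text \<open>The infimum of the empty set is \<open>\<infinity>\<close>, so finiteness provides an
  admissible \<open>r\<close>. Whether the infimum is attained does not matter, as any admissible
  \<open>r\<close> serves.\<close>

lemma projection_comparison_witness:
  assumes "Inf {ereal r | r. 0 \<le> r \<and> C r} < \<infinity>"
  obtains r where "0 \<le> r" "C r"
proof -
  have "{ereal r | r. 0 \<le> r \<and> C r} \<noteq> {}"
  proof
    assume eq: "{ereal r | r. 0 \<le> r \<and> C r} = {}"
    show False using assms unfolding eq by (simp add: top_ereal_def)
  qed
  then show ?thesis using that by blast
qed

theorem corollary1p2:
  fixes \<phi> :: "'d::unital_cstar_algebra \<Rightarrow> ('h::complex_hilbert_space \<Rightarrow> 'h) \<Rightarrow> 'a::cstar_algebra"
  assumes "simple_cstar_algebra TYPE('d)"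
    and "stably_finite TYPE('d)"
    and "(QT21 :: ('d \<Rightarrow> complex) set) \<noteq> {}"
    and "separable_infinite_dim TYPE('h)"
    and "stabilisation \<phi>"
  shows "(rc_p TYPE('d) < \<infinity> \<longrightarrow> \<not> (\<exists>J::'a set. maximal_ideal J) \<and> (Ped :: 'a set) \<noteq> UNIV) \<and>
    (rc TYPE('d) < \<infinity> \<longrightarrow> \<not> (\<exists>J::'a set. maximal_ideal J) \<and> (Ped :: 'a set) \<noteq> UNIV) \<and>
    (strict_comparison TYPE('d) \<longrightarrow> \<not> (\<exists>J::'a set. maximal_ideal J) \<and> (Ped :: 'a set) \<noteq> UNIV)"
proof -
  obtain b :: "nat \<Rightarrow> 'h" where b: "\<And>n. orthonormal_upto n b" "\<And>x. (\<lambda>n. pr b n x) \<longlonglongrightarrow> x"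
    using ex_orthonormal_basis[OF assms(4)] by blast
  interpret stabilised b \<phi>
    using b assms(5) by unfold_locales
  interpret dense: matrix_dense \<psi> by (rule matrix_dense_psi)
  have main: "\<not> (\<exists>J::'a set. maximal_ideal J) \<and> (Ped :: 'a set) \<noteq> UNIV"
    if "0 \<le> r" "\<And>q b :: 'd minf. projection q \<Longrightarrow> positive b \<Longrightarrow> dim_gap r q b \<Longrightarrow> cuntz_le q b" for r
    using dense.no_maximal_ideal[OF assms(1) that(2,1)] dense.Ped_proper[OF assms(1) that(2)] by blast
  \<comment> \<open>A projection equals \<open>adj q * q\<close> and is thus positive, so comparison
    for all positive elements includes comparison for projections with the same
    \<open>r\<close>.\<close>
  have comp: "cuntz_le q b"
    if "has_comparison TYPE('d) r" "projection q" "positive b" "dim_gap r q b" for r and q b :: "'d minf"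
  proof -
    have "positive q" using that(2) positiveI[of q] by (simp add: projection_def)
    then show ?thesis using that by (simp add: has_comparison_def)
  qed
  show ?thesis
  proof (intro conjI[of "_ \<longrightarrow> _"] impI)
    assume "rc_p TYPE('d) < \<infinity>"
    then obtain r where "0 \<le> r" "\<forall>q b :: 'd minf. projection q \<and> positive b \<and> dim_gap r q b \<longrightarrow> cuntz_le q b"
      unfolding rc_p_def by (rule projection_comparison_witness)
    then show "\<not> (\<exists>J::'a set. maximal_ideal J) \<and> (Ped :: 'a set) \<noteq> UNIV" using main by blast
  next
    assume "rc TYPE('d) < \<infinity>"
    then obtain r where "0 \<le> r" "has_comparison TYPE('d) r"
      unfolding rc_def by (rule projection_comparison_witness)
    then show "\<not> (\<exists>J::'a set. maximal_ideal J) \<and> (Ped :: 'a set) \<noteq> UNIV" using main comp by blast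
  next
    assume "strict_comparison TYPE('d)"
    then show "\<not> (\<exists>J::'a set. maximal_ideal J) \<and> (Ped :: 'a set) \<noteq> UNIV"
      unfolding strict_comparison_def using main[of 0] comp by blast
  qed
qed

end
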